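(* Let $\mu\in(0,1)$ and consider asymptotics in $(m,n)$ with $m\to\infty$ and $n/m\to\mu$; set $N=m-n$. For all $y \geqslant 0$, $$\frac{1}{N} \log \mathbb{P}(d_{m,n} - \mathbb{E}[d_{m,n}] \leqslant -N y) \xrightarrow[m\to \infty]{} -\Lambda^*\Bigl( \frac{1}{1-\mu}, \frac{\mu^2}{2(1-\mu)^2}-y \Bigr) ,$$ where $\Lambda^*$ is the Fenchel-Legendre transform of the function $\Lambda\colon \mathbb{R}^2\to (-\infty,\infty]$ defined by $$\Lambda(s,t) = \log \sum_{l=1}^\infty \frac{e^{(s-\mu)l} (\mu l)^{l-1}}{l!} \mathbb{E}[e^{t d_{l,l-1}}] .$$
   Context: Hashing with linear probing (parking on a circle): for integers $1\leqslant m$ and $0 \leqslant n \leqslant m$, there are $m$ parking spaces numbered $1,\dots,m$ and arranged cyclically ($m$ is followed by $1$). $n$ cars arrive sequentially; their addresses are independent and uniformly distributed on $\{1,\dots,m\}$. A car with address $h$ parks at the first unoccupied space in the cyclic order $h, h+1,\dots,m,1,2,\dots,h-1$. The displacement of a car is the number of spaces it moves from its address to the space where it parks (it is $0$ if its address is unoccupied). The total displacement $d_{m,n}$ is the sum of the displacements of the $n$ cars. The Fenchel-Legendre transform of $\Lambda\colon\mathbb{R}^2\to(-\infty,\infty]$ is $\Lambda^*(x,z)=\sup\{sx+tz-\Lambda(s,t) : (s,t)\in\mathbb{R}^2\}$. Convention: $\log 0=-\infty$.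
   Formalization: At the single value y = μ²/(2(1−μ)²) the formal theorem additionally assumes N y ≤ E[d_{m,n}] for all large m; without it the event is empty infinitely often and the stated limit, which is finite there, fails (e.g. n = ⌊μm⌋). *)

theory Defs
  imports "HOL-Probability.Probability"
begin

text \<open>
  Parking on a circle with spaces \<open>{1..m}\<close>. A list of addresses is processed from left to right;
  \<open>S\<close> is the set of currently occupied spaces.
\<close>

definition space_after :: "nat \<Rightarrow> nat \<Rightarrow> nat \<Rightarrow> nat" where
  "space_after m h j = (h - 1 + j) mod m + 1"

text \<open>
  The minimum ranges over a nonempty set as long as some space is unoccupied, i.e. whenever at most
  \<open>m\<close> cars park in total; otherwise the value is meaningless.
\<close>

definition displacement :: "nat \<Rightarrow> nat set \<Rightarrow> nat \<Rightarrow> nat" where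
  "displacement m S h = (LEAST j. space_after m h j \<notin> S)"

primrec displacement_sum :: "nat \<Rightarrow> nat set \<Rightarrow> nat list \<Rightarrow> nat" where
  "displacement_sum m S [] = 0"
| "displacement_sum m S (h # hs) =
     displacement m S h
     + displacement_sum m (insert (space_after m h (displacement m S h)) S) hs"

definition total_displacement :: "nat \<Rightarrow> nat list \<Rightarrow> nat" where
  "total_displacement m hs = displacement_sum m {} hs"

definition addresses :: "nat \<Rightarrow> nat \<Rightarrow> nat list pmf" where
  "addresses m n = replicate_pmf n (pmf_of_set {1..m})"

definition expected_displacement :: "nat \<Rightarrow> nat \<Rightarrow> real" where
  "expected_displacement m n =
     measure_pmf.expectation (addresses m n) (\<lambda>hs. real (total_displacement m hs))"

definition displacement_mgf :: "nat \<Rightarrow> nat \<Rightarrow> real \<Rightarrow> real" where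
  "displacement_mgf m n t =
     measure_pmf.expectation (addresses m n) (\<lambda>hs. exp (t * real (total_displacement m hs)))"

definition ext_ln :: "ennreal \<Rightarrow> ereal" where
  "ext_ln x = (if x = 0 then -\<infinity> else if x = \<infinity> then \<infinity> else ereal (ln (enn2real x)))"

definition Lambda_term :: "real \<Rightarrow> real \<Rightarrow> real \<Rightarrow> nat \<Rightarrow> real" where
  "Lambda_term \<mu> s t l =
     exp ((s - \<mu>) * real l) * (\<mu> * real l) ^ (l - 1) / fact l * displacement_mgf l (l - 1) t"

text \<open>The series over \<open>l \<ge> 1\<close> is shifted to start at 0.\<close>

definition Lambda :: "real \<Rightarrow> real \<times> real \<Rightarrow> ereal" where
  "Lambda \<mu> = (\<lambda>(s, t). ext_ln (\<Sum>l. ennreal (Lambda_term \<mu> s t (Suc l))))"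

definition fenchel_legendre :: "(real \<times> real \<Rightarrow> ereal) \<Rightarrow> real \<times> real \<Rightarrow> ereal" where
  "fenchel_legendre F = (\<lambda>(x, z). SUP (s, t). ereal (s * x + t * z) - F (s, t))"

end

theory Submission
  imports Defs
begin

text \<open>
  Condition on space \<open>m\<close> staying empty (by rotation invariance this has probability \<open>N / m\<close>) and cut
  the circle at the \<open>N = m - n\<close> empty spaces. The \<open>N\<close> resulting blocks are independent apart from
  the constraint that their lengths add up to \<open>m\<close>: if \<open>w l j\<close> is the weight of a block of length \<open>l\<close>
  with displacement \<open>j\<close>, tilted by \<open>e\<^sup>-\<^sup>\<mu>\<^sup>l \<mu>\<^sup>l\<^sup>-\<^sup>1\<close>, then \<open>P(d \<le> r)\<close> is, up to an explicit factor
  \<open>e\<^sup>o\<^sup>(\<^sup>N\<^sup>)\<close>, the \<open>N\<close>-fold convolution of \<open>w\<close> at length \<open>m\<close> and displacement at most \<open>r\<close>, and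
  \<open>\<Lambda>(s, t)\<close> is the logarithm of \<open>\<Sum> w l j e\<^sup>s\<^sup>l\<^sup>+\<^sup>t\<^sup>j\<close>.

  The upper bound is Chernoff's inequality with \<open>t \<le> 0\<close>; for \<open>t > 0\<close> the series diverges. For the
  lower bound with \<open>z = \<mu>\<^sup>2 / (2 (1 - \<mu>)\<^sup>2) - y > 0\<close>, truncate the block length, tilt to the minimiser of
  the truncated generating function over \<open>t \<le> 0\<close>, apply Chebyshev's inequality, and hit the length \<open>m\<close>
  exactly with a few blocks of displacement 0; a compactness argument removes the truncation. For
  \<open>z = 0\<close> the probability of displacement 0 is explicit, and for \<open>z < 0\<close> both sides are infinite.

  The mean of \<open>d\<close> comes from the flow \<open>X\<^sub>p\<close> of cars leaving space \<open>p\<close>: with \<open>A\<^sub>p\<close> the number of cars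
  whose address is \<open>p\<close>, squaring \<open>X\<^sub>p + [p occupied] = X\<^sub>p\<^sub>-\<^sub>1 + A\<^sub>p\<close> and summing over \<open>p\<close> gives a
  recursion in \<open>n\<close>.
\<close>

section \<open>Parking on a circle\<close>

text \<open>The event bounds the displacement from one side only, so tilts with t \<le> 0 suffice.
  This matches the divergence of \<Lambda> for t > 0: clustering all addresses in a fixed fraction
  of a block costs a factor exponential in its length l, but forces a displacement of order l^2. The
  obstacle is that the optimal tilt may lie on the boundary t = 0, where \<Lambda> cannot be
  differentiated in t. Truncation turns the generating function into a finite sum, smooth
  everywhere; its minimiser over t \<le> 0 satisfies complementary slackness, which is all that a
  one-sided constraint needs. The length constraint is an exact equality, invisible to Chebyshev's
  inequality; a small proportion of filler blocks absorbs the fluctuations at an arbitrarily small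
  exponential rate. Since only rates matter, a factorial estimate with logarithmic error and events
  of probability 1/2 are precise enough. The recursion for the mean rests on the fact that the flow
  depends only on the multiset of addresses, so that any car may be regarded as the last to
  arrive.\<close>

definition words :: "nat \<Rightarrow> nat \<Rightarrow> nat list set" where
  "words m n = {hs. set hs \<subseteq> {1..m} \<and> length hs = n}"

lemma mem_words: "hs \<in> words m n \<longleftrightarrow> set hs \<subseteq> {1..m} \<and> length hs = n"
  by (simp add: words_def)

definition park :: "nat \<Rightarrow> nat set \<Rightarrow> nat \<Rightarrow> nat" where
  "park m S h = space_after m h (displacement m S h)"

primrec occupied :: "nat \<Rightarrow> nat set \<Rightarrow> nat list \<Rightarrow> nat set" where
  "occupied m S [] = S"
| "occupied m S (h # hs) = occupied m (insert (park m S h) S) hs"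

lemma displacement_sum_Cons:
  "displacement_sum m S (h # hs) = displacement m S h + displacement_sum m (insert (park m S h) S) hs"
  by (simp add: park_def)

lemma finite_words: "finite (words m n)"
  using finite_lists_length_eq[of "{1..m}" n] by (simp add: words_def)

lemma card_words: "card (words m n) = m ^ n"
  using card_lists_length_eq[of "{1..m}" n] by (simp add: words_def)

lemma space_after_mem: "0 < m \<Longrightarrow> space_after m h j \<in> {1..m}"
  by (auto simp: space_after_def Suc_le_eq)

lemma inj_on_space_after: "inj_on (space_after m h) {..<m}"
proof (rule linorder_inj_onI)
  fix i j assume ij: "i < j" "i \<in> {..<m}" "j \<in> {..<m}"
  show "space_after m h i \<noteq> space_after m h j"
  proof
    assume "space_after m h i = space_after m h j"
    then have "m dvd (h - 1 + j) - (h - 1 + i)"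
      using ij by (subst mod_eq_dvd_iff_nat[symmetric]) (auto simp: space_after_def)
    then show False using ij by (auto dest: dvd_imp_le)
  qed
qed auto

lemma image_space_after:
  assumes "0 < m" shows "space_after m h ` {..<m} = {1..m}"
proof (rule card_seteq)
  show "space_after m h ` {..<m} \<subseteq> {1..m}" using space_after_mem[OF assms] by blast
  show "card {1..m} \<le> card (space_after m h ` {..<m})"
    by (simp add: card_image[OF inj_on_space_after])
qed simp

lemma displacement_free:
  assumes "p \<in> {1..m}" "p \<notin> S"
  shows "displacement m S h < m" "park m S h \<notin> S" "park m S h \<in> {1..m}"
proof -
  have m: "0 < m" using assms by auto
  obtain j where j: "j < m" "space_after m h j \<notin> S"
    using assms image_space_after[OF m, of h] by (metis imageE lessThan_iff)
  show "park m S h \<notin> S" unfolding park_def displacement_def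
    using j(2) by (rule LeastI)
  have "displacement m S h \<le> j" unfolding displacement_def
    using j(2) by (rule Least_le)
  then show "displacement m S h < m" using j by simp
  show "park m S h \<in> {1..m}" unfolding park_def by (rule space_after_mem[OF m])
qed

lemma ex_free: "S \<subseteq> {1..m} \<Longrightarrow> card S < m \<Longrightarrow> \<exists>p\<in>{1..m}. p \<notin> S"
  by (metis card_atLeastAtMost diff_Suc_1 not_less_iff_gr_or_eq subset_antisym subsetI subset_eq)

lemma park_step:
  assumes "S \<subseteq> {1..m}" "card S + Suc k \<le> m"
  shows "insert (park m S h) S \<subseteq> {1..m}" "card (insert (park m S h) S) = Suc (card S)"
    "card (insert (park m S h) S) + k \<le> m"
proof -
  obtain p where "p \<in> {1..m}" "p \<notin> S" using ex_free[of S m] assms by auto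
  from displacement_free[OF this, of h] assms show "insert (park m S h) S \<subseteq> {1..m}"
    "card (insert (park m S h) S) = Suc (card S)" "card (insert (park m S h) S) + k \<le> m"
    by (auto simp: finite_subset[OF assms(1)])
qed

lemma occupied_mono: "S \<subseteq> occupied m S hs"
  by (induction hs arbitrary: S) (auto, blast)

lemma occupied_card:
  assumes "S \<subseteq> {1..m}" "card S + length hs \<le> m"
  shows "occupied m S hs \<subseteq> {1..m} \<and> card (occupied m S hs) = card S + length hs"
  using assms
proof (induction hs arbitrary: S)
  case (Cons h hs)
  from park_step[of S m "length hs" h] Cons show ?case by auto
qed simp

section \<open>Rotation invariance\<close>

definition rot :: "nat \<Rightarrow> nat \<Rightarrow> nat" where
  "rot m p = p mod m + 1"

lemma rot_mem: "0 < m \<Longrightarrow> rot m p \<in> {1..m}"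
  by (auto simp: rot_def Suc_le_eq)

lemma inj_on_rot: "inj_on (rot m) {1..m}"
proof -
  have "rot m p = space_after m 1 p" for p by (simp add: rot_def space_after_def)
  then have *: "inj_on (rot m) {..<m}" using inj_on_space_after[of m 1] by (auto simp: inj_on_def)
  show ?thesis
  proof (rule inj_onI)
    fix p q assume a: "p \<in> {1..m}" "q \<in> {1..m}" "rot m p = rot m q"
    then have "p mod m = q mod m" by (simp add: rot_def)
    with a(1,2) show "p = q" by (cases "p = m"; cases "q = m") auto
  qed
qed

lemma bij_betw_rot: "0 < m \<Longrightarrow> bij_betw (rot m) {1..m} {1..m}"
  unfolding bij_betw_def by (metis card_image card_subset_eq finite_atLeastAtMost image_subsetI inj_on_rot rot_mem)

lemma space_after_rot:
  assumes "1 \<le> h" shows "space_after m (rot m h) j = rot m (space_after m h j)"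
proof -
  have "(h mod m + j) mod m = (h + j) mod m" by (simp add: mod_add_left_eq)
  moreover have "rot m (space_after m h j) = (Suc (h - 1 + j)) mod m + 1"
    by (simp add: rot_def space_after_def mod_Suc_eq)
  ultimately show ?thesis using assms by (simp add: space_after_def rot_def)
qed

lemma displacement_rot:
  assumes "S \<subseteq> {1..m}" "1 \<le> h" "0 < m"
  shows "displacement m (rot m ` S) (rot m h) = displacement m S h"
    and "park m (rot m ` S) (rot m h) = rot m (park m S h)"
proof -
  have "rot m (space_after m h j) \<in> rot m ` S \<longleftrightarrow> space_after m h j \<in> S" for j
    using inj_on_rot[of m] assms(1) space_after_mem[OF assms(3), of h j]
    by (meson image_eqI inj_on_image_mem_iff)
  then show *: "displacement m (rot m ` S) (rot m h) = displacement m S h"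
    by (simp add: displacement_def space_after_rot[OF assms(2)])
  show "park m (rot m ` S) (rot m h) = rot m (park m S h)"
    by (simp add: park_def * space_after_rot[OF assms(2)])
qed

lemma displacement_sum_rot:
  assumes "S \<subseteq> {1..m}" "set hs \<subseteq> {1..m}" "0 < m"
  shows "displacement_sum m (rot m ` S) (map (rot m) hs) = displacement_sum m S hs \<and>
    occupied m (rot m ` S) (map (rot m) hs) = rot m ` occupied m S hs"
  using assms
proof (induction hs arbitrary: S)
  case (Cons h hs)
  have "insert (park m S h) S \<subseteq> {1..m}"
    using Cons.prems space_after_mem[of m] by (auto simp: park_def)
  then show ?case using Cons.IH[of "insert (park m S h) S"] Cons.prems displacement_rot[of S m h]
    by (simp add: displacement_sum_Cons del: displacement_sum.simps(2))
qed simp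

definition free_count :: "nat \<Rightarrow> nat \<Rightarrow> nat \<Rightarrow> nat \<Rightarrow> nat" where
  "free_count m n j p = card {hs \<in> words m n. p \<notin> occupied m {} hs \<and> total_displacement m hs = j}"

lemma bij_betw_map_words:
  assumes "bij_betw f {1..m} {1..m}"
  shows "bij_betw (map f) (words m n) (words m n)"
proof -
  have "bij_betw (map f) (lists {1..m}) (lists {1..m})"
    using assms by (rule bij_lists)
  then have "inj_on (map f) (words m n)"
    by (rule inj_on_subset[OF bij_betw_imp_inj_on]) (auto simp: mem_words subset_iff)
  moreover have "map f ` words m n \<subseteq> words m n"
  proof
    fix x assume "x \<in> map f ` words m n"
    then obtain y where "y \<in> words m n" "x = map f y" by blast
    then show "x \<in> words m n" using bij_betwE[OF assms] by (fastforce simp: mem_words)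
  qed
  ultimately show ?thesis
    unfolding bij_betw_def using card_subset_eq[OF finite_words] card_image by blast
qed

lemma free_count_rot:
  assumes "p \<in> {1..m}" "n \<le> m"
  shows "free_count m n j (rot m p) = free_count m n j p"
proof -
  have m: "0 < m" using assms by auto
  have bij: "bij_betw (map (rot m)) (words m n) (words m n)"
    using bij_betw_map_words[OF bij_betw_rot[OF m]] .
  have eq: "rot m p \<notin> occupied m {} (map (rot m) hs) \<and> total_displacement m (map (rot m) hs) = j
      \<longleftrightarrow> p \<notin> occupied m {} hs \<and> total_displacement m hs = j" if "hs \<in> words m n" for hs
  proof -
    have "occupied m {} hs \<subseteq> {1..m}" using occupied_card[of "{}" m hs] that assms by (auto simp: mem_words)
    then have "rot m p \<in> rot m ` occupied m {} hs \<longleftrightarrow> p \<in> occupied m {} hs"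
      using inj_on_rot[of m] assms(1) by (meson image_eqI inj_on_image_mem_iff)
    then show ?thesis
      using displacement_sum_rot[of "{}" m hs] that m by (simp add: total_displacement_def mem_words)
  qed
  have "{hs \<in> words m n. rot m p \<notin> occupied m {} hs \<and> total_displacement m hs = j}
    = map (rot m) ` {hs \<in> words m n. p \<notin> occupied m {} hs \<and> total_displacement m hs = j}"
    (is "?A = map (rot m) ` ?B")
  proof
    show "?A \<subseteq> map (rot m) ` ?B"
    proof
      fix hs assume hs: "hs \<in> ?A"
      then obtain gs where "gs \<in> words m n" "hs = map (rot m) gs"
        using bij_betw_imp_surj_on[OF bij] by blast
      with hs eq[of gs] show "hs \<in> map (rot m) ` ?B" by blast
    qed
    show "map (rot m) ` ?B \<subseteq> ?A"
    proof
      fix hs assume "hs \<in> map (rot m) ` ?B"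
      then obtain gs where "gs \<in> ?B" "hs = map (rot m) gs" by blast
      moreover from this have "hs \<in> words m n" using bij_betwE[OF bij] by blast
      ultimately show "hs \<in> ?A" using eq[of gs] by blast
    qed
  qed
  moreover have "inj_on (map (rot m)) ?B"
    by (rule inj_on_subset[OF bij_betw_imp_inj_on[OF bij]]) blast
  ultimately show ?thesis by (simp add: free_count_def card_image)
qed

lemma free_count_eq:
  assumes "p \<in> {1..m}" "n \<le> m"
  shows "free_count m n j p = free_count m n j m"
proof -
  have "free_count m n j (p + i) = free_count m n j p" if "p + i \<le> m" for i
    using that
  proof (induction i)
    case (Suc i)
    then have "rot m (p + i) = p + Suc i" by (simp add: rot_def)
    then show ?case using Suc free_count_rot[of "p + i" m n j] assms by auto
  qed simp
  from this[of "m - p"] assms show ?thesis by auto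
qed

text \<open>Double counting of pairs of a word and an empty space: every word leaves
  \<open>m - n\<close> spaces empty, and by rotation each of the \<open>m\<close> spaces is empty
  for equally many words of displacement \<open>j\<close>.\<close>

lemma rotation_count:
  assumes "n \<le> m"
  shows "(m - n) * card {hs \<in> words m n. total_displacement m hs = j} = m * free_count m n j m"
proof -
  let ?W = "{hs \<in> words m n. total_displacement m hs = j}"
  have fin: "finite ?W" by (rule finite_subset[OF _ finite_words[of m n]]) blast
  have "m * free_count m n j m = (\<Sum>p\<in>{1..m}. free_count m n j m)"
    by simp
  also have "\<dots> = (\<Sum>p\<in>{1..m}. free_count m n j p)"
    by (intro sum.cong refl free_count_eq[OF _ assms, symmetric])
  also have "\<dots> = (\<Sum>p\<in>{1..m}. \<Sum>hs\<in>?W. of_bool (p \<notin> occupied m {} hs))"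
  proof (intro sum.cong refl)
    fix p
    have "free_count m n j p = card {hs \<in> ?W. p \<notin> occupied m {} hs}"
      unfolding free_count_def by (rule arg_cong[where f = card]) blast
    also have "\<dots> = (\<Sum>hs\<in>?W. of_bool (p \<notin> occupied m {} hs))"
      by (subst card_eq_sum, rule sum.mono_neutral_cong_left) (use fin in auto)
    finally show "free_count m n j p = (\<Sum>hs\<in>?W. of_bool (p \<notin> occupied m {} hs))" .
  qed
  also have "\<dots> = (\<Sum>hs\<in>?W. \<Sum>p\<in>{1..m}. of_bool (p \<notin> occupied m {} hs))"
    by (rule sum.swap)
  also have "\<dots> = (\<Sum>hs\<in>?W. m - n)"
  proof (intro sum.cong refl)
    fix hs assume "hs \<in> ?W"
    then have "occupied m {} hs \<subseteq> {1..m}" "card (occupied m {} hs) = n"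
      using occupied_card[of "{}" m hs] assms by (auto simp: mem_words)
    then have "card ({1..m} - occupied m {} hs) = m - n"
      by (simp add: card_Diff_subset finite_subset)
    moreover have "(\<Sum>p\<in>{1..m}. of_bool (p \<notin> occupied m {} hs)) = card ({1..m} - occupied m {} hs)"
      by (subst card_eq_sum, rule sum.mono_neutral_cong_right) auto
    ultimately show "(\<Sum>p\<in>{1..m}. of_bool (p \<notin> occupied m {} hs)) = m - n" by simp
  qed
  finally show ?thesis by (simp add: mult.commute)
qed

section \<open>Decomposition into blocks\<close>

text \<open>Compares a search on a small circle with the same search on a large one: they agree only
  up to a space known to be empty, where both stop at the latest.\<close>

lemma Least_cong_upto:
  fixes P Q :: "nat \<Rightarrow> bool"
  assumes "\<And>j. j \<le> k \<Longrightarrow> P j = Q j" "P k"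
  shows "(LEAST j. P j) = (LEAST j. Q j)" "(LEAST j. P j) \<le> k"
proof -
  show le: "(LEAST j. P j) \<le> k" using assms(2) by (rule Least_le)
  have "(LEAST j. Q j) \<le> k" using assms by (intro Least_le) auto
  moreover have "P (LEAST j. P j)" "Q (LEAST j. Q j)"
    using LeastI[of P k] LeastI[of Q k] assms by blast+
  ultimately show "(LEAST j. P j) = (LEAST j. Q j)"
    using le assms(1) by (intro antisym Least_le) auto
qed

lemma space_after_no_wrap: "1 \<le> h \<Longrightarrow> h + j \<le> m \<Longrightarrow> space_after m h j = h + j"
  by (simp add: space_after_def)

context
  fixes k l :: nat and S T :: "nat set"
  assumes kl: "0 < k" "0 < l" and S: "S \<subseteq> {1..k}" "k \<notin> S" and T: "T \<subseteq> {1..l}" "l \<notin> T"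
begin

text \<open>Space \<open>k\<close> is empty, so a search that starts at \<open>h\<close> stops after
  at most \<open>k - h\<close> steps: it neither wraps round nor sees the right arc.\<close>

lemma displacement_left:
  assumes "h \<in> {1..k}"
  shows "displacement (k + l) (S \<union> (+) k ` T) h = displacement k S h"
    and "park (k + l) (S \<union> (+) k ` T) h = park k S h"
proof -
  have eq: "(space_after k h j \<notin> S) = (space_after (k + l) h j \<notin> S \<union> (+) k ` T)"
    if "j \<le> k - h" for j
    using that assms T(1) by (auto simp: space_after_no_wrap subset_iff)
  have free: "space_after k h (k - h) \<notin> S" using assms S by (auto simp: space_after_no_wrap)
  show *: "displacement (k + l) (S \<union> (+) k ` T) h = displacement k S h"
    unfolding displacement_def
    by (rule Least_cong_upto(1)[of "k - h", symmetric]) (use eq free in auto)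
  have "displacement k S h \<le> k - h"
    unfolding displacement_def
    by (rule Least_cong_upto(2)[of "k - h"]) (use eq free in auto)
  then show "park (k + l) (S \<union> (+) k ` T) h = park k S h"
    using assms by (auto simp: park_def * space_after_no_wrap)
qed

lemma displacement_right:
  assumes "h \<in> {1..l}"
  shows "displacement (k + l) (S \<union> (+) k ` T) (k + h) = displacement l T h"
    and "park (k + l) (S \<union> (+) k ` T) (k + h) = k + park l T h"
proof -
  have eq: "(space_after l h j \<notin> T) = (space_after (k + l) (k + h) j \<notin> S \<union> (+) k ` T)"
    if "j \<le> l - h" for j
    using that assms S(1) by (auto simp: space_after_no_wrap subset_iff)
  have free: "space_after l h (l - h) \<notin> T" using assms T by (auto simp: space_after_no_wrap)
  show *: "displacement (k + l) (S \<union> (+) k ` T) (k + h) = displacement l T h"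
    unfolding displacement_def
    by (rule Least_cong_upto(1)[of "l - h", symmetric]) (use eq free in auto)
  have "displacement l T h \<le> l - h"
    unfolding displacement_def
    by (rule Least_cong_upto(2)[of "l - h"]) (use eq free in auto)
  then show "park (k + l) (S \<union> (+) k ` T) (k + h) = k + park l T h"
    using assms by (auto simp: park_def * space_after_no_wrap)
qed

end

section \<open>Splitting a word at an empty space\<close>

definition left_cars :: "nat \<Rightarrow> nat list \<Rightarrow> nat list" where
  "left_cars k hs = filter (\<lambda>h. h \<le> k) hs"

definition right_cars :: "nat \<Rightarrow> nat list \<Rightarrow> nat list" where
  "right_cars k hs = map (\<lambda>h. h - k) (filter (\<lambda>h. \<not> h \<le> k) hs)"

text \<open>If spaces \<open>k\<close> and \<open>k + l\<close> stay empty, no car crosses them, so the two arcs between them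
  fill up independently.\<close>

lemma split_at_empty:
  assumes "0 < k" "0 < l" "S \<subseteq> {1..k}" "k \<notin> S" "T \<subseteq> {1..l}" "l \<notin> T" "set hs \<subseteq> {1..k + l}"
  shows "(k \<notin> occupied (k + l) (S \<union> (+) k ` T) hs \<and> k + l \<notin> occupied (k + l) (S \<union> (+) k ` T) hs
      \<longleftrightarrow> k \<notin> occupied k S (left_cars k hs) \<and> l \<notin> occupied l T (right_cars k hs)) \<and>
    (k \<notin> occupied k S (left_cars k hs) \<and> l \<notin> occupied l T (right_cars k hs) \<longrightarrow>
     occupied (k + l) (S \<union> (+) k ` T) hs
       = occupied k S (left_cars k hs) \<union> (+) k ` occupied l T (right_cars k hs) \<and>
     displacement_sum (k + l) (S \<union> (+) k ` T) hs
       = displacement_sum k S (left_cars k hs) + displacement_sum l T (right_cars k hs))"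
  using assms(3-)
proof (induction hs arbitrary: S T)
  case Nil
  then show ?case using assms(1,2) by (auto simp: left_cars_def right_cars_def subset_iff)
next
  case (Cons h hs)
  let ?U = "S \<union> (+) k ` T"
  show ?case
  proof (cases "h \<le> k")
    case True
    then have h: "h \<in> {1..k}" using Cons.prems by auto
    note d = displacement_left[OF assms(1,2) Cons.prems(1-4) h]
    have cars: "left_cars k (h # hs) = h # left_cars k hs" "right_cars k (h # hs) = right_cars k hs"
      using True by (simp_all add: left_cars_def right_cars_def)
    have U: "insert (park (k + l) ?U h) ?U = insert (park k S h) S \<union> (+) k ` T"
      by (simp add: d)
    have in_left: "insert (park k S h) S \<subseteq> {1..k}"
      using Cons.prems(1) space_after_mem[OF assms(1)] by (auto simp: park_def)
    show ?thesis
    \<comment> \<open>Once \<open>k\<close> is taken it stays taken, on the small circle and on the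
      large one, so both sides of the equivalence are false.\<close>
    proof (cases "park k S h = k")
      case True
      then have "k \<in> occupied k S (h # left_cars k hs)" "k \<in> occupied (k + l) ?U (h # hs)"
        using occupied_mono[of "insert (park k S h) S" k "left_cars k hs"]
          occupied_mono[of "insert (park (k + l) ?U h) ?U" "k + l" hs] d(2) by auto
      then show ?thesis unfolding cars by blast
    next
      case False
      then have "k \<notin> insert (park k S h) S" using Cons.prems(2) by simp
      from Cons.IH[OF in_left this Cons.prems(3,4)] Cons.prems(5) show ?thesis
        unfolding cars by (simp add: displacement_sum_Cons d del: displacement_sum.simps(2))
    qed
  next
    case False
    define g where "g = h - k"
    then have g: "g \<in> {1..l}" and h: "h = k + g" using Cons.prems False by auto
    note d = displacement_right[OF assms(1,2) Cons.prems(1-4) g]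
    have cars: "left_cars k (h # hs) = left_cars k hs" "right_cars k (h # hs) = g # right_cars k hs"
      using False by (simp_all add: left_cars_def right_cars_def g_def)
    have U: "insert (park (k + l) ?U h) ?U = S \<union> (+) k ` insert (park l T g) T"
      by (simp add: d h)
    have in_right: "insert (park l T g) T \<subseteq> {1..l}"
      using Cons.prems(3) space_after_mem[OF assms(2)] by (auto simp: park_def)
    show ?thesis
    proof (cases "park l T g = l")
      case True
      then have "l \<in> occupied l T (g # right_cars k hs)" "k + l \<in> occupied (k + l) ?U (h # hs)"
        using occupied_mono[of "insert (park l T g) T" l "right_cars k hs"]
          occupied_mono[of "insert (park (k + l) ?U h) ?U" "k + l" hs] d(2) h by auto
      then show ?thesis unfolding cars by blast
    next
      case False
      then have "l \<notin> insert (park l T g) T" using Cons.prems(4) by simp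
      from Cons.IH[OF Cons.prems(1,2) in_right this] Cons.prems(5) show ?thesis
        unfolding cars
        by (simp add: displacement_sum_Cons d h del: displacement_sum.simps(2))
    qed
  qed
qed

text \<open>No bound on the number of cars is assumed: a space that is empty at the end was
  available to every car, so no search fails.\<close>

lemma occupied_card_free:
  assumes "S \<subseteq> {1..m}" "p \<in> {1..m}" "p \<notin> occupied m S hs"
  shows "occupied m S hs \<subseteq> {1..m} \<and> card (occupied m S hs) = card S + length hs"
  using assms
proof (induction hs arbitrary: S)
  case (Cons h hs)
  then have "p \<notin> S" using occupied_mono[of S m "h # hs"] by blast
  from displacement_free[OF Cons.prems(2) this, of h] Cons show ?case
    by (auto simp: finite_subset)
qed simp

text \<open>The empty space \<open>m\<close> cuts the circle open. With \<open>n = l - 1\<close> and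
  \<open>m = l\<close> these words are the blocks of length \<open>l\<close>: every space but the
  last is filled.\<close>

definition last_free :: "nat \<Rightarrow> nat \<Rightarrow> nat \<Rightarrow> nat list set" where
  "last_free m n j = {hs \<in> words m n. m \<notin> occupied m {} hs \<and> total_displacement m hs = j}"

lemma finite_last_free: "finite (last_free m n j)"
  unfolding last_free_def by (rule finite_subset[OF _ finite_words[of m n]]) blast

lemma shuffles_left_right:
  assumes "set as \<subseteq> {1..k}" "set bs \<subseteq> {1..l}" "hs \<in> shuffles as (map ((+) k) bs)"
  shows "left_cars k hs = as" "right_cars k hs = bs"
proof -
  have "filter (\<lambda>h. h \<le> k) hs \<in> shuffles (filter (\<lambda>h. h \<le> k) as) (filter (\<lambda>h. h \<le> k) (map ((+) k) bs))"
    using assms(3) by (simp only: filter_shuffles[symmetric] imageI)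
  moreover have "filter (\<lambda>h. h \<le> k) as = as" "filter (\<lambda>h. h \<le> k) (map ((+) k) bs) = []"
    using assms by (force simp: filter_id_conv filter_empty_conv)+
  ultimately show "left_cars k hs = as" by (simp add: left_cars_def)
  have "filter (\<lambda>h. \<not> h \<le> k) hs \<in> shuffles (filter (\<lambda>h. \<not> h \<le> k) as) (filter (\<lambda>h. \<not> h \<le> k) (map ((+) k) bs))"
    using assms(3) by (simp only: filter_shuffles[symmetric] imageI)
  moreover have "filter (\<lambda>h. \<not> h \<le> k) as = []" "filter (\<lambda>h. \<not> h \<le> k) (map ((+) k) bs) = map ((+) k) bs"
    using assms by (force simp: filter_id_conv filter_empty_conv)+
  ultimately show "right_cars k hs = bs" by (simp add: right_cars_def comp_def)
qed

lemma mem_shuffles_left_right: "hs \<in> shuffles (left_cars k hs) (map ((+) k) (right_cars k hs))"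
proof -
  have "map ((+) k) (right_cars k hs) = filter (\<lambda>h. \<not> h \<le> k) hs"
    unfolding right_cars_def by (simp add: comp_def) (rule map_idI, auto)
  then show ?thesis unfolding left_cars_def by (simp only: partition_in_shuffles)
qed

lemma set_left_right:
  assumes "set hs \<subseteq> {1..k + l}"
  shows "set (left_cars k hs) \<subseteq> {1..k}" "set (right_cars k hs) \<subseteq> {1..l}"
    "length (left_cars k hs) + length (right_cars k hs) = length hs"
  using assms
  by (auto simp: left_cars_def right_cars_def sum_length_filter_compl subset_iff)

text \<open>Here \<open>k\<close> is the last empty space before \<open>k + l\<close>. Cars on the
  two arcs do not interact, so such a word is an arbitrary interleaving of a word on
  \<open>{1..k}\<close> that leaves \<open>k\<close> empty and a block word of length
  \<open>l\<close>.\<close>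

lemma last_block_fibre:
  assumes "0 < k" "0 < l"
  shows "{hs \<in> last_free (k + l) (n + (l - 1)) j. k \<notin> occupied (k + l) {} hs \<and>
           {k<..<k + l} \<subseteq> occupied (k + l) {} hs}
    = (\<Union>(i, as, bs) \<in> (SIGMA i:{..j}. last_free k n (j - i) \<times> last_free l (l - 1) i).
        shuffles as (map ((+) k) bs))" (is "?A = ?B")
proof (intro set_eqI iffI)
  fix hs assume "hs \<in> ?A"
  then have hs: "set hs \<subseteq> {1..k + l}" "length hs = n + (l - 1)" "k \<notin> occupied (k + l) {} hs"
    "k + l \<notin> occupied (k + l) {} hs" "total_displacement (k + l) hs = j"
    "{k<..<k + l} \<subseteq> occupied (k + l) {} hs"
    by (auto simp: last_free_def mem_words)
  note sp = split_at_empty[OF assms, of "{}" "{}" hs, simplified]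
  note lr = set_left_right[OF hs(1)]
  have e: "k \<notin> occupied k {} (left_cars k hs)" "l \<notin> occupied l {} (right_cars k hs)"
    using sp hs by auto
  have occ: "occupied (k + l) {} hs = occupied k {} (left_cars k hs) \<union> (+) k ` occupied l {} (right_cars k hs)"
    and d: "total_displacement (k + l) hs
      = total_displacement k (left_cars k hs) + total_displacement l (right_cars k hs)"
    using sp hs e unfolding total_displacement_def by auto
  have cl: "occupied k {} (left_cars k hs) \<subseteq> {1..k}"
    using occupied_card_free[of "{}" k k] e assms by auto
  have cr: "occupied l {} (right_cars k hs) \<subseteq> {1..l}"
      "card (occupied l {} (right_cars k hs)) = length (right_cars k hs)"
    using occupied_card_free[of "{}" l l] e assms by auto
  \<comment> \<open>The number of cars on the right arc is not given; it is read off from the arc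
    being full except for its last space.\<close>
  have "occupied l {} (right_cars k hs) = {1..<l}"
  proof
    show "{1..<l} \<subseteq> occupied l {} (right_cars k hs)"
    proof
      fix p assume p: "p \<in> {1..<l}"
      then have "k + p \<in> occupied (k + l) {} hs" using hs(6) by auto
      moreover have "k + p \<notin> occupied k {} (left_cars k hs)" using cl p by auto
      ultimately show "p \<in> occupied l {} (right_cars k hs)" unfolding occ by auto
    qed
    show "occupied l {} (right_cars k hs) \<subseteq> {1..<l}"
    proof
      fix p assume p: "p \<in> occupied l {} (right_cars k hs)"
      then have "p \<noteq> l" using e by auto
      then show "p \<in> {1..<l}" using p cr(1) by auto
    qed
  qed
  then have len: "length (right_cars k hs) = l - 1" using cr by simp
  let ?i = "total_displacement l (right_cars k hs)"
  have "left_cars k hs \<in> last_free k n (j - ?i)" "right_cars k hs \<in> last_free l (l - 1) ?i" "?i \<le> j"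
    using len lr e d hs by (auto simp: last_free_def mem_words)
  then show "hs \<in> ?B" using mem_shuffles_left_right[of hs k] by force
next
  fix hs assume "hs \<in> ?B"
  then obtain i as bs where i: "i \<le> j" and as: "as \<in> last_free k n (j - i)"
    and bs: "bs \<in> last_free l (l - 1) i" and sh: "hs \<in> shuffles as (map ((+) k) bs)" by auto
  have sets: "set as \<subseteq> {1..k}" "set bs \<subseteq> {1..l}"
    using as bs by (auto simp: last_free_def mem_words)
  note eq = shuffles_left_right[OF sets sh]
  have s: "set hs \<subseteq> {1..k + l}"
    using set_shuffles[OF sh] sets by (force simp: subset_iff)
  note sp = split_at_empty[OF assms, of "{}" "{}" hs, simplified]
  have e: "k \<notin> occupied k {} as" "l \<notin> occupied l {} bs"
    using as bs by (auto simp: last_free_def)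
  have 1: "k \<notin> occupied (k + l) {} hs" "k + l \<notin> occupied (k + l) {} hs"
    using sp s e eq by auto
  have occ: "occupied (k + l) {} hs = occupied k {} as \<union> (+) k ` occupied l {} bs"
    and d: "total_displacement (k + l) hs = total_displacement k as + total_displacement l bs"
    using sp s e eq unfolding total_displacement_def by auto
  have cr: "occupied l {} bs \<subseteq> {1..l}" "card (occupied l {} bs) = length bs"
    using occupied_card_free[of "{}" l l] e assms by auto
  have "occupied l {} bs \<subseteq> {1..<l}"
  proof
    fix p assume p: "p \<in> occupied l {} bs"
    then have "p \<noteq> l" using e by auto
    then show "p \<in> {1..<l}" using p cr(1) by auto
  qed
  then have full: "occupied l {} bs = {1..<l}"
    using cr(2) bs by (intro card_subset_eq) (auto simp: last_free_def mem_words)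
  have "{k<..<k + l} \<subseteq> (+) k ` {1..<l}"
  proof
    fix p assume "p \<in> {k<..<k + l}"
    then have "p = k + (p - k)" "p - k \<in> {1..<l}" by auto
    then show "p \<in> (+) k ` {1..<l}" by blast
  qed
  then have 2: "{k<..<k + l} \<subseteq> occupied (k + l) {} hs" unfolding occ full by blast
  have 3: "length hs = n + (l - 1)" "total_displacement (k + l) hs = j"
    using length_shuffles[OF sh] as bs d i by (auto simp: last_free_def mem_words)
  show "hs \<in> ?A" using 1 2 3 s by (simp add: last_free_def mem_words)
qed

text \<open>An interleaving determines both words, and the block word determines \<open>i\<close>,
  so the union is disjoint. The binomial coefficient counts the arrival times taken by the cars of
  the block.\<close>

lemma card_last_block_fibre:
  assumes "0 < k" "0 < l"
  shows "card {hs \<in> last_free (k + l) (n + (l - 1)) j. k \<notin> occupied (k + l) {} hs \<and>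
           {k<..<k + l} \<subseteq> occupied (k + l) {} hs}
    = (\<Sum>i\<le>j. ((n + (l - 1)) choose (l - 1)) * (card (last_free k n (j - i)) * card (last_free l (l - 1) i)))"
proof -
  let ?I = "SIGMA i:{..j}. last_free k n (j - i) \<times> last_free l (l - 1) i"
  have fin: "finite ?I" by (intro finite_SigmaI finite_last_free finite_atMost)
  have sets: "set as \<subseteq> {1..k}" "set bs \<subseteq> {1..l}" "length as = n" "length bs = l - 1" "total_displacement l bs = i"
    if "(i, as, bs) \<in> ?I" for i as bs
    using that by (auto simp: last_free_def mem_words)
  define Sh where "Sh x = (case x of (i :: nat, as, bs) \<Rightarrow> shuffles as (map ((+) k) bs))" for x
  have "card (\<Union>x\<in>?I. Sh x) = (\<Sum>x\<in>?I. card (Sh x))"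
  proof (rule card_UN_disjoint)
    show "finite ?I" by fact
    show "\<forall>x\<in>?I. finite (Sh x)" by (auto simp: Sh_def)
    show "\<forall>x\<in>?I. \<forall>y\<in>?I. x \<noteq> y \<longrightarrow> Sh x \<inter> Sh y = {}"
    proof (intro ballI impI, rule ccontr)
      fix x y assume x: "x \<in> ?I" and y: "y \<in> ?I" and ne: "x \<noteq> y" and int: "Sh x \<inter> Sh y \<noteq> {}"
      obtain i as bs i' as' bs' where xy: "x = (i, as, bs)" "y = (i', as', bs')" by (cases x, cases y)
      from int xy obtain hs where hs: "hs \<in> shuffles as (map ((+) k) bs)" "hs \<in> shuffles as' (map ((+) k) bs')"
        by (auto simp: Sh_def)
      note s1 = sets[OF x[unfolded xy]] and s2 = sets[OF y[unfolded xy]]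
      have "as = as'" "bs = bs'"
        using shuffles_left_right[OF s1(1,2) hs(1)] shuffles_left_right[OF s2(1,2) hs(2)] by simp_all
      moreover from this have "i = i'" using s1(5) s2(5) by simp
      ultimately show False using ne xy by simp
    qed
  qed
  then have "card {hs \<in> last_free (k + l) (n + (l - 1)) j. k \<notin> occupied (k + l) {} hs \<and>
           {k<..<k + l} \<subseteq> occupied (k + l) {} hs} = (\<Sum>(i, as, bs)\<in>?I. card (shuffles as (map ((+) k) bs)))"
    unfolding last_block_fibre[OF assms] by (simp add: Sh_def split_def)
  also have "\<dots> = (\<Sum>(i, as, bs)\<in>?I. (n + (l - 1)) choose (l - 1))"
  proof (intro sum.cong refl)
    fix x assume "x \<in> ?I"
    obtain i as bs where x: "x = (i, as, bs)" by (cases x)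
    have *: "(i, as, bs) \<in> ?I" using \<open>x \<in> ?I\<close> x by simp
    have "set as \<inter> set (map ((+) k) bs) = {}" using sets(1,2)[OF *] by fastforce
    then have "card (shuffles as (map ((+) k) bs)) = (n + (l - 1)) choose n"
      using card_disjoint_shuffles sets(3,4)[OF *] by fastforce
    also have "\<dots> = (n + (l - 1)) choose (l - 1)" by (subst binomial_symmetric) auto
    finally show "(case x of (i, as, bs) \<Rightarrow> card (shuffles as (map ((+) k) bs)))
      = (case x of (i, as, bs) \<Rightarrow> (n + (l - 1)) choose (l - 1))" by (simp add: x)
  qed
  also have "\<dots> = (\<Sum>i\<le>j. \<Sum>x\<in>last_free k n (j - i) \<times> last_free l (l - 1) i. (n + (l - 1)) choose (l - 1))"
    by (subst sum.Sigma) (simp_all add: finite_last_free split_def)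
  finally show ?thesis by (simp add: card_cartesian_product mult.commute)
qed

text \<open>Words are sorted by the largest empty space \<open>m - l\<close> below \<open>m\<close>;
  the hypothesis \<open>n + 2 <= m\<close> guarantees that there is one.\<close>

lemma card_last_free_rec:
  assumes "n + 2 \<le> m"
  shows "card (last_free m n j) = (\<Sum>l\<in>{1..<m}. \<Sum>i\<le>j.
    (n choose (l - 1)) * (card (last_free (m - l) (n - (l - 1)) (j - i)) * card (last_free l (l - 1) i)))"
proof -
  define F where "F l = {hs \<in> last_free m n j. m - l \<notin> occupied m {} hs \<and>
           {m - l<..<m} \<subseteq> occupied m {} hs}" for l
  have F: "card (F l) = (\<Sum>i\<le>j.
    (n choose (l - 1)) * (card (last_free (m - l) (n - (l - 1)) (j - i)) * card (last_free l (l - 1) i)))"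
    if l: "l \<in> {1..<m}" for l
  proof (cases "l - 1 \<le> n")
    case True
    then show ?thesis
      using card_last_block_fibre[of "m - l" l "n - (l - 1)" j] l by (simp add: F_def)
  next
    \<comment> \<open>A block of length \<open>l\<close> needs \<open>l - 1\<close> cars; with fewer
      cars the class is empty and the binomial coefficient is zero.\<close>
    case False
    have "F l = {}"
    proof (rule ccontr)
      assume "F l \<noteq> {}"
      then obtain hs where hs: "hs \<in> last_free m n j" "{m - l<..<m} \<subseteq> occupied m {} hs" by (auto simp: F_def)
      have "occupied m {} hs \<subseteq> {1..m}" "card (occupied m {} hs) = n"
        using occupied_card[of "{}" m hs] hs assms by (auto simp: last_free_def mem_words)
      then have "card {m - l<..<m} \<le> n" using card_mono[OF _ hs(2)] by (auto simp: finite_subset)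
      then show False using False l by simp
    qed
    then show ?thesis using False by simp
  qed
  have "last_free m n j = (\<Union>l\<in>{1..<m}. F l)"
  proof (intro equalityI subsetI)
    fix hs assume hs: "hs \<in> last_free m n j"
    define E where "E = {1..<m} - occupied m {} hs"
    have occ: "occupied m {} hs \<subseteq> {1..m}" "card (occupied m {} hs) = n"
      using occupied_card[of "{}" m hs] hs assms by (auto simp: last_free_def mem_words)
    have "E \<noteq> {}"
    proof
      assume "E = {}"
      then have "card {1..<m} \<le> card (occupied m {} hs)"
        using occ by (intro card_mono) (auto simp: E_def finite_subset)
      then show False using assms occ by simp
    qed
    moreover have fin: "finite E" by (simp add: E_def)
    ultimately have M: "Max E \<in> E" "\<And>p. p \<in> E \<Longrightarrow> p \<le> Max E" by auto
    have "{Max E<..<m} \<subseteq> occupied m {} hs"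
    proof
      fix p assume p: "p \<in> {Max E<..<m}"
      then have "p \<notin> E" using M(2)[of p] by auto
      then show "p \<in> occupied m {} hs" using p by (auto simp: E_def)
    qed
    moreover have "Max E \<notin> occupied m {} hs" "m - (m - Max E) = Max E"
      using M(1) by (auto simp: E_def)
    ultimately have "hs \<in> F (m - Max E)" using hs by (simp add: F_def)
    moreover have "m - Max E \<in> {1..<m}" using M(1) unfolding E_def by force
    ultimately show "hs \<in> (\<Union>l\<in>{1..<m}. F l)" by blast
  qed (auto simp: F_def)
  then have "card (last_free m n j) = card (\<Union>l\<in>{1..<m}. F l)" by simp
  also have "\<dots> = (\<Sum>l\<in>{1..<m}. card (F l))"
  proof (rule card_UN_disjoint)
    show "\<forall>l\<in>{1..<m}. finite (F l)"
      unfolding F_def using finite_last_free[of m n j] by simp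
    have disj: "F l \<inter> F l' = {}" if "0 < l" "l < l'" "l' < m" for l l'
    proof -
      have "m - l \<in> {m - l'<..<m}" using that by auto
      then show ?thesis by (auto simp: F_def)
    qed
    show "\<forall>l\<in>{1..<m}. \<forall>l'\<in>{1..<m}. l \<noteq> l' \<longrightarrow> F l \<inter> F l' = {}"
    proof (intro ballI impI)
      fix l l' assume "l \<in> {1..<m}" "l' \<in> {1..<m}" "l \<noteq> l'"
      then show "F l \<inter> F l' = {}" using disj[of l l'] disj[of l' l] by (cases "l < l'") auto
    qed
  qed simp
  finally show ?thesis using F by simp
qed

text \<open>Dividing by the factorial of the number of cars, as in an exponential generating
  function, turns the binomial recursion into a plain convolution.\<close>

definition block_weight :: "nat \<Rightarrow> nat \<Rightarrow> real" where
  "block_weight l i = real (card (last_free l (l - 1) i)) / fact (l - 1)"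

primrec conv :: "(nat \<Rightarrow> nat \<Rightarrow> real) \<Rightarrow> nat \<Rightarrow> nat \<Rightarrow> nat \<Rightarrow> real" where
  "conv w 0 m j = of_bool (m = 0 \<and> j = 0)"
| "conv w (Suc N) m j = (\<Sum>l\<in>{1..m}. \<Sum>i\<le>j. w l i * conv w N (m - l) (j - i))"

lemma conv_block_weight:
  assumes "N + n = m" "0 < N"
  shows "conv block_weight N m j = real (card (last_free m n j)) / fact n"
  using assms
proof (induction N arbitrary: m n j)
  case (Suc N)
  show ?case
  proof (cases "N = 0")
    \<comment> \<open>For a single block, \<open>conv w 0\<close> leaves only the summand with
      \<open>l = m\<close> and \<open>i = j\<close>.\<close>
    case True
    then have m: "m = Suc n" using Suc.prems by simp
    have "conv block_weight (Suc N) m j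
      = (\<Sum>l\<in>{1..m}. \<Sum>i\<le>j. if l = m \<and> i = j then block_weight m j else 0)"
      unfolding conv.simps True by (intro sum.cong refl) auto
    also have "\<dots> = (\<Sum>l\<in>{1..m}. if l = m then block_weight m j else 0)"
      by (intro sum.cong refl) (auto simp: sum.delta)
    also have "\<dots> = block_weight m j" using m by (simp add: sum.delta)
    finally show ?thesis unfolding block_weight_def[of m j] by (simp add: m)
  next
    case False
    define c where "c m n j = real (card (last_free m n j))" for m n j
    have wt: "block_weight l i * conv block_weight N (m - l) (j - i)
      = real (n choose (l - 1)) * (c (m - l) (n - (l - 1)) (j - i) * c l (l - 1) i) / fact n"
      if "l \<in> {1..m}" for l i
    proof (cases "l - 1 \<le> n")
      case True
      have "conv block_weight N (m - l) (j - i) = c (m - l) (n - (l - 1)) (j - i) / fact (n - (l - 1))"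
        unfolding c_def using True that Suc.prems False by (intro Suc.IH) auto
      moreover have "real (n choose (l - 1)) = fact n / (fact (l - 1) * fact (n - (l - 1)))"
        using True by (rule binomial_fact)
      ultimately show ?thesis by (simp add: block_weight_def c_def)
    next
      \<comment> \<open>The remaining \<open>m - l\<close> spaces are then fewer than the remaining
        \<open>N\<close> blocks, each of which has length at least 1.\<close>
      case False
      have "m - l < N" using that False Suc.prems by auto
      have "conv block_weight N a b = 0" if "a < N" for a b
        using that
      proof (induction N arbitrary: a b)
        case (Suc N)
        then show ?case by (auto intro!: sum.neutral)
      qed simp
      with \<open>m - l < N\<close> show ?thesis using False by simp
    qed
    have "conv block_weight (Suc N) m j = (\<Sum>l\<in>{1..m}. \<Sum>i\<le>j.
       real (n choose (l - 1)) * (c (m - l) (n - (l - 1)) (j - i) * c l (l - 1) i) / fact n)"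
      unfolding conv.simps by (intro sum.cong refl wt)
    also have "\<dots> = (\<Sum>l\<in>{1..<m}. \<Sum>i\<le>j.
       real (n choose (l - 1)) * (c (m - l) (n - (l - 1)) (j - i) * c l (l - 1) i) / fact n)"
      using Suc.prems False by (intro sum.mono_neutral_right) (auto simp: not_less binomial_eq_0)
    also have "\<dots> = (\<Sum>l\<in>{1..<m}. \<Sum>i\<le>j.
       real (n choose (l - 1)) * (c (m - l) (n - (l - 1)) (j - i) * c l (l - 1) i)) / fact n"
      by (simp add: sum_divide_distrib)
    also have "\<dots> = c m n j / fact n"
      using card_last_free_rec[of n m j] Suc.prems False by (simp add: c_def)
    finally show ?thesis by (simp add: c_def)
  qed
qed simp

section \<open>Flows\<close>

text \<open>A car counts at \<open>p\<close> if it finds \<open>p\<close> occupied and moves on; the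
  space where it parks is excluded.\<close>

primrec flow :: "nat \<Rightarrow> nat set \<Rightarrow> nat list \<Rightarrow> nat \<Rightarrow> nat" where
  "flow m S [] p = 0"
| "flow m S (h # hs) p = of_bool (p \<in> space_after m h ` {..<displacement m S h})
     + flow m (insert (park m S h) S) hs p"

definition pred_space :: "nat \<Rightarrow> nat \<Rightarrow> nat" where
  "pred_space m p = (if p = 1 then m else p - 1)"

lemma pred_space_mem: "p \<in> {1..m} \<Longrightarrow> pred_space m p \<in> {1..m}"
  by (auto simp: pred_space_def)

lemma rot_pred_space: "p \<in> {1..m} \<Longrightarrow> rot m (pred_space m p) = p"
  by (auto simp: pred_space_def rot_def)

lemma pred_space_rot: "p \<in> {1..m} \<Longrightarrow> pred_space m (rot m p) = p"
  by (cases "p = m") (auto simp: pred_space_def rot_def)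

lemma bij_betw_pred_space: "bij_betw (pred_space m) {1..m} {1..m}"
proof (rule bij_betw_byWitness[where f' = "rot m"])
  show "rot m ` {1..m} \<subseteq> {1..m}" using rot_mem[of m] by (cases "m = 0") auto
qed (use rot_pred_space pred_space_rot pred_space_mem in auto)

lemma space_after_Suc: "space_after m h (Suc j) = rot m (space_after m h j)"
  by (simp add: rot_def space_after_def mod_Suc_eq)

lemma space_after_0: "h \<in> {1..m} \<Longrightarrow> space_after m h 0 = h"
  by (auto simp: space_after_def)

lemma sum_flow:
  assumes "S \<subseteq> {1..m}" "card S + length hs \<le> m"
  shows "(\<Sum>p\<in>{1..m}. flow m S hs p) = displacement_sum m S hs"
  using assms
proof (induction hs arbitrary: S)
  case (Cons h hs)
  let ?P = "space_after m h ` {..<displacement m S h}"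
  obtain q where q: "q \<in> {1..m}" "q \<notin> S" using ex_free[of S m] Cons.prems by auto
  have lt: "displacement m S h < m" using displacement_free[OF q] by simp
  have "(\<Sum>p\<in>{1..m}. of_bool (p \<in> ?P)) = card ?P"
  proof -
    have "?P \<subseteq> {1..m}" using space_after_mem[of m] lt by auto
    then show ?thesis by (simp add: of_bool_def sum.If_cases Int_absorb1)
  qed
  also have "\<dots> = displacement m S h"
    using card_image[OF inj_on_subset[OF inj_on_space_after, of "{..<displacement m S h}" m h]] lt by simp
  finally show ?case
    using Cons.IH[OF park_step(1,3)[of S m "length hs" h]] Cons.prems
    by (simp add: displacement_sum_Cons sum.distrib del: displacement_sum.simps(2))
qed simp

text \<open>Conservation at \<open>p\<close> for one car: it comes from the preceding space or has
  address \<open>p\<close>, and then parks there or moves on. The bound \<open>d < m\<close> ensures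
  that no space is visited twice.\<close>

lemma path_balance:
  assumes "h \<in> {1..m}" "p \<in> {1..m}" "d < m"
  shows "of_bool (p \<in> space_after m h ` {..<d}) + of_bool (p = space_after m h d)
    = of_bool (pred_space m p \<in> space_after m h ` {..<d}) + (of_bool (p = h) :: nat)"
  using assms(3)
proof (induction d)
  case 0
  then show ?case using space_after_0[OF assms(1)] by simp
next
  case (Suc d)
  have m: "0 < m" using Suc by simp
  have mem: "space_after m h d \<in> {1..m}" using space_after_mem[OF m] .
  have eq: "p = space_after m h (Suc d) \<longleftrightarrow> pred_space m p = space_after m h d"
    unfolding space_after_Suc using rot_pred_space[OF assms(2)] pred_space_rot[OF mem] by metis
  have fresh: "space_after m h d \<notin> space_after m h ` {..<d}"
    using inj_on_image_mem_iff[OF inj_on_space_after, of d m "{..<d}" h] Suc.prems by auto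
  have split: "of_bool (q \<in> space_after m h ` {..<Suc d})
    = of_bool (q \<in> space_after m h ` {..<d}) + (of_bool (q = space_after m h d) :: nat)" for q
    using fresh by (auto simp: lessThan_Suc)
  show ?case using Suc.IH Suc.prems unfolding split eq by simp
qed

lemma flow_balance:
  assumes "S \<subseteq> {1..m}" "card S + length hs \<le> m" "set hs \<subseteq> {1..m}" "p \<in> {1..m}"
  shows "flow m S hs p + of_bool (p \<in> occupied m S hs)
    = flow m S hs (pred_space m p) + count_list hs p + of_bool (p \<in> S)"
  using assms
proof (induction hs arbitrary: S)
  case (Cons h hs)
  obtain q where q: "q \<in> {1..m}" "q \<notin> S" using ex_free[of S m] Cons.prems by auto
  note d = displacement_free[OF q, of h]
  have "of_bool (p \<in> space_after m h ` {..<displacement m S h}) + of_bool (p = park m S h)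
    = of_bool (pred_space m p \<in> space_after m h ` {..<displacement m S h}) + (of_bool (p = h) :: nat)"
    unfolding park_def using d Cons.prems by (intro path_balance) auto
  moreover have "of_bool (p \<in> insert (park m S h) S) = of_bool (p = park m S h) + (of_bool (p \<in> S) :: nat)"
    using d(2) by auto
  moreover have "count_list (h # hs) p = of_bool (p = h) + count_list hs p" by simp
  ultimately show ?case
    using Cons.IH[OF park_step(1,3)[of S m "length hs" h]] Cons.prems
    by (simp only: flow.simps occupied.simps list.set) auto
qed simp

lemma flow_pos_occupied:
  "0 < flow m S hs p \<Longrightarrow> p \<in> occupied m S hs"
proof (induction hs arbitrary: S)
  case (Cons h hs)
  show ?case
  proof (cases "p \<in> space_after m h ` {..<displacement m S h}")
    case True
    then have "p \<in> S" using not_less_Least unfolding displacement_def by fastforce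
    then show ?thesis using occupied_mono[of S m "h # hs"] by blast
  qed (use Cons in auto)
qed simp

text \<open>A queueing recursion: the flow is the positive part of inflow plus arrivals minus one.
  Truncated subtraction on \<open>nat\<close> supplies the positive part.\<close>

lemma flow_eq:
  assumes "n < m" "hs \<in> words m n" "p \<in> {1..m}"
  shows "flow m {} hs p = (flow m {} hs (pred_space m p) + count_list hs p) - 1"
proof -
  have "flow m {} hs p + of_bool (p \<in> occupied m {} hs) = flow m {} hs (pred_space m p) + count_list hs p"
    using flow_balance[of "{}" m hs p] assms by (simp add: mem_words)
  moreover have "p \<in> occupied m {} hs \<or> flow m {} hs p = 0"
    using flow_pos_occupied[of m "{}" hs p] by blast
  ultimately show ?thesis by (cases "p \<in> occupied m {} hs") auto
qed

lemma flow_zero: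
  assumes "n < m" "hs \<in> words m n"
  shows "\<exists>p\<in>{1..m}. flow m {} hs p = 0"
proof -
  have "occupied m {} hs \<subseteq> {1..m}" "card (occupied m {} hs) = n"
    using occupied_card[of "{}" m hs] assms by (auto simp: mem_words)
  from ex_free[OF this(1)] this(2) assms obtain p where "p \<in> {1..m}" "p \<notin> occupied m {} hs" by auto
  then show ?thesis using flow_pos_occupied[of m "{}" hs p] by blast
qed

text \<open>The recursion \<open>flow_eq\<close> is monotone and sees a word only through its letter
  counts. Starting from a space where the flow of \<open>hs\<close> is zero, the inequality
  propagates round the circle.\<close>

lemma flow_mono:
  assumes "n < m" "hs \<in> words m n" "gs \<in> words m n" "mset hs = mset gs" "p \<in> {1..m}"
  shows "flow m {} hs p \<le> flow m {} gs p"
proof -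
  obtain q where q: "q \<in> {1..m}" "flow m {} hs q = 0" using flow_zero[OF assms(1,2)] by blast
  have "flow m {} hs (space_after m q j) \<le> flow m {} gs (space_after m q j)" for j
  proof (induction j)
    case 0
    then show ?case using q space_after_0[OF q(1)] by simp
  next
    case (Suc j)
    let ?r = "space_after m q j"
    have r: "?r \<in> {1..m}" "rot m ?r \<in> {1..m}" using space_after_mem[of m] rot_mem[of m] assms(1) by auto
    have "count_list hs (rot m ?r) = count_list gs (rot m ?r)"
      by (metis assms(4) count_mset)
    then show ?case
      using Suc flow_eq[OF assms(1,2) r(2)] flow_eq[OF assms(1,3) r(2)] pred_space_rot[OF r(1)]
      by (simp add: space_after_Suc)
  qed
  moreover obtain j where "p = space_after m q j"
    using image_space_after[of m q] assms(1,5) by (metis gr_implies_not0 imageE neq0_conv)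
  ultimately show ?thesis by simp
qed

lemma flow_mset:
  assumes "n < m" "hs \<in> words m n" "gs \<in> words m n" "mset hs = mset gs" "p \<in> {1..m}"
  shows "flow m {} hs p = flow m {} gs p"
  using flow_mono[OF assms] flow_mono[OF assms(1,3,2) assms(4)[symmetric] assms(5)] by simp

lemma flow_append: "flow m S (hs @ gs) p = flow m S hs p + flow m (occupied m S hs) gs p"
  by (induction hs arbitrary: S) auto

text \<open>To leave the space before its own address, the last car would have to go round the whole
  circle.\<close>

lemma flow_snoc:
  assumes "n < m" "hs \<in> words m n" "h \<in> {1..m}"
  shows "flow m {} (hs @ [h]) (pred_space m h) = flow m {} hs (pred_space m h)"
proof -
  have "occupied m {} hs \<subseteq> {1..m}" "card (occupied m {} hs) = n"
    using occupied_card[of "{}" m hs] assms by (auto simp: mem_words)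
  from ex_free[OF this(1)] this(2) assms obtain p where p: "p \<in> {1..m}" "p \<notin> occupied m {} hs" by auto
  define d where "d = displacement m (occupied m {} hs) h"
  have d: "d < m" unfolding d_def using displacement_free[OF p] by simp
  have "pred_space m h \<notin> space_after m h ` {..<d}"
  proof
    assume "pred_space m h \<in> space_after m h ` {..<d}"
    then obtain j where j: "j < d" "pred_space m h = space_after m h j" by auto
    then have "h = space_after m h (Suc j)"
      using rot_pred_space[OF assms(3)] by (simp add: space_after_Suc)
    then have "space_after m h 0 = space_after m h (Suc j)" using space_after_0[OF assms(3)] by simp
    then show False using inj_onD[OF inj_on_space_after[of m h], of 0 "Suc j"] j d by simp
  qed
  then show ?thesis by (simp add: flow_append d_def)
qed

lemma total_displacement_squares:
  assumes "n < m" "hs \<in> words m n"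
  shows "2 * total_displacement m hs + n
    = (\<Sum>p\<in>{1..m}. (2 * flow m {} hs (pred_space m p) + count_list hs p) * count_list hs p)"
proof -
  let ?X = "flow m {} hs" and ?o = "\<lambda>p. of_bool (p \<in> occupied m {} hs) :: nat" and ?A = "count_list hs"
  have occ: "occupied m {} hs \<subseteq> {1..m}" "card (occupied m {} hs) = n"
    using occupied_card[of "{}" m hs] assms by (auto simp: mem_words)
  have o: "(\<Sum>p\<in>{1..m}. ?o p) = n" using occ by (simp add: of_bool_def sum.If_cases Int_absorb1)
  have sq: "?X p ^ 2 + 2 * ?X p + ?o p = (?X (pred_space m p))\<^sup>2 + (2 * ?X (pred_space m p) + ?A p) * ?A p"
    if "p \<in> {1..m}" for p
  proof -
    have "?X p + ?o p = ?X (pred_space m p) + ?A p"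
      using flow_balance[of "{}" m hs p] that assms by (auto simp: mem_words)
    then have "(?X p + ?o p)\<^sup>2 = (?X (pred_space m p) + ?A p)\<^sup>2" by simp
    \<comment> \<open>A positive flow forces \<open>p\<close> to be occupied, so the mixed term
      \<open>?X p * ?o p\<close> is just \<open>?X p\<close>.\<close>
    moreover have "(?X p + ?o p)\<^sup>2 = ?X p ^ 2 + 2 * ?X p + ?o p"
      using flow_pos_occupied[of m "{}" hs p] by (cases "p \<in> occupied m {} hs") (auto simp: power2_eq_square)
    ultimately show ?thesis by (simp add: power2_eq_square algebra_simps)
  qed
  have "(\<Sum>p\<in>{1..m}. ?X p ^ 2) + (2 * total_displacement m hs + n) = (\<Sum>p\<in>{1..m}. ?X p ^ 2 + 2 * ?X p + ?o p)"
    using sum_flow[of "{}" m hs] assms o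
    by (simp add: sum.distrib sum_distrib_left[symmetric] total_displacement_def mem_words)
  also have "\<dots> = (\<Sum>p\<in>{1..m}. (?X (pred_space m p))\<^sup>2) +
     (\<Sum>p\<in>{1..m}. (2 * ?X (pred_space m p) + ?A p) * ?A p)"
    unfolding sum.distrib[symmetric] by (intro sum.cong refl sq)
  \<comment> \<open>After this shift the sums of squares on both sides cancel.\<close>
  also have "(\<Sum>p\<in>{1..m}. (?X (pred_space m p))\<^sup>2) = (\<Sum>p\<in>{1..m}. ?X p ^ 2)"
    by (rule sum.reindex_bij_betw[OF bij_betw_pred_space])
  finally show ?thesis by simp
qed

lemma sum_count_list:
  fixes f :: "nat \<Rightarrow> nat"
  assumes "set hs \<subseteq> A" "finite A"
  shows "(\<Sum>p\<in>A. f p * count_list hs p) = (\<Sum>i<length hs. f (hs ! i))"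
  using assms(1)
proof (induction hs)
  case (Cons h hs)
  have "(\<Sum>p\<in>A. f p * count_list (h # hs) p) = (\<Sum>p\<in>A. (if p = h then f p else 0) + f p * count_list hs p)"
    by (intro sum.cong) auto
  also have "\<dots> = f h + (\<Sum>i<length hs. f (hs ! i))"
    using Cons assms(2) by (simp add: sum.distrib)
  finally show ?case by (simp del: count_list.simps sum.lessThan_Suc add: sum.lessThan_Suc_shift)
qed simp

text \<open>Swapping the positions \<open>0\<close> and \<open>i\<close> is an involution on words, so in a sum over all words a
  symmetric weight may be evaluated at the first letter.\<close>

lemma sum_words_letter:
  fixes g :: "nat \<Rightarrow> nat multiset \<Rightarrow> nat"
  shows "(\<Sum>hs\<in>words m (Suc n). \<Sum>i<Suc n. g (hs ! i) (mset hs))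
    = Suc n * (\<Sum>hs\<in>words m n. \<Sum>h\<in>{1..m}. g h (add_mset h (mset hs)))"
proof -
  have step: "(\<Sum>hs\<in>words m (Suc n). g (hs ! i) (mset hs)) = (\<Sum>hs\<in>words m (Suc n). g (hs ! 0) (mset hs))"
    if i: "i < Suc n" for i
  proof -
    define sw where "sw hs = hs[0 := hs ! i, i := hs ! 0]" for hs :: "nat list"
    have ms: "mset (sw hs) = mset hs" "length (sw hs) = length hs" "sw (sw hs) = hs" "sw hs ! 0 = hs ! i"
      if "length hs = Suc n" for hs
    proof -
      show "mset (sw hs) = mset hs" unfolding sw_def using i that by (intro mset_swap) auto
      show "length (sw hs) = length hs" by (simp add: sw_def)
      show "sw (sw hs) = hs" using i that by (auto simp: sw_def nth_list_update intro!: nth_equalityI)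
      show "sw hs ! 0 = hs ! i" using i that by (cases "i = 0") (auto simp: sw_def)
    qed
    have mem: "sw hs \<in> words m (Suc n)" if "hs \<in> words m (Suc n)" for hs
      using that ms[of hs] mset_eq_setD[of "sw hs" hs] by (simp add: mem_words)
    have "bij_betw sw (words m (Suc n)) (words m (Suc n))"
      using mem ms(3) by (intro bij_betw_byWitness[where f' = sw]) (auto simp: mem_words)
    then have "(\<Sum>hs\<in>words m (Suc n). g (hs ! 0) (mset hs))
      = (\<Sum>hs\<in>words m (Suc n). g (sw hs ! 0) (mset (sw hs)))"
      by (rule sum.reindex_bij_betw[symmetric])
    also have "\<dots> = (\<Sum>hs\<in>words m (Suc n). g (hs ! i) (mset hs))"
      using ms by (intro sum.cong refl) (simp add: mem_words)
    finally show ?thesis by simp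
  qed
  have "(\<Sum>hs\<in>words m (Suc n). \<Sum>i<Suc n. g (hs ! i) (mset hs))
    = (\<Sum>i<Suc n. \<Sum>hs\<in>words m (Suc n). g (hs ! i) (mset hs))" by (rule sum.swap)
  also have "\<dots> = (\<Sum>i<Suc n. \<Sum>hs\<in>words m (Suc n). g (hs ! 0) (mset hs))"
    by (intro sum.cong refl step) simp
  also have "\<dots> = Suc n * (\<Sum>hs\<in>words m (Suc n). g (hs ! 0) (mset hs))" by simp
  also have "(\<Sum>hs\<in>words m (Suc n). g (hs ! 0) (mset hs))
    = (\<Sum>(h, hs)\<in>{1..m} \<times> words m n. g h (add_mset h (mset hs)))"
  proof (rule sum.reindex_bij_witness[where i = "\<lambda>(h, hs). h # hs" and j = "\<lambda>hs. (hd hs, tl hs)"])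
    fix hs assume "hs \<in> words m (Suc n)"
    then obtain h gs where "hs = h # gs" "h \<in> {1..m}" "gs \<in> words m n"
      by (cases hs) (auto simp: mem_words)
    then show "(case (hd hs, tl hs) of (h, hs) \<Rightarrow> h # hs) = hs" "(hd hs, tl hs) \<in> {1..m} \<times> words m n"
      "(case (hd hs, tl hs) of (h, hs) \<Rightarrow> g h (add_mset h (mset hs))) = g (hs ! 0) (mset hs)" by auto
  qed (auto simp: mem_words subset_iff)
  also have "\<dots> = (\<Sum>hs\<in>words m n. \<Sum>h\<in>{1..m}. g h (add_mset h (mset hs)))"
    by (subst sum.swap) (simp add: sum.cartesian_product)
  finally show ?thesis .
qed

text \<open>By \<open>total_displacement_squares\<close> the displacement is a sum over letters of a
  function of the letter and the multiset. By symmetry the letter may be that of the last car, and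
  removing this car leaves the flow into its address unchanged.\<close>

lemma sum_total_displacement_Suc:
  assumes "Suc n < m"
  shows "2 * (\<Sum>hs\<in>words m (Suc n). total_displacement m hs)
    = Suc n * (2 * (\<Sum>hs\<in>words m n. total_displacement m hs) + n * m ^ n)"
proof -
  \<comment> \<open>A representative word for each multiset makes the flow a function of the
    multiset, as \<open>sum_words_letter\<close> requires; by \<open>flow_mset\<close> the choice is
    immaterial.\<close>
  define f where "f M = (SOME hs. hs \<in> words m (Suc n) \<and> mset hs = M)" for M
  have f: "f (mset hs) \<in> words m (Suc n) \<and> mset (f (mset hs)) = mset hs" if "hs \<in> words m (Suc n)" for hs
    unfolding f_def by (rule someI[of _ hs]) (use that in simp)
  define g where "g h M = 2 * flow m {} (f M) (pred_space m h) + count M h" for h M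
  have g: "g h (mset hs) = 2 * flow m {} hs (pred_space m h) + count_list hs h"
    if "hs \<in> words m (Suc n)" "h \<in> {1..m}" for h hs
    unfolding g_def using f[OF that(1)] flow_mset[OF assms, of "f (mset hs)" hs] that pred_space_mem
    by (simp add: count_mset)
  \<comment> \<open>The extra 1 is the removed car in the count of its own address.\<close>
  have g': "g h (add_mset h (mset hs)) = 2 * flow m {} hs (pred_space m h) + count_list hs h + 1"
    if "hs \<in> words m n" "h \<in> {1..m}" for h hs
  proof -
    have mem: "hs @ [h] \<in> words m (Suc n)" using that by (auto simp: mem_words)
    have "g h (add_mset h (mset hs)) = g h (mset (hs @ [h]))" by simp
    also have "\<dots> = 2 * flow m {} (hs @ [h]) (pred_space m h) + count_list (hs @ [h]) h"
      using g[OF mem that(2)] .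
    finally show ?thesis using flow_snoc[OF _ that, of] assms by simp
  qed
  have "2 * (\<Sum>hs\<in>words m (Suc n). total_displacement m hs) + Suc n * m ^ Suc n
    = (\<Sum>hs\<in>words m (Suc n). 2 * total_displacement m hs + Suc n)"
    by (simp only: sum.distrib sum_distrib_left[symmetric] sum_constant card_words) simp
  also have "\<dots> = (\<Sum>hs\<in>words m (Suc n). \<Sum>i<Suc n. g (hs ! i) (mset hs))"
  proof (intro sum.cong refl)
    fix hs assume hs: "hs \<in> words m (Suc n)"
    have "2 * total_displacement m hs + Suc n = (\<Sum>p\<in>{1..m}. g p (mset hs) * count_list hs p)"
      using total_displacement_squares[OF assms hs] g[OF hs] by simp
    also have "\<dots> = (\<Sum>i<Suc n. g (hs ! i) (mset hs))"
      using sum_count_list[of hs "{1..m}" "\<lambda>p. g p (mset hs)"] hs by (simp add: mem_words)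
    finally show "2 * total_displacement m hs + Suc n = (\<Sum>i<Suc n. g (hs ! i) (mset hs))" .
  qed
  also have "\<dots> = Suc n * (\<Sum>hs\<in>words m n. \<Sum>h\<in>{1..m}. g h (add_mset h (mset hs)))"
    by (rule sum_words_letter)
  also have "(\<Sum>hs\<in>words m n. \<Sum>h\<in>{1..m}. g h (add_mset h (mset hs)))
    = (\<Sum>hs\<in>words m n. 2 * total_displacement m hs + n + m)"
  proof (intro sum.cong refl)
    fix hs assume hs: "hs \<in> words m n"
    have "(\<Sum>h\<in>{1..m}. g h (add_mset h (mset hs)))
      = (\<Sum>h\<in>{1..m}. 2 * flow m {} hs (pred_space m h) + count_list hs h + 1)"
      by (intro sum.cong refl g'[OF hs])
    also have "\<dots> = 2 * (\<Sum>h\<in>{1..m}. flow m {} hs (pred_space m h)) + (\<Sum>h\<in>{1..m}. 1 * count_list hs h) + m"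
      by (simp only: sum.distrib sum_distrib_left) simp
    also have "(\<Sum>h\<in>{1..m}. 1 * count_list hs h) = n"
      using sum_count_list[of hs "{1..m}" "\<lambda>_. 1"] hs by (simp add: mem_words)
    also have "(\<Sum>h\<in>{1..m}. flow m {} hs (pred_space m h)) = (\<Sum>h\<in>{1..m}. flow m {} hs h)"
      by (rule sum.reindex_bij_betw[OF bij_betw_pred_space])
    also have "\<dots> = total_displacement m hs"
      using sum_flow[of "{}" m hs] hs assms by (simp add: total_displacement_def mem_words)
    finally show "(\<Sum>h\<in>{1..m}. g h (add_mset h (mset hs))) = 2 * total_displacement m hs + n + m" .
  qed
  also have "\<dots> = 2 * (\<Sum>hs\<in>words m n. total_displacement m hs) + (n + m) * m ^ n"
    by (simp only: sum.distrib sum_distrib_left[symmetric] sum_constant card_words) (simp add: algebra_simps)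
  finally show ?thesis by (simp add: algebra_simps)
qed

section \<open>Uniform words\<close>

lemma addresses_eq:
  assumes "0 < m"
  shows "addresses m n = pmf_of_set (words m n)"
proof (rule pmf_eqI)
  have ne: "words m n \<noteq> {}" using assms card_words[of m n] by force
  have "pmf (replicate_pmf n (pmf_of_set {1..m})) hs = (if hs \<in> words m n then 1 / real m ^ n else 0)" for hs
  proof (induction n arbitrary: hs)
    case 0
    then show ?case by (auto simp: mem_words indicator_def)
  next
    case (Suc n)
    have "replicate_pmf (Suc n) (pmf_of_set {1..m})
      = map_pmf (\<lambda>(x, xs). x # xs) (pair_pmf (pmf_of_set {1..m}) (replicate_pmf n (pmf_of_set {1..m})))"
      by (simp add: pair_pmf_def map_bind_pmf)
    show ?case
    proof (cases hs)
      case Nil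
      have "[] \<notin> set_pmf (replicate_pmf (Suc n) (pmf_of_set {1..m}))" by (simp only: set_replicate_pmf) simp
      then show ?thesis using Nil by (simp add: pmf_eq_0_set_pmf mem_words del: replicate_pmf.simps)
    next
      case (Cons h gs)
      have "pmf (replicate_pmf (Suc n) (pmf_of_set {1..m})) hs
        = pmf (pair_pmf (pmf_of_set {1..m}) (replicate_pmf n (pmf_of_set {1..m}))) (h, gs)"
        unfolding \<open>replicate_pmf (Suc n) _ = _\<close> Cons
        using pmf_map_inj'[of "\<lambda>(x, xs). x # xs" _ "(h, gs)"] by (simp add: inj_on_def split_def)
      also have "\<dots> = (if hs \<in> words m (Suc n) then 1 / real m ^ Suc n else 0)"
        using assms by (simp only: pmf_pair Suc.IH) (auto simp: pmf_of_set Cons mem_words indicator_def)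
      finally show ?thesis .
    qed
  qed
  then show "pmf (addresses m n) hs = pmf (pmf_of_set (words m n)) hs" for hs
    using ne by (simp add: addresses_def pmf_of_set finite_words card_words)
qed

lemma words_nonempty: "0 < m \<Longrightarrow> words m n \<noteq> {}"
  using card_words[of m n] by force

lemma expectation_addresses:
  fixes f :: "nat list \<Rightarrow> real"
  assumes "0 < m"
  shows "measure_pmf.expectation (addresses m n) f = (\<Sum>hs\<in>words m n. f hs) / real m ^ n"
  unfolding addresses_eq[OF assms]
  by (subst integral_pmf_of_set) (use words_nonempty[OF assms] in \<open>simp_all add: finite_words card_words\<close>)

lemma prob_addresses:
  assumes "0 < m"
  shows "measure_pmf.prob (addresses m n) A = real (card (words m n \<inter> A)) / real m ^ n"
  unfolding addresses_eq[OF assms]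
  by (subst measure_pmf_of_set) (use words_nonempty[OF assms] in \<open>simp_all add: finite_words card_words\<close>)

section \<open>The expected displacement\<close>

lemma expected_displacement_0: "expected_displacement m 0 = 0"
  by (simp add: expected_displacement_def addresses_def total_displacement_def)

lemma expected_displacement_Suc:
  assumes "Suc n < m"
  shows "expected_displacement m (Suc n)
    = real (Suc n) / real m * expected_displacement m n + real n * real (Suc n) / (2 * real m)"
proof -
  have m: "0 < m" using assms by simp
  define T where "T n = real (\<Sum>hs\<in>words m n. total_displacement m hs)" for n
  have "2 * T (Suc n) = real (Suc n) * (2 * T n + real n * real m ^ n)"
    using arg_cong[OF sum_total_displacement_Suc[OF assms], of real]
    by (simp only: of_nat_mult of_nat_add of_nat_power of_nat_numeral T_def)
  then have "T (Suc n) = real (Suc n) * (T n + real n * real m ^ n / 2)"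
    by (simp only: distrib_left)
  moreover have E: "expected_displacement m n = T n / real m ^ n" for n
    by (simp add: expected_displacement_def expectation_addresses[OF m] T_def)
  ultimately show ?thesis using m unfolding E by (simp add: field_simps del: of_nat_Suc)
qed

text \<open>The fixed point of \<open>e = u * e + u^2 / 2\<close>, the limiting form of the
  recursion for \<open>expected_displacement m n / m\<close> at load
  \<open>u = n / m\<close>.\<close>

definition mean_flow :: "real \<Rightarrow> real" where
  "mean_flow u = u\<^sup>2 / (2 * (1 - u))"

lemma mean_flow_fixpoint: "u < 1 \<Longrightarrow> u * mean_flow u + u\<^sup>2 / 2 = mean_flow u"
  by (simp add: mean_flow_def field_simps power2_eq_square)

text \<open>\<open>mean_flow\<close> is increasing, and enlarging \<open>n\<close> to
  \<open>n + 1\<close> in the inhomogeneous term produces exactly the fixed point equation at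
  \<open>u\<close>.\<close>

lemma expected_displacement_upper:
  assumes "n < m"
  shows "expected_displacement m n \<le> real m * mean_flow (real n / real m)"
  using assms
proof (induction n)
  case 0
  then show ?case by (simp add: expected_displacement_0 mean_flow_def)
next
  case (Suc n)
  define u where "u = real (Suc n) / real m"
  have u: "0 < u" "u < 1" "real m > 0" using Suc by (auto simp: u_def)
  have v: "real n / real m \<le> u" "0 \<le> real n / real m" by (auto simp: u_def divide_right_mono)
  have "mean_flow (real n / real m) \<le> mean_flow u"
    unfolding mean_flow_def using u v by (intro frac_le power_mono mult_left_mono) auto
  then have "expected_displacement m n \<le> real m * mean_flow u"
    using Suc u(3) by (meson Suc_lessD mult_left_mono less_imp_le order_trans)
  then have "u * expected_displacement m n \<le> u * (real m * mean_flow u)"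
    using u by (intro mult_left_mono) auto
  moreover have "real n * real (Suc n) / (2 * real m) \<le> real m * (u\<^sup>2 / 2)"
    using u(3) by (simp add: u_def power2_eq_square field_simps)
  moreover have "expected_displacement m (Suc n)
      = u * expected_displacement m n + real n * real (Suc n) / (2 * real m)"
    unfolding u_def by (rule expected_displacement_Suc[OF Suc.prems])
  moreover have "real m * (u * mean_flow u + u\<^sup>2 / 2) = u * (real m * mean_flow u) + real m * (u\<^sup>2 / 2)"
    by (simp add: algebra_simps)
  ultimately have "expected_displacement m (Suc n) \<le> real m * (u * mean_flow u + u\<^sup>2 / 2)"
    by linarith
  then show ?case unfolding mean_flow_fixpoint[OF u(2)] by (simp only: u_def)
qed

text \<open>A Lipschitz bound on \<open>[0, a]\<close>, used to compare two consecutive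
  loads.\<close>

lemma mean_flow_diff:
  assumes "0 \<le> v" "v \<le> u" "u \<le> a" "a < 1"
  shows "mean_flow u - mean_flow v \<le> (u - v) / (1 - a)\<^sup>2"
proof -
  have pos: "1 - u > 0" "1 - v > 0" "1 - a > 0" using assms by auto
  have "mean_flow u - mean_flow v = (u - v) * (u + v - u * v) / (2 * ((1 - u) * (1 - v)))"
    unfolding mean_flow_def
  proof (subst diff_frac_eq)
    show "(u\<^sup>2 * (2 * (1 - v)) - v\<^sup>2 * (2 * (1 - u))) / (2 * (1 - u) * (2 * (1 - v)))
      = (u - v) * (u + v - u * v) / (2 * ((1 - u) * (1 - v)))"
    proof (subst frac_eq_eq)
      show "(u\<^sup>2 * (2 * (1 - v)) - v\<^sup>2 * (2 * (1 - u))) * (2 * ((1 - u) * (1 - v)))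
        = (u - v) * (u + v - u * v) * (2 * (1 - u) * (2 * (1 - v)))"
        by (simp add: power2_eq_square algebra_simps)
    qed (use pos in simp_all)
  qed (use pos in auto)
  also have "\<dots> \<le> (u - v) * 2 / (2 * ((1 - a) * (1 - a)))"
  proof (intro frac_le mult_left_mono mult_mono)
    show "u + v - u * v \<le> 2" using assms by (smt (verit) mult_nonneg_nonneg)
  qed (use assms pos in auto)
  also have "\<dots> = (u - v) / (1 - a)\<^sup>2"
    unfolding power2_eq_square mult.commute[of "u - v" 2] by (rule mult_divide_mult_cancel_left) simp
  finally show ?thesis .
qed

text \<open>One step loses at most \<open>1 / (1 - a)^2\<close> through the change of load and
  \<open>u / 2\<close> in the inhomogeneous term. The factor \<open>u <= a < 1\<close> contracts the
  earlier error, so a constant \<open>C\<close> with \<open>(1 - a) * C = 1 / (1 - a)^2 + 1\<close>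
  survives the induction.\<close>

lemma expected_displacement_lower:
  assumes "n < m" "real n / real m \<le> a" "a < 1"
  shows "real m * mean_flow (real n / real m) - (1 / (1 - a)\<^sup>2 + 1) / (1 - a) \<le> expected_displacement m n"
  using assms(1,2)
proof (induction n)
  case 0
  then show ?case using assms(3) by (simp add: expected_displacement_0 mean_flow_def)
next
  case (Suc n)
  define C where "C = (1 / (1 - a)\<^sup>2 + 1) / (1 - a)"
  define u v where "u = real (Suc n) / real m" and "v = real n / real m"
  have m: "real m > 0" using Suc by auto
  have u: "0 < u" "u < 1" "u \<le> a" "v \<le> u" "0 \<le> v" "u - v = 1 / real m"
    using Suc by (auto simp: u_def v_def divide_right_mono diff_divide_distrib[symmetric])
  then have "v \<le> a" by simp
  have C: "C \<ge> 0" using assms(3) by (simp add: C_def)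
  have IH: "real m * mean_flow v - C \<le> expected_displacement m n"
    using Suc.IH Suc.prems \<open>v \<le> a\<close> by (simp add: v_def C_def)
  have "real m * mean_flow u - real m * mean_flow v \<le> 1 / (1 - a)\<^sup>2"
    using mean_flow_diff[of v u a] u assms(3) m by (simp add: field_simps)
  then have "real m * mean_flow u - 1 / (1 - a)\<^sup>2 - C \<le> expected_displacement m n" using IH by simp
  then have 1: "u * (real m * mean_flow u - 1 / (1 - a)\<^sup>2 - C) \<le> u * expected_displacement m n"
    using u by (intro mult_left_mono) auto
  have 2: "u * (1 / (1 - a)\<^sup>2) \<le> 1 / (1 - a)\<^sup>2"
    using mult_right_mono[of u 1 "1 / (1 - a)\<^sup>2"] u by simp
  have 3: "u * C \<le> a * C" using u C by (intro mult_right_mono) auto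
  have 4: "C - a * C = 1 / (1 - a)\<^sup>2 + 1"
  proof -
    have "(1 - a) * C = 1 / (1 - a)\<^sup>2 + 1" using assms(3) by (simp add: C_def)
    then show ?thesis by (simp add: left_diff_distrib)
  qed
  have 5: "real n * real (Suc n) / (2 * real m) = real m * (u\<^sup>2 / 2) - u / 2"
    using m by (simp add: u_def power2_eq_square field_simps)
  have "expected_displacement m (Suc n) = u * expected_displacement m n + real m * (u\<^sup>2 / 2) - u / 2"
    using expected_displacement_Suc[OF Suc.prems(1)] unfolding 5 u_def[symmetric] by linarith
  then have "real m * (u * mean_flow u + u\<^sup>2 / 2) - C \<le> expected_displacement m (Suc n)"
  proof -
    assume E: "expected_displacement m (Suc n) = u * expected_displacement m n + real m * (u\<^sup>2 / 2) - u / 2"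
    obtain A q where A: "A = real m * mean_flow u" and q: "q = 1 / (1 - a)\<^sup>2" by blast
    have "u * A - u * q - u * C \<le> u * expected_displacement m n"
      using 1 unfolding A[symmetric] q[symmetric] by (simp only: right_diff_distrib)
    moreover have "real m * (u * mean_flow u + u\<^sup>2 / 2) = u * A + real m * (u\<^sup>2 / 2)"
      by (simp add: A algebra_simps)
    ultimately show ?thesis using E 2 3 4 u(1,2) unfolding q[symmetric] by argo
  qed
  then show ?case unfolding mean_flow_fixpoint[OF u(2)] by (simp only: u_def C_def)
qed

lemma expected_displacement_limit:
  fixes m n :: "nat \<Rightarrow> nat"
  assumes \<mu>: "0 < \<mu>" "\<mu> < 1"
    and m_lim: "filterlim m at_top sequentially"
    and ratio: "(\<lambda>k. real (n k) / real (m k)) \<longlonglongrightarrow> \<mu>"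
  shows "(\<lambda>k. expected_displacement (m k) (n k) / real (m k)) \<longlonglongrightarrow> mean_flow \<mu>"
proof -
  define a where "a = (1 + \<mu>) / 2"
  have a: "\<mu> < a" "a < 1" using \<mu> by (auto simp: a_def)
  define C where "C = (1 / (1 - a)\<^sup>2 + 1) / (1 - a)"
  have lim: "(\<lambda>k. mean_flow (real (n k) / real (m k))) \<longlonglongrightarrow> mean_flow \<mu>"
    unfolding mean_flow_def using \<mu> by (intro tendsto_intros ratio) auto
  have m_real: "filterlim (\<lambda>k. real (m k)) at_top sequentially"
    by (rule filterlim_compose[OF filterlim_real_sequentially m_lim])
  have ev: "eventually (\<lambda>k. real (n k) / real (m k) < a \<and> real (m k) > 0) sequentially"
    using order_tendstoD(2)[OF ratio a(1)] filterlim_at_top_dense[THEN iffD1, OF m_real, rule_format, of 0]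
    by eventually_elim auto
  show ?thesis
  proof (rule tendsto_sandwich)
    show "eventually (\<lambda>k. mean_flow (real (n k) / real (m k)) - C / real (m k)
        \<le> expected_displacement (m k) (n k) / real (m k)) sequentially"
      using ev
    proof eventually_elim
      case (elim k)
      then have "real (n k) / real (m k) < 1" using a by linarith
      with elim have "n k < m k" by simp
      from expected_displacement_lower[OF this _ a(2)] elim
      have "real (m k) * mean_flow (real (n k) / real (m k)) - C \<le> expected_displacement (m k) (n k)"
        by (simp add: C_def)
      from divide_right_mono[OF this, of "real (m k)"] elim show ?case
        by (simp add: diff_divide_distrib)
    qed
    show "eventually (\<lambda>k. expected_displacement (m k) (n k) / real (m k)
        \<le> mean_flow (real (n k) / real (m k))) sequentially"
      using ev
    proof eventually_elim
      case (elim k)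
      then have "real (n k) / real (m k) < 1" using a by linarith
      with elim have "n k < m k" by simp
      from expected_displacement_upper[OF this] elim show ?case
        by (simp add: field_simps)
    qed
    have "(\<lambda>k. C / real (m k)) \<longlonglongrightarrow> 0" by (rule tendsto_divide_0[OF tendsto_const])
      (use m_real in \<open>simp add: filterlim_at_top_imp_at_infinity\<close>)
    from tendsto_diff[OF lim this]
    show "(\<lambda>k. mean_flow (real (n k) / real (m k)) - C / real (m k)) \<longlonglongrightarrow> mean_flow \<mu>" by simp
  qed (rule lim)
qed

section \<open>Bounds on the displacement\<close>

lemma displacement_sum_distinct:
  assumes "distinct hs" "set hs \<subseteq> {1..m}" "set hs \<inter> S = {}"
  shows "displacement_sum m S hs = 0"
  using assms
proof (induction hs arbitrary: S)
  case (Cons h hs)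
  have "space_after m h 0 \<notin> S" using Cons.prems space_after_0[of h m] by auto
  then have d: "displacement m S h = 0" unfolding displacement_def by (intro Least_eq_0)
  then have "park m S h = h" using Cons.prems space_after_0[of h m] by (simp add: park_def)
  with Cons d show ?case by (simp add: displacement_sum_Cons del: displacement_sum.simps(2))
qed simp

lemma card_displacement_zero:
  assumes "n \<le> m"
  shows "fact m / fact (m - n) \<le> real (card {hs \<in> words m n. total_displacement m hs = 0})"
proof -
  have "(\<Prod>{m - n + 1..m}) = fact m div fact (m - n)"
    using fact_div_fact[of "m - n" m] assms by simp
  then have "fact m / fact (m - n) = real (\<Prod>{m - n + 1..m})"
    using fact_dvd[of "m - n" m, where 'a = nat] by (simp add: real_of_nat_div)
  also have "\<dots> = real (card {hs. length hs = n \<and> distinct hs \<and> set hs \<subseteq> {1..m}})"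
    using card_lists_distinct_length_eq[of "{1..m}" n] assms by simp
  also have "\<dots> \<le> real (card {hs \<in> words m n. total_displacement m hs = 0})"
  proof (intro of_nat_mono card_mono)
    show "finite {hs \<in> words m n. total_displacement m hs = 0}" using finite_words by simp
    show "{hs. length hs = n \<and> distinct hs \<and> set hs \<subseteq> {1..m}} \<subseteq> {hs \<in> words m n. total_displacement m hs = 0}"
      using displacement_sum_distinct[of _ m "{}"] by (auto simp: mem_words total_displacement_def)
  qed
  finally show ?thesis .
qed

text \<open>Address and distance play symmetric roles, so for a known distance the injectivity of
  \<open>space_after\<close> in its last argument recovers the address.\<close>

lemma space_after_swap: "1 \<le> h \<Longrightarrow> space_after m h d = space_after m (Suc d) (h - 1)"
  by (simp add: space_after_def add.commute)

text \<open>A car is determined by where it parks and how far it moved.\<close>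

lemma sum_power_displacement:
  fixes q :: real
  assumes q: "0 < q" "q < 1" and S: "S \<subseteq> {1..m}" "card S < m"
  shows "(\<Sum>h\<in>{1..m}. q ^ displacement m S h) \<le> real (m - card S) / (1 - q)"
proof -
  obtain p where p: "p \<in> {1..m}" "p \<notin> S" using ex_free[OF S] by blast
  note d = displacement_free[OF p]
  let ?f = "\<lambda>h. (park m S h, displacement m S h)"
  have inj: "inj_on ?f {1..m}"
  proof (rule inj_onI)
    fix h g assume h: "h \<in> {1..m}" and g: "g \<in> {1..m}" and eq: "?f h = ?f g"
    then have "space_after m (Suc (displacement m S h)) (h - 1) = space_after m (Suc (displacement m S h)) (g - 1)"
      using space_after_swap[of h m] space_after_swap[of g m] by (auto simp: park_def)
    then have "h - 1 = g - 1" using inj_onD[OF inj_on_space_after] h g by fastforce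
    then show "h = g" using h g by auto
  qed
  have "(\<Sum>h\<in>{1..m}. q ^ displacement m S h) = (\<Sum>x\<in>?f ` {1..m}. q ^ snd x)"
    by (subst sum.reindex[OF inj]) simp
  also have "\<dots> \<le> (\<Sum>x\<in>({1..m} - S) \<times> {..<m}. q ^ snd x)"
    using d q by (intro sum_mono2) auto
  also have "\<dots> = (\<Sum>p\<in>{1..m} - S. \<Sum>j<m. q ^ j)"
    unfolding sum.cartesian_product by (simp add: split_def)
  also have "\<dots> = real (m - card S) * (\<Sum>j<m. q ^ j)"
    using S by (simp add: card_Diff_subset finite_subset)
  also have "\<dots> \<le> real (m - card S) * (1 / (1 - q))"
  proof (intro mult_left_mono)
    have "(\<Sum>j<m. q ^ j) = (1 - q ^ m) / (1 - q)" using q by (simp add: sum_gp_strict)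
    also have "\<dots> \<le> 1 / (1 - q)" using q by (intro divide_right_mono) auto
    finally show "(\<Sum>j<m. q ^ j) \<le> 1 / (1 - q)" .
  qed simp
  finally show ?thesis by simp
qed

lemma sum_words_Suc:
  fixes f :: "nat list \<Rightarrow> real"
  shows "(\<Sum>hs\<in>words m (Suc n). f hs) = (\<Sum>h\<in>{1..m}. \<Sum>hs\<in>words m n. f (h # hs))"
proof -
  have "(\<Sum>hs\<in>words m (Suc n). f hs) = (\<Sum>(h, hs)\<in>{1..m} \<times> words m n. f (h # hs))"
  proof (rule sum.reindex_bij_witness[where i = "\<lambda>(h, hs). h # hs" and j = "\<lambda>hs. (hd hs, tl hs)"])
    fix hs assume "hs \<in> words m (Suc n)"
    then obtain h gs where "hs = h # gs" "h \<in> {1..m}" "gs \<in> words m n"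
      by (cases hs) (auto simp: mem_words)
    then show "(case (hd hs, tl hs) of (h, hs) \<Rightarrow> h # hs) = hs" "(hd hs, tl hs) \<in> {1..m} \<times> words m n"
      "(case (hd hs, tl hs) of (h, hs) \<Rightarrow> f (h # hs)) = f hs" by auto
  qed (auto simp: mem_words subset_iff)
  then show ?thesis by (simp add: sum.cartesian_product)
qed

text \<open>The cars are bounded one at a time: each contributes the number of spaces still free
  over \<open>1 - q\<close>, and these numbers multiply to a falling factorial.\<close>

lemma sum_power_displacement_sum:
  fixes q :: real
  assumes q: "0 < q" "q < 1" and S: "S \<subseteq> {1..m}" "card S + n \<le> m"
  shows "(\<Sum>hs\<in>words m n. q ^ displacement_sum m S hs)
    \<le> fact (m - card S) / fact (m - card S - n) / (1 - q) ^ n"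
  using S
proof (induction n arbitrary: S)
  case 0
  have "words m 0 = {[]}" by (auto simp: mem_words)
  then show ?case by simp
next
  case (Suc n)
  let ?c = "fact (m - card S - 1) / fact (m - card S - Suc n) / (1 - q) ^ n"
  have "(\<Sum>hs\<in>words m (Suc n). q ^ displacement_sum m S hs)
    = (\<Sum>h\<in>{1..m}. q ^ displacement m S h * (\<Sum>hs\<in>words m n. q ^ displacement_sum m (insert (park m S h) S) hs))"
    by (simp add: sum_words_Suc displacement_sum_Cons power_add sum_distrib_left del: displacement_sum.simps(2))
  also have "\<dots> \<le> (\<Sum>h\<in>{1..m}. q ^ displacement m S h * ?c)"
  proof (intro sum_mono mult_left_mono)
    fix h
    note st = park_step[OF Suc.prems(1), of n h]
    have "card S + Suc n \<le> m" using Suc.prems(2) .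
    from Suc.IH[OF st(1)[OF this] st(3)[OF this]] st(2)[OF this]
    show "(\<Sum>hs\<in>words m n. q ^ displacement_sum m (insert (park m S h) S) hs) \<le> ?c" by simp
  qed (use q in simp)
  also have "\<dots> = (\<Sum>h\<in>{1..m}. q ^ displacement m S h) * ?c" by (rule sum_distrib_right[symmetric])
  also have "\<dots> \<le> real (m - card S) / (1 - q) * ?c"
    using q Suc.prems by (intro mult_right_mono sum_power_displacement) auto
  also have "\<dots> = fact (m - card S) / fact (m - card S - Suc n) / (1 - q) ^ Suc n"
    using Suc.prems(2) fact_reduce[of "m - card S", where 'a = real] by (simp add: field_simps)
  finally show ?case .
qed

text \<open>A car with address \<open>h\<close> and displacement \<open>d\<close> parks in space
  \<open>h + d\<close>, or in a smaller one after wrapping round.\<close>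

lemma displacement_sum_sum:
  assumes "S \<subseteq> {1..m}" "card S + length hs \<le> m" "set hs \<subseteq> {1..m}"
  shows "\<Sum>(occupied m S hs) \<le> displacement_sum m S hs + sum_list hs + \<Sum>S"
  using assms
proof (induction hs arbitrary: S)
  case (Cons h hs)
  obtain q where q: "q \<in> {1..m}" "q \<notin> S" using ex_free[of S m] Cons.prems by auto
  have "park m S h \<le> h + displacement m S h"
  proof -
    have "1 \<le> h" using Cons.prems(3) by simp
    with mod_less_eq_dividend[of "h - 1 + displacement m S h" m] show ?thesis
      unfolding park_def space_after_def by linarith
  qed
  moreover have "\<Sum>(insert (park m S h) S) = park m S h + \<Sum>S"
    using displacement_free[OF q, of h] Cons.prems(1) by (simp add: finite_subset)
  moreover have "\<Sum>(occupied m S (h # hs)) \<le> displacement_sum m (insert (park m S h) S) hs + sum_list hs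
      + \<Sum>(insert (park m S h) S)"
    using Cons.IH[OF park_step(1,3)[of S m "length hs" h]] Cons.prems by simp
  ultimately show ?case by (simp add: displacement_sum_Cons del: displacement_sum.simps(2))
qed simp

text \<open>All spaces but one get filled, so the spaces used sum to about \<open>8 * k^2\<close>,
  while the addresses sum to at most \<open>k * (4 * k - 1)\<close>: the displacement is quadratic
  in the size of the circle.\<close>

lemma total_displacement_clustered:
  assumes "0 < k" "hs \<in> words k (4 * k - 1)"
  shows "k * (4 * k - 1) \<le> total_displacement (4 * k) hs"
proof -
  let ?m = "4 * k"
  have hs: "set hs \<subseteq> {1..?m}" "length hs = ?m - 1" using assms by (auto simp: mem_words)
  have occ: "occupied ?m {} hs \<subseteq> {1..?m}" "card (occupied ?m {} hs) = ?m - 1"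
    using occupied_card[of "{}" ?m hs] hs by auto
  obtain p where p: "p \<in> {1..?m}" "p \<notin> occupied ?m {} hs" using ex_free[OF occ(1)] occ(2) assms(1) by auto
  have "occupied ?m {} hs = {1..?m} - {p}"
    using p occ by (intro card_subset_eq) auto
  then have "\<Sum>{1..?m} = \<Sum>(occupied ?m {} hs) + p"
    using p(1) sum.remove[of "{1..?m}" p "\<lambda>x. x"] by simp
  moreover have "2 * \<Sum>{1..?m} = ?m * (?m + 1)" using gauss_sum_from_Suc_0[of ?m, where 'a = nat] by simp
  ultimately have "?m * (?m + 1) \<le> 2 * \<Sum>(occupied ?m {} hs) + 2 * ?m" using p(1) by simp
  moreover have "\<Sum>(occupied ?m {} hs) \<le> total_displacement ?m hs + sum_list hs"
    using displacement_sum_sum[of "{}" ?m hs] hs by (simp add: total_displacement_def)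
  moreover have "sum_list hs \<le> (?m - 1) * k"
  proof -
    have "\<And>h. h \<in> set hs \<Longrightarrow> h \<le> k" using assms(2) by (auto simp: mem_words)
    then have "sum_list (map (\<lambda>h. h) hs) \<le> sum_list (map (\<lambda>_. k) hs)" by (intro sum_list_mono)
    then show ?thesis using hs(2) by (simp add: sum_list_triv)
  qed
  ultimately have "?m * (?m + 1) \<le> 2 * total_displacement ?m hs + 2 * ((?m - 1) * k) + 2 * ?m" by linarith
  moreover obtain j where "k = Suc j" using assms(1) by (cases k) auto
  ultimately show ?thesis by (simp add: algebra_simps)
qed

section \<open>Block weights and the function \<open>\<Lambda>\<close>\<close>

text \<open>The exponent is the logarithm of \<open>\<mu>^(l - 1) * exp (- \<mu> * l)\<close>,
  written as an affine function of \<open>l\<close> so that the tilt factors out of a convolution of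
  fixed total length.\<close>

definition tilted_weight :: "real \<Rightarrow> nat \<Rightarrow> nat \<Rightarrow> real" where
  "tilted_weight \<mu> l i = block_weight l i * exp ((ln \<mu> - \<mu>) * real l - ln \<mu>)"

lemma block_weight_nonneg: "0 \<le> block_weight l i"
  by (simp add: block_weight_def)

lemma tilted_weight_nonneg: "0 \<le> tilted_weight \<mu> l i"
  by (simp add: tilted_weight_def block_weight_nonneg)

lemma card_last_free_eq:
  assumes "1 \<le> l"
  shows "card {hs \<in> words l (l - 1). total_displacement l hs = j} = l * card (last_free l (l - 1) j)"
  using rotation_count[of "l - 1" l j] assms by (simp add: free_count_def last_free_def)

lemma tilted_weight_pos:
  assumes "1 \<le> l"
  shows "0 < tilted_weight \<mu> l 0"
proof -
  have "0 < fact l / (fact (l - (l - 1)) :: real)" by simp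
  also have "\<dots> \<le> real (l * card (last_free l (l - 1) 0))"
    using card_displacement_zero[of "l - 1" l] card_last_free_eq[OF assms, of 0] by simp
  finally have "0 < card (last_free l (l - 1) 0)" by (simp add: zero_less_mult_iff)
  then show ?thesis by (simp add: tilted_weight_def block_weight_def)
qed

lemma displacement_sum_le:
  assumes "S \<subseteq> {1..m}" "card S + length hs \<le> m"
  shows "displacement_sum m S hs \<le> length hs * m"
  using assms
proof (induction hs arbitrary: S)
  case (Cons h hs)
  obtain q where q: "q \<in> {1..m}" "q \<notin> S" using ex_free[of S m] Cons.prems by auto
  then show ?case
    using displacement_free(1)[OF q, of h] Cons.IH[OF park_step(1,3)[of S m "length hs" h]] Cons.prems
    by (simp add: displacement_sum_Cons del: displacement_sum.simps(2))
qed simp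

lemma Lambda_term_eq:
  assumes \<mu>: "0 < \<mu>" and l: "1 \<le> l" and J: "l * l \<le> J"
  shows "Lambda_term \<mu> s t l = (\<Sum>j\<le>J. tilted_weight \<mu> l j * exp (s * real l + t * real j))"
proof -
  have le: "total_displacement l hs \<le> J" if "hs \<in> words l (l - 1)" for hs
  proof -
    have "total_displacement l hs \<le> (l - 1) * l"
      using displacement_sum_le[of "{}" l hs] that by (simp add: total_displacement_def mem_words)
    also have "\<dots> \<le> l * l" by simp
    finally show ?thesis using J by simp
  qed
  have "(\<Sum>hs\<in>words l (l - 1). exp (t * real (total_displacement l hs)))
    = (\<Sum>j\<le>J. \<Sum>hs\<in>{hs \<in> words l (l - 1). total_displacement l hs = j}. exp (t * real (total_displacement l hs)))"
    using le by (intro sum.group[symmetric] finite_words) auto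
  also have "\<dots> = (\<Sum>j\<le>J. real l * (real (card (last_free l (l - 1) j)) * exp (t * real j)))"
    by (intro sum.cong refl) (simp add: card_last_free_eq[OF l, unfolded One_nat_def])
  finally have sum: "(\<Sum>hs\<in>words l (l - 1). exp (t * real (total_displacement l hs)))
    = real l * (\<Sum>j\<le>J. real (card (last_free l (l - 1) j)) * exp (t * real j))"
    by (simp add: sum_distrib_left)
  have fact: "(fact l :: real) = real l * fact (l - 1)" using fact_reduce[of l] l by simp
  have pow: "\<mu> ^ (l - 1) = exp (ln \<mu> * real l - ln \<mu>)"
  proof -
    have "\<mu> ^ (l - 1) = exp (real (l - 1) * ln \<mu>)" using \<mu> by (simp add: exp_of_nat_mult)
    also have "real (l - 1) * ln \<mu> = ln \<mu> * real l - ln \<mu>" using l by (simp add: of_nat_diff algebra_simps)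
    finally show ?thesis .
  qed
  have "Lambda_term \<mu> s t l = exp ((s - \<mu>) * real l) * \<mu> ^ (l - 1)
     * (\<Sum>j\<le>J. real (card (last_free l (l - 1) j)) * exp (t * real j)) / fact (l - 1)"
    using l unfolding Lambda_term_def displacement_mgf_def fact
    by (subst expectation_addresses) (simp_all add: sum[unfolded One_nat_def] power_mult_distrib)
  also have "exp ((s - \<mu>) * real l) * \<mu> ^ (l - 1) = exp ((ln \<mu> - \<mu>) * real l - ln \<mu>) * exp (s * real l)"
    unfolding pow exp_add[symmetric] by (simp add: algebra_simps)
  finally show ?thesis
    by (simp add: tilted_weight_def block_weight_def sum_distrib_left sum_divide_distrib exp_add mult_ac)
qed

lemma Lambda_term_nonneg: "0 < \<mu> \<Longrightarrow> 1 \<le> l \<Longrightarrow> 0 \<le> Lambda_term \<mu> s t l"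
  by (subst Lambda_term_eq[OF _ _ order_refl]) (auto intro!: sum_nonneg mult_nonneg_nonneg tilted_weight_nonneg)

lemma Lambda_term_ge:
  assumes "0 < \<mu>" "1 \<le> l"
  shows "(\<Sum>j\<le>J. tilted_weight \<mu> l j * exp (s * real l + t * real j)) \<le> Lambda_term \<mu> s t l"
  unfolding Lambda_term_eq[OF assms, of "max J (l * l)", simplified]
  by (intro sum_mono2) (auto intro!: mult_nonneg_nonneg tilted_weight_nonneg)

text \<open>Apply \<open>sum_power_displacement_sum\<close> with \<open>q = exp t\<close>: the
  falling factorial is \<open>fact l\<close> and cancels the denominator of the term.\<close>

lemma Lambda_term_le_geometric:
  assumes \<mu>: "0 < \<mu>" and l: "1 \<le> l" and t: "t < 0"
  shows "Lambda_term \<mu> s t l \<le> exp ((s - \<mu>) * real l) * (\<mu> / (1 - exp t)) ^ (l - 1)"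
proof -
  have q: "0 < exp t" "exp t < 1" using t by auto
  have "(\<Sum>hs\<in>words l (l - 1). exp (t * real (total_displacement l hs)))
    = (\<Sum>hs\<in>words l (l - 1). exp t ^ displacement_sum l {} hs)"
    by (simp add: total_displacement_def exp_of_nat_mult[symmetric] mult.commute)
  also have "\<dots> \<le> fact l / fact (l - (l - 1)) / (1 - exp t) ^ (l - 1)"
    using sum_power_displacement_sum[OF q, of "{}" l "l - 1"] l by simp
  finally have "(\<Sum>hs\<in>words l (l - 1). exp (t * real (total_displacement l hs))) / fact l \<le> 1 / (1 - exp t) ^ (l - 1)"
    using l by (simp add: field_simps)
  then have "exp ((s - \<mu>) * real l) * \<mu> ^ (l - 1) *
     ((\<Sum>hs\<in>words l (l - 1). exp (t * real (total_displacement l hs))) / fact l)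
     \<le> exp ((s - \<mu>) * real l) * \<mu> ^ (l - 1) * (1 / (1 - exp t) ^ (l - 1))"
    using \<mu> by (intro mult_left_mono) auto
  then show ?thesis
    using l by (simp add: Lambda_term_def displacement_mgf_def expectation_addresses power_mult_distrib power_divide)
qed

text \<open>Only words with all addresses in the first quarter of the block are kept. Their share
  \<open>(1 / 4)^(l - 1)\<close> and the other factors lose at most exponentially in
  \<open>k\<close>, whereas the displacement contributes an exponent quadratic in \<open>k\<close>;
  \<open>large\<close> says that the gain wins.\<close>

lemma Lambda_term_clustered:
  assumes \<mu>: "0 < \<mu>" "\<mu> < 1" and t: "0 < t" and k: "0 < k"
    and large: "- 4 * (s - \<mu> - 1 + ln (\<mu> / 4)) \<le> t * (4 * real k - 1)"
  shows "1 \<le> Lambda_term \<mu> s t (4 * k)"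
proof -
  let ?l = "4 * k"
  have l: "0 < ?l" using k by simp
  have "real k ^ (?l - 1) * exp (t * (real k * (4 * real k - 1)))
    = (\<Sum>hs\<in>words k (?l - 1). exp (t * real (k * (?l - 1))))"
    using k by (simp add: card_words of_nat_diff)
  also have "\<dots> \<le> (\<Sum>hs\<in>words k (?l - 1). exp (t * real (total_displacement ?l hs)))"
    using total_displacement_clustered[OF k] t by (intro sum_mono) (simp del: of_nat_mult)
  also have "\<dots> \<le> (\<Sum>hs\<in>words ?l (?l - 1). exp (t * real (total_displacement ?l hs)))"
  proof (intro sum_mono2 finite_words)
    show "words k (?l - 1) \<subseteq> words ?l (?l - 1)" by (fastforce simp: mem_words subset_iff)
  qed simp
  finally have 1: "real k ^ (?l - 1) * exp (t * (real k * (4 * real k - 1)))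
    \<le> (\<Sum>hs\<in>words ?l (?l - 1). exp (t * real (total_displacement ?l hs)))" .
  have "fact ?l \<le> real (?l ^ ?l)" by (rule fact_le_power)
  then have 2: "real k ^ (?l - 1) / fact ?l \<ge> real k ^ (?l - 1) / real (?l ^ ?l)"
    by (intro divide_left_mono) (auto simp: k)
  have 3: "real k ^ (?l - 1) / real (?l ^ ?l) = (1 / 4) ^ (?l - 1) / real ?l"
  proof -
    obtain j where "?l = Suc j" using l by (cases ?l) auto
    then have "real (?l ^ ?l) = real ?l * (4 * real k) ^ (?l - 1)" by (metis diff_Suc_1 of_nat_mult of_nat_numeral of_nat_power power_Suc)
    then show ?thesis using k by (simp add: power_mult_distrib power_divide)
  qed
  \<comment> \<open>This crude bound accounts for the \<open>- 1\<close> in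
    \<open>large\<close>.\<close>
  have 4: "1 / real ?l \<ge> exp (- real ?l)"
  proof -
    have "real ?l \<le> exp (real ?l)" using exp_ge_add_one_self[of "real ?l"] by linarith
    then show ?thesis using k by (simp add: exp_minus field_simps)
  qed
  have 5: "(\<mu> / 4) ^ (?l - 1) \<ge> exp (real ?l * ln (\<mu> / 4))"
  proof -
    have "exp (real ?l * ln (\<mu> / 4)) = (\<mu> / 4) ^ ?l" using \<mu> by (simp only: exp_of_nat_mult) simp
    also have "\<dots> \<le> (\<mu> / 4) ^ (?l - 1)" using \<mu> by (intro power_decreasing) auto
    finally show ?thesis .
  qed
  have "0 \<le> real k * (4 * (s - \<mu> - 1 + ln (\<mu> / 4)) + t * (4 * real k - 1))" using large by simp
  then have "1 \<le> exp (real k * (4 * (s - \<mu> - 1 + ln (\<mu> / 4)) + t * (4 * real k - 1)))" by simp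
  also have "\<dots> = exp ((s - \<mu>) * real ?l) * exp (real ?l * ln (\<mu> / 4)) * exp (- real ?l) * exp (t * (real k * (4 * real k - 1)))"
    unfolding exp_add[symmetric] by (simp add: algebra_simps)
  also have "\<dots> \<le> exp ((s - \<mu>) * real ?l) * (\<mu> / 4) ^ (?l - 1) * (1 / real ?l) * exp (t * (real k * (4 * real k - 1)))"
    using 4 5 \<mu> by (intro mult_mono mult_right_mono mult_left_mono) auto
  also have "\<dots> = exp ((s - \<mu>) * real ?l) * \<mu> ^ (?l - 1) * (real k ^ (?l - 1) / real (?l ^ ?l)) * exp (t * (real k * (4 * real k - 1)))"
    unfolding 3 by (simp add: power_divide)
  also have "\<dots> \<le> exp ((s - \<mu>) * real ?l) * \<mu> ^ (?l - 1) * (real k ^ (?l - 1) / fact ?l) * exp (t * (real k * (4 * real k - 1)))"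
    using 2 \<mu> by (intro mult_right_mono mult_left_mono) auto
  also have "\<dots> = exp ((s - \<mu>) * real ?l) * \<mu> ^ (?l - 1) / fact ?l * (real k ^ (?l - 1) * exp (t * (real k * (4 * real k - 1))))"
    by simp
  also have "\<dots> \<le> exp ((s - \<mu>) * real ?l) * \<mu> ^ (?l - 1) / fact ?l * (\<Sum>hs\<in>words ?l (?l - 1). exp (t * real (total_displacement ?l hs)))"
    using 1 \<mu> by (intro mult_left_mono) auto
  also have "\<dots> = Lambda_term \<mu> s t ?l"
    using k by (simp add: Lambda_term_def displacement_mgf_def expectation_addresses power_mult_distrib)
  finally show ?thesis .
qed

text \<open>The terms do not tend to 0. Hence a finite value of \<Lambda> forces t \<le> 0, the sign
  that Chernoff's bound needs.\<close>

lemma Lambda_sum_infinite: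
  assumes "0 < \<mu>" "\<mu> < 1" "0 < t"
  shows "(\<Sum>l. ennreal (Lambda_term \<mu> s t (Suc l))) = \<infinity>"
proof (rule ccontr)
  assume "(\<Sum>l. ennreal (Lambda_term \<mu> s t (Suc l))) \<noteq> \<infinity>"
  then have "summable (\<lambda>l. Lambda_term \<mu> s t (Suc l))"
    using Lambda_term_nonneg[OF assms(1)] by (intro summable_suminf_not_top) auto
  from summable_LIMSEQ_zero[OF this]
  have "(\<lambda>l. Lambda_term \<mu> s t (Suc l)) \<longlonglongrightarrow> 0" .
  from order_tendstoD(2)[OF this, of 1] obtain n0 where
    n0: "\<And>n. n0 \<le> n \<Longrightarrow> Lambda_term \<mu> s t (Suc n) < 1" by (auto simp: eventually_sequentially)
  define A where "A = - 4 * (s - \<mu> - 1 + ln (\<mu> / 4)) / t"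
  obtain k0 :: nat where k0: "A \<le> real k0" using real_arch_simple by blast
  define k where "k = Suc (max k0 n0)"
  have "A \<le> 4 * real k - 1" using k0 by (simp add: k_def)
  then have "- 4 * (s - \<mu> - 1 + ln (\<mu> / 4)) \<le> t * (4 * real k - 1)"
    using assms(3) by (simp add: A_def pos_divide_le_eq mult.commute)
  from Lambda_term_clustered[OF assms _ this] have "1 \<le> Lambda_term \<mu> s t (4 * k)" by (simp add: k_def)
  moreover have "Lambda_term \<mu> s t (Suc (4 * k - 1)) < 1" by (rule n0) (simp add: k_def)
  ultimately show False by (simp add: k_def)
qed

section \<open>Cumulative convolutions\<close>

definition cum_conv :: "(nat \<Rightarrow> nat \<Rightarrow> real) \<Rightarrow> nat \<Rightarrow> nat \<Rightarrow> nat \<Rightarrow> real" where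
  "cum_conv w N m r = (\<Sum>j\<le>r. conv w N m j)"

lemma conv_nonneg: "(\<And>l i. 0 \<le> w l i) \<Longrightarrow> 0 \<le> conv w N m j"
  by (induction N arbitrary: m j) (auto intro!: sum_nonneg mult_nonneg_nonneg)

lemma cum_conv_nonneg: "(\<And>l i. 0 \<le> w l i) \<Longrightarrow> 0 \<le> cum_conv w N m r"
  unfolding cum_conv_def by (intro sum_nonneg conv_nonneg) auto

lemma cum_conv_0: "cum_conv w 0 m r = of_bool (m = 0)"
  by (cases "m = 0") (simp_all add: cum_conv_def)

lemma cum_conv_Suc: "cum_conv w (Suc N) m r = (\<Sum>l\<in>{1..m}. \<Sum>i\<le>r. w l i * cum_conv w N (m - l) (r - i))"
proof -
  have "cum_conv w (Suc N) m r = (\<Sum>l\<in>{1..m}. \<Sum>j\<le>r. \<Sum>i\<le>j. w l i * conv w N (m - l) (j - i))"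
    unfolding cum_conv_def conv.simps by (rule sum.swap)
  also have "\<dots> = (\<Sum>l\<in>{1..m}. \<Sum>i\<le>r. w l i * cum_conv w N (m - l) (r - i))"
  proof (rule sum.cong[OF refl])
    fix l
    have "(\<Sum>j\<le>r. \<Sum>i\<le>j. w l i * conv w N (m - l) (j - i))
      = (\<Sum>(j, i)\<in>(SIGMA j:{..r}. {..j}). w l i * conv w N (m - l) (j - i))"
      by (simp add: sum.Sigma)
    also have "\<dots> = (\<Sum>(i, j)\<in>(SIGMA i:{..r}. {..r - i}). w l i * conv w N (m - l) j)"
      by (rule sum.reindex_bij_witness[where i = "\<lambda>(i, j). (i + j, i)" and j = "\<lambda>(j, i). (i, j - i)"]) auto
    also have "\<dots> = (\<Sum>i\<le>r. \<Sum>j\<le>r - i. w l i * conv w N (m - l) j)"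
      by (simp add: sum.Sigma)
    finally show "(\<Sum>j\<le>r. \<Sum>i\<le>j. w l i * conv w N (m - l) (j - i))
      = (\<Sum>i\<le>r. w l i * cum_conv w N (m - l) (r - i))"
      by (simp add: cum_conv_def sum_distrib_left)
  qed
  finally show ?thesis .
qed

text \<open>Chernoff's bound: for displacement \<open>j <= r\<close> and t \<le> 0 the factor
  \<open>exp (t * (j - r))\<close> is at least 1. It is enough that \<open>F\<close> dominates the
  finite partial sums of the generating function.\<close>

lemma cum_conv_le:
  assumes w: "\<And>l i. 0 \<le> w l i" and t: "t \<le> 0"
    and F: "\<And>m r. (\<Sum>l\<in>{1..m}. \<Sum>i\<le>r. w l i * exp (s * real l + t * real i)) \<le> F"
  shows "cum_conv w N m r \<le> exp (- s * real m - t * real r) * F ^ N"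
proof (induction N arbitrary: m r)
  case 0
  have "0 \<le> - (t * real r)" using t by (simp add: mult_nonpos_nonneg)
  then show ?case by (auto simp: cum_conv_0)
next
  case (Suc N)
  have "F \<ge> 0" using F[of 0 0] by simp
  have "cum_conv w (Suc N) m r \<le> (\<Sum>l\<in>{1..m}. \<Sum>i\<le>r. w l i * (exp (- s * real (m - l) - t * real (r - i)) * F ^ N))"
    unfolding cum_conv_Suc by (intro sum_mono mult_left_mono Suc w)
  also have "\<dots> = (\<Sum>l\<in>{1..m}. \<Sum>i\<le>r. w l i * exp (s * real l + t * real i) * (exp (- s * real m - t * real r) * F ^ N))"
    by (intro sum.cong refl) (auto simp: of_nat_diff exp_add[symmetric] algebra_simps mult_exp_exp)
  also have "\<dots> = (\<Sum>l\<in>{1..m}. \<Sum>i\<le>r. w l i * exp (s * real l + t * real i)) * (exp (- s * real m - t * real r) * F ^ N)"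
    by (simp add: sum_distrib_right)
  also have "\<dots> \<le> F * (exp (- s * real m - t * real r) * F ^ N)"
    using \<open>F \<ge> 0\<close> by (intro mult_right_mono F) auto
  finally show ?case by (simp add: mult_ac)
qed

text \<open>An exponent affine in the length adds up to \<open>a * m + c * N\<close> over any
  \<open>N\<close> blocks of total length \<open>m\<close>.\<close>

lemma cum_conv_tilt:
  assumes "\<And>l i. 1 \<le> l \<Longrightarrow> v l i = w l i * exp (a * real l + c)"
  shows "cum_conv v N m r = cum_conv w N m r * exp (a * real m + c * real N)"
proof (induction N arbitrary: m r)
  case 0
  then show ?case by (cases "m = 0") (auto simp: cum_conv_0)
next
  case (Suc N)
  have "cum_conv v (Suc N) m r = (\<Sum>l\<in>{1..m}. \<Sum>i\<le>r. (w l i * cum_conv w N (m - l) (r - i)) * exp (a * real m + c * real (Suc N)))"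
    unfolding cum_conv_Suc Suc using assms
    by (intro sum.cong refl) (auto simp: of_nat_diff exp_add[symmetric] algebra_simps mult_exp_exp)
  then show ?case unfolding cum_conv_Suc by (simp add: sum_distrib_right)
qed

section \<open>Expectations over sequences of independent blocks\<close>

text \<open>A value function: \<open>(a, b)\<close> is the length and displacement collected so far,
  and \<open>g\<close> is evaluated at the end. If \<open>w\<close> has mass 1 on \<open>T\<close>,
  this is an expectation; a finite \<open>T\<close> expresses the truncation.\<close>

primrec bexp :: "(nat \<times> nat) set \<Rightarrow> (nat \<Rightarrow> nat \<Rightarrow> real) \<Rightarrow> nat \<Rightarrow> (nat \<Rightarrow> nat \<Rightarrow> real) \<Rightarrow> nat \<Rightarrow> nat \<Rightarrow> real" where
  "bexp T w 0 g a b = g a b"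
| "bexp T w (Suc N) g a b = (\<Sum>(l, i)\<in>T. w l i * bexp T w N g (a + l) (b + i))"

lemma bexp_add: "bexp T w (M + N) g a b = bexp T w M (bexp T w N g) a b"
  by (induction M arbitrary: a b) auto

lemma bexp_mono:
  assumes "\<And>l i. 0 \<le> w l i" "\<And>a b. g a b \<le> h a b"
  shows "bexp T w N g a b \<le> bexp T w N h a b"
  using assms(2) by (induction N arbitrary: a b) (auto intro!: sum_mono mult_left_mono assms(1))

lemma bexp_cmult: "bexp T w N (\<lambda>a b. c * g a b) a b = c * bexp T w N g a b"
  by (induction N arbitrary: a b) (auto simp: sum_distrib_left mult_ac intro!: sum.cong)

lemma bexp_plus: "bexp T w N (\<lambda>a b. g a b + h a b) a b = bexp T w N g a b + bexp T w N h a b"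
  by (induction N arbitrary: a b) (auto simp: sum.distrib[symmetric] distrib_left intro!: sum.cong)

lemma bexp_const:
  assumes "(\<Sum>(l, i)\<in>T. w l i) = 1"
  shows "bexp T w N (\<lambda>a b. c) a b = c"
proof (induction N arbitrary: a b)
  case (Suc N)
  have "bexp T w (Suc N) (\<lambda>a b. c) a b = (\<Sum>(l, i)\<in>T. w l i) * c"
    by (simp add: Suc sum_distrib_right split_def)
  then show ?case by (simp add: assms)
qed simp

text \<open>Change of measure. The density of a sequence of blocks depends only on its endpoint, and
  centring at \<open>(x, z)\<close> leaves exactly one factor \<open>F\<close> per block.\<close>

lemma bexp_tilt:
  assumes v: "\<And>l i. v l i = w l i * exp (s * (real l - x) + t * (real i - z)) / F" and F: "F > 0"
  shows "bexp T w N g a b = F ^ N *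
    bexp T v N (\<lambda>a' b'. g a' b' * exp (- s * (real a' - real a - real N * x) - t * (real b' - real b - real N * z))) a b"
proof (induction N arbitrary: a b)
  case (Suc N)
  have "bexp T w (Suc N) g a b = (\<Sum>(l, i)\<in>T. w l i * (F ^ N * bexp T v N
      (\<lambda>a' b'. g a' b' * exp (- s * (real a' - real (a + l) - real N * x) - t * (real b' - real (b + i) - real N * z))) (a + l) (b + i)))"
    by (simp add: Suc)
  also have "\<dots> = (\<Sum>(l, i)\<in>T. F ^ Suc N * (v l i * bexp T v N
      (\<lambda>a' b'. g a' b' * exp (- s * (real a' - real a - real (Suc N) * x) - t * (real b' - real b - real (Suc N) * z))) (a + l) (b + i)))"
  proof (intro sum.cong refl, clarify)
    fix l i
    let ?e = "exp (- s * (real l - x) - t * (real i - z))"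
    have w: "w l i = F * v l i * ?e" using F by (simp add: v mult_exp_exp)
    have e: "?e * bexp T v N
      (\<lambda>a' b'. g a' b' * exp (- s * (real a' - real (a + l) - real N * x) - t * (real b' - real (b + i) - real N * z))) (a + l) (b + i)
      = bexp T v N
      (\<lambda>a' b'. g a' b' * exp (- s * (real a' - real a - real (Suc N) * x) - t * (real b' - real b - real (Suc N) * z))) (a + l) (b + i)"
      unfolding bexp_cmult[symmetric]
      by (intro arg_cong[where f = "\<lambda>g. bexp T v N g (a + l) (b + i)"] ext)
         (simp add: mult_exp_exp algebra_simps)
    show "w l i * (F ^ N * bexp T v N
      (\<lambda>a' b'. g a' b' * exp (- s * (real a' - real (a + l) - real N * x) - t * (real b' - real (b + i) - real N * z))) (a + l) (b + i))
      = F ^ Suc N * (v l i * bexp T v N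
      (\<lambda>a' b'. g a' b' * exp (- s * (real a' - real a - real (Suc N) * x) - t * (real b' - real b - real (Suc N) * z))) (a + l) (b + i))"
      unfolding w e[symmetric] by simp
  qed
  finally show ?case by (simp add: sum_distrib_left split_def)
qed simp

text \<open>Squared bias plus variance; the coefficients \<alpha> and \<beta> let one statement
  cover lengths and displacements.\<close>

lemma bexp_second_moment:
  fixes \<alpha> \<beta> c :: real
  assumes fin: "finite T" and one: "(\<Sum>(l, i)\<in>T. w l i) = 1"
    and mean: "(\<Sum>(l, i)\<in>T. w l i * (\<alpha> * real l + \<beta> * real i)) = x"
  shows "bexp T w N (\<lambda>a b. (\<alpha> * real a + \<beta> * real b - c)\<^sup>2) a b
    = (\<alpha> * real a + \<beta> * real b + real N * x - c)\<^sup>2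
      + real N * (\<Sum>(l, i)\<in>T. w l i * (\<alpha> * real l + \<beta> * real i - x)\<^sup>2)"
proof (induction N arbitrary: a b)
  case (Suc N)
  define V where "V = (\<Sum>(l, i)\<in>T. w l i * (\<alpha> * real l + \<beta> * real i - x)\<^sup>2)"
  define y where "y = \<alpha> * real a + \<beta> * real b + real (Suc N) * x - c"
  have "(\<Sum>(l, i)\<in>T. w l i * (\<alpha> * real l + \<beta> * real i - x))
    = (\<Sum>(l, i)\<in>T. w l i * (\<alpha> * real l + \<beta> * real i) - x * w l i)"
    by (intro sum.cong) (auto simp: algebra_simps)
  also have "\<dots> = 0" using mean one by (simp add: split_def sum_subtractf sum_distrib_left[symmetric])
  finally have centred: "(\<Sum>(l, i)\<in>T. w l i * (\<alpha> * real l + \<beta> * real i - x)) = 0" .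
  have "bexp T w (Suc N) (\<lambda>a b. (\<alpha> * real a + \<beta> * real b - c)\<^sup>2) a b
    = (\<Sum>(l, i)\<in>T. w l i * ((\<alpha> * real l + \<beta> * real i - x + y)\<^sup>2 + real N * V))"
    unfolding bexp.simps Suc V_def[symmetric]
    by (intro sum.cong refl) (auto simp: y_def algebra_simps)
  also have "\<dots> = (\<Sum>(l, i)\<in>T. w l i * (\<alpha> * real l + \<beta> * real i - x)\<^sup>2
      + 2 * y * (w l i * (\<alpha> * real l + \<beta> * real i - x)) + (y\<^sup>2 + real N * V) * w l i)"
    by (intro sum.cong refl) (auto simp: power2_eq_square algebra_simps)
  also have "\<dots> = V + 2 * y * (\<Sum>(l, i)\<in>T. w l i * (\<alpha> * real l + \<beta> * real i - x))
      + (y\<^sup>2 + real N * V) * (\<Sum>(l, i)\<in>T. w l i)"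
    by (simp add: V_def split_def sum.distrib sum_distrib_left)
  also have "\<dots> = y\<^sup>2 + real (Suc N) * V" by (simp only: centred one) (simp add: algebra_simps)
  finally show ?case by (simp add: y_def V_def)
qed simp

lemma bexp_concentration:
  assumes fin: "finite T" and w: "\<And>l i. 0 \<le> w l i" and one: "(\<Sum>(l, i)\<in>T. w l i) = 1"
    and mean: "(\<Sum>(l, i)\<in>T. w l i * real l) = x" "(\<Sum>(l, i)\<in>T. w l i * real i) = y"
    and \<delta>: "0 < \<delta>"
  shows "eventually (\<lambda>N. 1 / 2 \<le> bexp T w N (\<lambda>a b. of_bool (\<bar>real a - real N * x\<bar> \<le> \<delta> * real N \<and>
     \<bar>real b - real N * y\<bar> \<le> \<delta> * real N)) 0 0) sequentially"
proof -
  define V where "V = (\<Sum>(l, i)\<in>T. w l i * (1 * real l + 0 * real i - x)\<^sup>2)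
    + (\<Sum>(l, i)\<in>T. w l i * (0 * real l + 1 * real i - y)\<^sup>2)"
  \<comment> \<open>From here on Chebyshev's failure bound \<open>N * V / (\<delta> * N)^2\<close>
    is at most 1/2.\<close>
  obtain N0 :: nat where N0: "2 * V / \<delta>\<^sup>2 \<le> real N0" using real_arch_simple by blast
  show ?thesis
    unfolding eventually_sequentially
  proof (intro exI allI impI)
    fix N assume N: "max 1 N0 \<le> N"
    then have N1: "0 < real N" by simp
    define R where "R = \<delta> * real N"
    have R: "0 < R" using N1 \<delta> by (simp add: R_def)
    let ?u = "\<lambda>a b. (1 * real a + 0 * real b - real N * x)\<^sup>2" and ?v = "\<lambda>a b. (0 * real a + 1 * real b - real N * y)\<^sup>2"
    \<comment> \<open>The indicator dominates \<open>1 - (?u + ?v) / R^2\<close>, so Chebyshev's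
      inequality follows from monotonicity and the second moments.\<close>
    have "bexp T w N (\<lambda>a b. 1 + (- 1 / R\<^sup>2) * (?u a b + ?v a b)) 0 0
      \<le> bexp T w N (\<lambda>a b. of_bool (\<bar>real a - real N * x\<bar> \<le> R \<and> \<bar>real b - real N * y\<bar> \<le> R)) 0 0"
    proof (rule bexp_mono[OF w])
      fix a b
      show "1 + (- 1 / R\<^sup>2) * (?u a b + ?v a b)
        \<le> of_bool (\<bar>real a - real N * x\<bar> \<le> R \<and> \<bar>real b - real N * y\<bar> \<le> R)"
      proof (cases "\<bar>real a - real N * x\<bar> \<le> R \<and> \<bar>real b - real N * y\<bar> \<le> R")
        case False
        then have "R\<^sup>2 \<le> ?u a b \<or> R\<^sup>2 \<le> ?v a b"
          using R abs_le_square_iff[of R "real a - real N * x"] abs_le_square_iff[of R "real b - real N * y"]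
          by auto
        then have "R\<^sup>2 \<le> ?u a b + ?v a b"
          using zero_le_power2[of "1 * real a + 0 * real b - real N * x"]
            zero_le_power2[of "0 * real a + 1 * real b - real N * y"] by linarith
        then show ?thesis using R False by (simp add: field_simps)
      qed (use R in simp)
    qed
    moreover have "bexp T w N (\<lambda>a b. 1 + (- 1 / R\<^sup>2) * (?u a b + ?v a b)) 0 0 = 1 - real N * V / R\<^sup>2"
    proof -
      have "bexp T w N ?u 0 0 = real N * (\<Sum>(l, i)\<in>T. w l i * (1 * real l + 0 * real i - x)\<^sup>2)"
        by (subst bexp_second_moment[OF fin one, where x = x]) (use mean in auto)
      moreover have "bexp T w N ?v 0 0 = real N * (\<Sum>(l, i)\<in>T. w l i * (0 * real l + 1 * real i - y)\<^sup>2)"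
        by (subst bexp_second_moment[OF fin one, where x = y]) (use mean in auto)
      ultimately show ?thesis
        unfolding bexp_plus bexp_cmult bexp_const[OF one] V_def
        by (simp add: distrib_left add_divide_distrib)
    qed
    moreover have "real N * V / R\<^sup>2 \<le> 1 / 2"
    proof -
      have "2 * V / \<delta>\<^sup>2 \<le> real N" using N0 N by linarith
      then have "2 * V \<le> real N * \<delta>\<^sup>2" using \<delta> by (simp add: field_simps)
      then have "real N * (2 * V) \<le> real N * (real N * \<delta>\<^sup>2)" using N1 by (intro mult_left_mono) auto
      then have "real N * V \<le> 1 / 2 * R\<^sup>2" by (simp add: R_def power2_eq_square mult_ac)
      then show ?thesis using R by (subst pos_divide_le_eq) auto
    qed
    ultimately show "1 / 2 \<le> bexp T w N (\<lambda>a b. of_bool (\<bar>real a - real N * x\<bar> \<le> \<delta> * real N \<and>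
     \<bar>real b - real N * y\<bar> \<le> \<delta> * real N)) 0 0" unfolding R_def by linarith
  qed
qed

text \<open>Dropping the blocks outside \<open>T\<close> only decreases the sum; the leading
  \<open>of_bool\<close> covers starting points that already overshoot.\<close>

lemma bexp_le_cum_conv:
  assumes fin: "finite T" and T: "\<And>l i. (l, i) \<in> T \<Longrightarrow> 1 \<le> l" and w: "\<And>l i. 0 \<le> w l i"
  shows "bexp T w N (\<lambda>a b. of_bool (a = m \<and> b \<le> r)) a b \<le> of_bool (a \<le> m \<and> b \<le> r) * cum_conv w N (m - a) (r - b)"
proof (induction N arbitrary: a b)
  case 0
  then show ?case by (auto simp: cum_conv_0)
next
  case (Suc N)
  let ?g = "\<lambda>l i. w l i * (of_bool (a + l \<le> m \<and> b + i \<le> r) * cum_conv w N (m - (a + l)) (r - (b + i)))"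
  have "bexp T w (Suc N) (\<lambda>a b. of_bool (a = m \<and> b \<le> r)) a b \<le> (\<Sum>(l, i)\<in>T. ?g l i)"
    unfolding bexp.simps by (intro sum_mono) (auto intro!: mult_left_mono Suc w)
  also have "\<dots> \<le> of_bool (a \<le> m \<and> b \<le> r) * cum_conv w (Suc N) (m - a) (r - b)"
  proof (cases "a \<le> m \<and> b \<le> r")
    case True
    have "(\<Sum>(l, i)\<in>T. ?g l i) = (\<Sum>(l, i)\<in>T \<inter> ({1..m - a} \<times> {..r - b}). ?g l i)"
      using T True by (intro sum.mono_neutral_right fin) fastforce+
    also have "\<dots> \<le> (\<Sum>(l, i)\<in>{1..m - a} \<times> {..r - b}. ?g l i)"
      by (intro sum_mono2) (auto intro!: mult_nonneg_nonneg w cum_conv_nonneg)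
    also have "\<dots> = (\<Sum>l\<in>{1..m - a}. \<Sum>i\<le>r - b. w l i * cum_conv w N (m - a - l) (r - b - i))"
      unfolding sum.cartesian_product[symmetric] using True by (intro sum.cong refl) auto
    finally show ?thesis using True by (simp add: cum_conv_Suc)
  next
    case False
    then have "(\<Sum>(l, i)\<in>T. ?g l i) = 0" by (intro sum.neutral) auto
    then show ?thesis using False by auto
  qed
  finally show ?case .
qed

text \<open>One explicit sequence suffices: blocks of displacement 0 with lengths between 1 and
  \<open>B\<close> bridge any gap from \<open>q\<close> to \<open>q * B\<close>, each at the price
  of a factor at least \<open>c\<close>.\<close>

lemma bexp_filler:
  assumes fin: "finite T" and w: "\<And>l i. 0 \<le> w l i" and c: "0 \<le> c"
    and B: "1 \<le> B" "\<And>l. l \<in> {1..B} \<Longrightarrow> (l, 0) \<in> T \<and> c \<le> w l 0"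
    and ab: "a + q \<le> m" "m \<le> a + q * B" "b \<le> r"
  shows "c ^ q \<le> bexp T w q (\<lambda>a b. of_bool (a = m \<and> b \<le> r)) a b"
  using ab
proof (induction q arbitrary: a)
  case (Suc q)
  \<comment> \<open>The shortest length after which \<open>q\<close> blocks of length at most
    \<open>B\<close> can still bridge the rest.\<close>
  define l where "l = max 1 (m - a - q * B)"
  have l: "l \<in> {1..B}" "a + l + q \<le> m" "m \<le> a + l + q * B"
  proof -
    have qB: "q \<le> q * B" "Suc q * B = B + q * B" using B(1) by simp_all
    have "a + Suc q \<le> m" "m \<le> a + Suc q * B" using Suc.prems by simp_all
    then show "l \<in> {1..B}" "a + l + q \<le> m" "m \<le> a + l + q * B"
      using qB B(1) unfolding l_def atLeastAtMost_iff by linarith+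
  qed
  have nonneg: "0 \<le> bexp T w q (\<lambda>a b. of_bool (a = m \<and> b \<le> r)) a' b'" for a' b'
    using bexp_mono[where w = w and T = T and N = q and a = a' and b = b'
        and g = "\<lambda>_ _. 0" and h = "\<lambda>a b. of_bool (a = m \<and> b \<le> r)"]
      bexp_cmult[where T = T and w = w and N = q and a = a' and b = b' and c = 0 and g = "\<lambda>_ _. 0"] w by simp
  have "c ^ Suc q = c * c ^ q" by simp
  also have "\<dots> \<le> w l 0 * bexp T w q (\<lambda>a b. of_bool (a = m \<and> b \<le> r)) (a + l) (b + 0)"
    using Suc.IH[of "a + l"] l B(2)[of l] ab(3) c w by (intro mult_mono) auto
  also have "\<dots> \<le> bexp T w (Suc q) (\<lambda>a b. of_bool (a = m \<and> b \<le> r)) a b"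
    unfolding bexp.simps
    using member_le_sum[of "(l, 0)" T "\<lambda>(l, i). w l i * bexp T w q (\<lambda>a b. of_bool (a = m \<and> b \<le> r)) (a + l) (b + i)"]
      B(2)[OF l(1)] fin w nonneg by auto
  finally show ?case .
qed simp

section \<open>The lower bound\<close>

text \<open>\<open>B\<close> serves twice: the lengths 1 and \<open>B\<close> enclose
  \<open>x\<close>, which bounds the sublevel sets, and they let filler blocks correct the length in
  either direction.\<close>

locale block_weights =
  fixes w :: "nat \<Rightarrow> nat \<Rightarrow> real" and x z :: real and B :: nat
  assumes w_nonneg: "\<And>l i. 0 \<le> w l i" and w_pos: "\<And>l. 1 \<le> l \<Longrightarrow> 0 < w l 0"
    and x_gt: "1 < x" and z_pos: "0 < z" and B_gt: "x < real B"
begin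

text \<open>For parking blocks, displacements up to \<open>K * K\<close> are all that occur at
  lengths up to \<open>K\<close>, so only the length is really truncated.\<close>

definition blocks :: "nat \<Rightarrow> (nat \<times> nat) set" where
  "blocks K = {1..K} \<times> {..K * K}"

text \<open>For the tilted weights this truncates
  \<open>exp (\<Lambda>(s, t) - s * x - t * z)\<close>, so its infimum approximates the exponential
  of the rate.\<close>

definition gen :: "nat \<Rightarrow> real \<times> real \<Rightarrow> real" where
  "gen K = (\<lambda>(s, t). \<Sum>(l, i)\<in>blocks K. w l i * exp (s * (real l - x) + t * (real i - z)))"

lemma finite_blocks: "finite (blocks K)"
  by (simp add: blocks_def)

lemma B_ge: "2 \<le> B"
  using x_gt B_gt by (cases "B \<le> 1") auto

lemma gen_mono: "K \<le> L \<Longrightarrow> gen K st \<le> gen L st"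
proof -
  assume "K \<le> L"
  then have "K * K \<le> L * L" by (intro mult_le_mono)
  with \<open>K \<le> L\<close> have "blocks K \<subseteq> blocks L" unfolding blocks_def by (intro Sigma_mono) auto
  then show ?thesis unfolding gen_def split_def by (intro sum_mono2 finite_blocks) (auto simp: w_nonneg)
qed

lemma gen_ge: "(l, i) \<in> blocks K \<Longrightarrow> w l i * exp (s * (real l - x) + t * (real i - z)) \<le> gen K (s, t)"
  unfolding gen_def
  using member_le_sum[of "(l, i)" "blocks K" "\<lambda>(l, i). w l i * exp (s * (real l - x) + t * (real i - z))"]
  by (auto simp: finite_blocks w_nonneg)

lemma gen_pos: "1 \<le> K \<Longrightarrow> 0 < gen K (s, t)"
  by (rule less_le_trans[OF _ gen_ge[of 1 0]]) (auto simp: blocks_def w_pos)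

lemma continuous_gen: "continuous_on A (gen K)"
  unfolding gen_def split_def by (intro continuous_intros)

section \<open>Compactness and removal of the truncation\<close>

definition sublevel :: "nat \<Rightarrow> real \<Rightarrow> (real \<times> real) set" where
  "sublevel K C = {st. snd st \<le> 0 \<and> gen K st \<le> C}"

text \<open>Since 1 < x < B, the blocks \<open>(1, 0)\<close> and \<open>(B, 0)\<close> alone bound
  s on both sides; as z > 0, together they also bound t from below.\<close>

lemma compact_sublevel:
  assumes K: "B \<le> K"
  shows "compact (sublevel K C)"
proof -
  define c where "c = min (w 1 0) (w B 0)"
  have c: "0 < c" using w_pos[of 1] w_pos[of B] B_ge by (simp add: c_def)
  \<comment> \<open>\<open>max C c\<close> keeps the argument of the logarithm at least 1, whatever
    \<open>C\<close> is.\<close>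
  define M where "M = ln (max C c / c)"
  have "sublevel K C \<subseteq> {- M / (x - 1)..M / (real B - x)} \<times> {- M / z..0}"
  proof
    fix st assume st: "st \<in> sublevel K C"
    obtain s t where [simp]: "st = (s, t)" by fastforce
    have t: "t \<le> 0" and C: "gen K (s, t) \<le> C" using st by (auto simp: sublevel_def)
    have bound: "s * (real l - x) - t * z \<le> M" if "l = 1 \<or> l = B" for l
    proof -
      have "c * exp (s * (real l - x) + t * (real 0 - z)) \<le> w l 0 * exp (s * (real l - x) + t * (real 0 - z))"
        using that by (intro mult_right_mono) (auto simp: c_def)
      also have "\<dots> \<le> gen K (s, t)"
        using that K B_ge by (intro gen_ge) (auto simp: blocks_def)
      finally have "exp (s * (real l - x) + t * (real 0 - z)) \<le> max C c / c"
        using C c by (simp add: field_simps)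
      then have "s * (real l - x) + t * (real 0 - z) \<le> M"
        unfolding M_def using c by (subst ln_ge_iff) auto
      then show ?thesis by simp
    qed
    have b1: "s * (1 - x) - t * z \<le> M" and b2: "s * (real B - x) - t * z \<le> M" using bound by fastforce+
    have tz: "0 \<le> - (t * z)" using t z_pos by (simp add: mult_nonpos_nonneg)
    have "- s * (x - 1) \<le> M" using b1 tz by (simp add: algebra_simps)
    then have 1: "- M / (x - 1) \<le> s" using x_gt by (simp add: field_simps)
    have "s * (real B - x) \<le> M" using b2 tz by simp
    then have 2: "s \<le> M / (real B - x)" using B_gt by (simp add: field_simps)
    \<comment> \<open>The weights \<open>B - x\<close> and \<open>x - 1\<close> eliminate
      \<open>s\<close>.\<close>
    have "(real B - x) * (s * (1 - x) - t * z) + (x - 1) * (s * (real B - x) - t * z) \<le> (real B - x) * M + (x - 1) * M"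
      using b1 b2 x_gt B_gt by (intro add_mono mult_left_mono) auto
    then have "(real B - 1) * (- (t * z)) \<le> (real B - 1) * M" by (simp add: algebra_simps)
    then have "- (t * z) \<le> M" using B_ge by (subst (asm) mult_le_cancel_left_pos) auto
    then have 3: "- M / z \<le> t" using z_pos by (simp add: field_simps)
    show "st \<in> {- M / (x - 1)..M / (real B - x)} \<times> {- M / z..0}" using 1 2 3 t by simp
  qed
  moreover have "closed (sublevel K C)"
    unfolding sublevel_def
    by (intro closed_Collect_conj closed_Collect_le continuous_intros continuous_gen)
  moreover have "compact ({- M / (x - 1)..M / (real B - x)} \<times> {- M / z..0})"
    by (intro compact_Times compact_Icc)
  ultimately show ?thesis by (metis closed_Int_compact Int_absorb2)
qed

text \<open>The sublevel sets are compact and decrease in \<open>K\<close>. If none were empty they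
  would have a common point, against the pointwise assumption; so one \<open>K\<close> works for all
  pairs.\<close>

lemma sublevel_empty:
  assumes "\<And>s t. t \<le> 0 \<Longrightarrow> \<exists>K. C < gen K (s, t)"
  shows "\<exists>K\<ge>B. \<forall>s t. t \<le> 0 \<longrightarrow> C < gen K (s, t)"
proof (rule ccontr)
  assume neg: "\<not> ?thesis"
  define F where "F K = sublevel (K + B) C" for K
  have "\<Inter>(range F) \<noteq> {}"
  proof (rule compact_nest)
    show "compact (F K)" for K unfolding F_def by (rule compact_sublevel) simp
    show "F K \<noteq> {}" for K
    proof -
      obtain s t where "t \<le> 0" "gen (K + B) (s, t) \<le> C" using neg by (metis le_add2 not_less)
      then have "(s, t) \<in> F K" by (simp add: F_def sublevel_def)
      then show ?thesis by blast
    qed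
    show "F L \<subseteq> F K" if "K \<le> L" for K L
      using that gen_mono[of "K + B" "L + B"] by (auto simp: F_def sublevel_def intro: order_trans)
  qed
  then obtain s t where st: "\<And>K. (s, t) \<in> F K" by fast
  then have "t \<le> 0" by (simp add: F_def sublevel_def)
  then obtain K where "C < gen K (s, t)" using assms by blast
  also have "\<dots> \<le> gen (K + B) (s, t)" by (rule gen_mono) simp
  also have "\<dots> \<le> C" using st[of K] by (simp add: F_def sublevel_def)
  finally show False by simp
qed

lemma gen_minimizer:
  assumes K: "B \<le> K"
  shows "\<exists>s t. t \<le> 0 \<and> (\<forall>s' t'. t' \<le> 0 \<longrightarrow> gen K (s, t) \<le> gen K (s', t'))"
proof -
  let ?C = "gen K (0, 0)"
  have "(0, 0) \<in> sublevel K ?C" by (simp add: sublevel_def)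
  then have "sublevel K ?C \<noteq> {}" by blast
  from continuous_attains_inf[OF compact_sublevel[OF K] this continuous_gen[of _ K]]
  obtain st where st: "st \<in> sublevel K ?C" "\<And>st'. st' \<in> sublevel K ?C \<Longrightarrow> gen K st \<le> gen K st'" by blast
  obtain s t where [simp]: "st = (s, t)" by fastforce
  show ?thesis
  proof (intro exI conjI allI impI)
    show "t \<le> 0" using st(1) by (simp add: sublevel_def)
    fix s' t' :: real assume "t' \<le> 0"
    then show "gen K (s, t) \<le> gen K (s', t')"
      using st(1) st(2)[of "(s', t')"] by (cases "gen K (s', t') \<le> ?C") (auto simp: sublevel_def)
  qed
qed

section \<open>First-order conditions at the minimiser\<close>

lemma gen_deriv_s:
  "((\<lambda>s. gen K (s, t)) has_real_derivative
     (\<Sum>(l, i)\<in>blocks K. w l i * exp (s * (real l - x) + t * (real i - z)) * (real l - x))) (at s)"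
  unfolding gen_def split_def prod.case
  by (auto intro!: derivative_eq_intros sum.cong)

lemma gen_deriv_t:
  "((\<lambda>t. gen K (s, t)) has_real_derivative
     (\<Sum>(l, i)\<in>blocks K. w l i * exp (s * (real l - x) + t * (real i - z)) * (real i - z))) (at t)"
  unfolding gen_def split_def prod.case
  by (auto intro!: derivative_eq_intros sum.cong)

text \<open>\<open>t * Dt = 0\<close> is complementary slackness for the constraint \<open>t \<le> 0\<close>.\<close>

lemma gen_first_order:
  assumes t: "t \<le> 0" and min: "\<And>s' t'. t' \<le> 0 \<Longrightarrow> gen K (s, t) \<le> gen K (s', t')"
  defines "Dt \<equiv> \<Sum>(l, i)\<in>blocks K. w l i * exp (s * (real l - x) + t * (real i - z)) * (real i - z)"
  shows "(\<Sum>(l, i)\<in>blocks K. w l i * exp (s * (real l - x) + t * (real i - z)) * (real l - x)) = 0"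
    and "Dt \<le> 0" and "t * Dt = 0"
proof -
  show "(\<Sum>(l, i)\<in>blocks K. w l i * exp (s * (real l - x) + t * (real i - z)) * (real l - x)) = 0"
    by (rule DERIV_local_min[OF gen_deriv_s, of 1]) (use min[OF t] in auto)
  show "Dt \<le> 0"
  proof (rule ccontr)
    assume "\<not> Dt \<le> 0"
    then have "0 < Dt" by simp
    from DERIV_pos_inc_left[OF gen_deriv_t[of K s t, folded Dt_def] this] obtain d where
      "0 < d" "\<And>h. 0 < h \<Longrightarrow> h < d \<Longrightarrow> gen K (s, t - h) < gen K (s, t)" by blast
    then have "gen K (s, t - d / 2) < gen K (s, t)" by simp
    moreover have "gen K (s, t) \<le> gen K (s, t - d / 2)" using \<open>0 < d\<close> t by (intro min) auto
    ultimately show False by simp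
  qed
  show "t * Dt = 0"
  proof (cases "t = 0")
    case False
    then have "0 < - t" using t by simp
    have "Dt = 0" unfolding Dt_def
      by (rule DERIV_local_min[OF gen_deriv_t, of "- t"]) (use \<open>0 < - t\<close> min in auto)
    then show ?thesis by simp
  qed simp
qed

text \<open>The first \<open>N - q\<close> blocks follow the law tilted to the minimiser and
  concentrate near length \<open>x\<close> and displacement \<open>y <= z\<close> per block. The
  last \<open>q\<close>, about \<open>\<eta> * N\<close>, are fillers that make the length exact
  and, having displacement 0, leave room below \<open>r\<close>.\<close>

lemma cum_conv_lower:
  fixes N m r :: "nat \<Rightarrow> nat"
  assumes N: "filterlim N at_top sequentially"
    and m: "(\<lambda>k. real (m k) / real (N k)) \<longlonglongrightarrow> x" and r: "(\<lambda>k. real (r k) / real (N k)) \<longlonglongrightarrow> z"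
    and K: "B \<le> K" and above: "\<And>s t. t \<le> 0 \<Longrightarrow> exp b < gen K (s, t)" and \<epsilon>: "0 < \<epsilon>"
  shows "eventually (\<lambda>k. exp (real (N k) * (b - \<epsilon>)) \<le> cum_conv w (N k) (m k) (r k)) sequentially"
proof -
  have K1: "1 \<le> K" using K B_ge by simp
  obtain s t where t: "t \<le> 0" and min: "\<And>s' t'. t' \<le> 0 \<Longrightarrow> gen K (s, t) \<le> gen K (s', t')"
    using gen_minimizer[OF K] by blast
  define F where "F = gen K (s, t)"
  have F: "exp b < F" "0 < F" using above[OF t] gen_pos[OF K1] by (auto simp: F_def)
  define v where "v l i = w l i * exp (s * (real l - x) + t * (real i - z)) / F" for l i
  have v: "0 \<le> v l i" for l i using w_nonneg F by (simp add: v_def)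
  let ?T = "blocks K"
  have one: "(\<Sum>(l, i)\<in>?T. v l i) = 1"
    using F by (simp add: v_def split_def sum_divide_distrib[symmetric]) (simp add: F_def gen_def split_def)
  define y where "y = (\<Sum>(l, i)\<in>?T. v l i * real i)"
  have meanl: "(\<Sum>(l, i)\<in>?T. v l i * real l) = x"
  proof -
    have "(\<Sum>(l, i)\<in>?T. v l i * (real l - x)) = 0"
      using gen_first_order(1)[OF t min]
      by (simp add: v_def split_def sum_divide_distrib[symmetric] mult_ac)
    then show ?thesis using one
      by (simp add: right_diff_distrib split_def sum_subtractf sum_distrib_right[symmetric])
  qed
  define Dt where "Dt = (\<Sum>(l, i)\<in>blocks K. w l i * exp (s * (real l - x) + t * (real i - z)) * (real i - z))"
  have Dt: "Dt \<le> 0" "t * Dt = 0" using gen_first_order(2,3)[OF t min] by (auto simp: Dt_def)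
  have yz: "y - z = Dt / F"
  proof -
    have "(\<Sum>(l, i)\<in>?T. v l i * (real i - z)) = Dt / F"
      by (simp add: v_def Dt_def split_def sum_divide_distrib mult_ac)
    then show ?thesis using one
      by (simp add: y_def right_diff_distrib split_def sum_subtractf sum_distrib_right[symmetric])
  qed
  have "Dt / F \<le> 0" using Dt(1) F(2) by (simp add: divide_le_0_iff)
  then have y: "y \<le> z" using yz by linarith
  have slack: "t * (y - z) = 0" unfolding yz using Dt(2) by auto
  define c where "c = Min ((\<lambda>l. w l 0) ` {1..B})"
  have c: "0 < c" "\<And>l. l \<in> {1..B} \<Longrightarrow> c \<le> w l 0"
  proof -
    have ne: "(\<lambda>l. w l 0) ` {1..B} \<noteq> {}" using B_ge by auto
    show "0 < c" unfolding c_def using ne by (subst Min_gr_iff) (auto simp: w_pos)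
    show "c \<le> w l 0" if "l \<in> {1..B}" for l unfolding c_def using that by (intro Min_le) auto
  qed
  \<comment> \<open>Bounds the exponent lost when a tilted block, worth \<open>F\<close>, is
    replaced by a filler, worth \<open>c\<close>; the added 1 keeps it positive.\<close>
  define A where "A = \<bar>ln c - ln F\<bar> + 1"
  define \<eta> where "\<eta> = min (1 / 2) (\<epsilon> / (4 * A))"
  have A: "0 < A" by (simp add: A_def)
  have \<eta>: "0 < \<eta>" "\<eta> \<le> 1 / 2" "\<eta> * A \<le> \<epsilon> / 4"
    using A \<epsilon> by (auto simp: \<eta>_def min_def field_simps)
  \<comment> \<open>The first three entries keep the fluctuations within the room that the fillers
    leave for the length, on both sides, and for the displacement. The last keeps the loss in the
    density above \<open>exp (- \<epsilon> / 4 * N)\<close>.\<close>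
  define \<delta> where "\<delta> = Min {\<eta> * (x - 1) / 4, \<eta> * (real B - x) / 4, \<eta> * z / 4, \<epsilon> / (4 * (\<bar>s\<bar> + \<bar>t\<bar> + 1))}"
  have \<delta>: "0 < \<delta>" "\<delta> \<le> \<eta> * (x - 1) / 4" "\<delta> \<le> \<eta> * (real B - x) / 4" "\<delta> \<le> \<eta> * z / 4"
    "\<delta> \<le> \<epsilon> / (4 * (\<bar>s\<bar> + \<bar>t\<bar> + 1))"
  proof -
    show "0 < \<delta>"
      using \<eta>(1) x_gt B_gt z_pos \<epsilon> unfolding \<delta>_def by (subst Min_gr_iff) (auto intro!: divide_pos_pos)
  qed (unfold \<delta>_def, (rule Min_le; simp)+)
  define q where "q k = nat \<lceil>\<eta> * real (N k)\<rceil>" for k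
  have N_real: "filterlim (\<lambda>k. real (N k)) at_top sequentially"
    by (rule filterlim_compose[OF filterlim_real_sequentially N])
  have ev1: "eventually (\<lambda>k. \<bar>real (m k) / real (N k) - x\<bar> < \<delta>) sequentially"
    using tendstoD[OF m \<delta>(1)] by (simp add: dist_real_def)
  have ev2: "eventually (\<lambda>k. \<bar>real (r k) / real (N k) - z\<bar> < \<delta>) sequentially"
    using tendstoD[OF r \<delta>(1)] by (simp add: dist_real_def)
  \<comment> \<open>The last entry yields \<open>q <= 3 / 4 * N\<close>; the middle one absorbs the
    probability 1/2 and the rounding in \<open>q\<close>.\<close>
  define N0 where "N0 = max (4 / \<eta>) (max (4 * (ln 2 + A) / \<epsilon>) 4)"
  have ev3: "eventually (\<lambda>k. N0 \<le> real (N k)) sequentially"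
    using N_real by (simp add: filterlim_at_top)
  define good where "good n a b' \<longleftrightarrow> \<bar>real a - real n * x\<bar> \<le> \<delta> * real n \<and> \<bar>real b' - real n * y\<bar> \<le> \<delta> * real n"
    for n a b' :: nat
  have "eventually (\<lambda>n. 1 / 2 \<le> bexp ?T v n (\<lambda>a b'. of_bool (good n a b')) 0 0) sequentially"
    unfolding good_def
    by (rule bexp_concentration[OF finite_blocks v one meanl _ \<delta>(1)]) (simp add: y_def)
  then obtain n0 where n0: "\<And>n. n0 \<le> n \<Longrightarrow> 1 / 2 \<le> bexp ?T v n (\<lambda>a b'. of_bool (good n a b')) 0 0"
    by (auto simp: eventually_sequentially)
  have ev4: "eventually (\<lambda>k. 4 * real n0 \<le> real (N k)) sequentially"
    using N_real by (simp add: filterlim_at_top)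
  show ?thesis
    using ev1 ev2 ev3 ev4
  proof eventually_elim
    case (elim k)
    define n where "n = N k - q k"
    define NN where "NN = real (N k)"
    have NN: "4 \<le> NN" "4 \<le> \<eta> * NN" "4 * (ln 2 + A) \<le> \<epsilon> * NN" "0 < NN"
      using elim(3) \<eta>(1) \<epsilon> by (auto simp: N0_def NN_def field_simps)
    have q: "\<eta> * NN \<le> real (q k)" "real (q k) \<le> \<eta> * NN + 1"
      using \<eta>(1) NN by (auto simp: q_def NN_def[symmetric] le_nat_iff ceiling_le_iff)
    have "\<eta> * NN \<le> 1 / 2 * NN" using \<eta>(2) NN by (intro mult_right_mono) auto
    then have qle: "real (q k) \<le> 3 / 4 * NN" using q NN by linarith
    then have qN: "q k \<le> N k" using NN by (simp add: NN_def)
    have n: "real n = NN - real (q k)" using qN by (simp add: n_def NN_def)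
    have n_ge: "n0 \<le> n" using n qle elim(4) by (simp add: NN_def)
    have n_le: "real n \<le> NN" using n by simp
    have mb: "\<bar>real (m k) - NN * x\<bar> \<le> \<delta> * NN"
    proof -
      have "real (m k) - NN * x = (real (m k) / real (N k) - x) * NN" using NN by (simp add: NN_def field_simps)
      then show ?thesis using elim(1) NN by (simp add: abs_mult)
    qed
    have rb: "\<bar>real (r k) - NN * z\<bar> \<le> \<delta> * NN"
    proof -
      have "real (r k) - NN * z = (real (r k) / real (N k) - z) * NN" using NN by (simp add: NN_def field_simps)
      then show ?thesis using elim(2) NN by (simp add: abs_mult)
    qed
    have \<delta>n: "\<delta> * real n \<le> \<delta> * NN" using \<delta>(1) n_le by (intro mult_left_mono) auto
    have fit: "a + q k \<le> m k \<and> m k \<le> a + q k * B \<and> b' \<le> r k" if g: "good n a b'" for a b'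
    proof -
      have ga: "\<bar>real a - real n * x\<bar> \<le> \<delta> * NN" and gb: "\<bar>real b' - real n * y\<bar> \<le> \<delta> * NN"
        using g \<delta>n by (auto simp: good_def)
      have nx: "real n * x = NN * x - real (q k) * x" by (simp only: n left_diff_distrib)
      have d1: "4 * (\<delta> * NN) \<le> real (q k) * (x - 1)"
      proof -
        have "4 * (\<delta> * NN) \<le> \<eta> * (x - 1) * NN" using \<delta>(2) NN by (simp add: mult_right_mono)
        also have "\<dots> = \<eta> * NN * (x - 1)" by simp
        also have "\<dots> \<le> real (q k) * (x - 1)" using q(1) x_gt by (intro mult_right_mono) auto
        finally show ?thesis .
      qed
      have d2: "4 * (\<delta> * NN) \<le> real (q k) * (real B - x)"
      proof -
        have "4 * (\<delta> * NN) \<le> \<eta> * (real B - x) * NN" using \<delta>(3) NN by (simp add: mult_right_mono)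
        also have "\<dots> = \<eta> * NN * (real B - x)" by simp
        also have "\<dots> \<le> real (q k) * (real B - x)" using q(1) B_gt by (intro mult_right_mono) auto
        finally show ?thesis .
      qed
      have d3: "4 * (\<delta> * NN) \<le> real (q k) * z"
      proof -
        have "4 * (\<delta> * NN) \<le> \<eta> * z * NN" using \<delta>(4) NN by (simp add: mult_right_mono)
        also have "\<dots> = \<eta> * NN * z" by simp
        also have "\<dots> \<le> real (q k) * z" using q(1) z_pos by (intro mult_right_mono) auto
        finally show ?thesis .
      qed
      have pos: "0 < \<delta> * NN" using \<delta>(1) NN by simp
      have "real a + real (q k) \<le> real (m k)"
        using ga mb d1 pos nx by (simp add: algebra_simps abs_le_iff)
      moreover have "real (m k) \<le> real a + real (q k) * real B"
        using ga mb d2 pos nx by (simp add: algebra_simps abs_le_iff)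
      moreover have "real b' \<le> real (r k)"
      proof -
        have "real n * y \<le> real n * z" using y by (intro mult_left_mono) auto
        moreover have "real n * z = NN * z - real (q k) * z" by (simp only: n left_diff_distrib)
        ultimately show ?thesis using gb rb d3 pos by (simp add: abs_le_iff)
      qed
      ultimately show ?thesis by (simp flip: of_nat_add of_nat_mult)
    qed
    define g where "g a b' = (of_bool (a = m k \<and> b' \<le> r k) :: real)" for a b'
    define E where "E = exp (- ((\<bar>s\<bar> + \<bar>t\<bar>) * (\<delta> * NN)))"
    have "c ^ q k * (F ^ n * (E * (1 / 2))) \<le> c ^ q k * (F ^ n * (E * bexp ?T v n (\<lambda>a b'. of_bool (good n a b')) 0 0))"
      using c(1) F(2) n0[OF n_ge] by (intro mult_left_mono) (auto simp: E_def)
    also have "\<dots> \<le> c ^ q k * (F ^ n * bexp ?T v n (\<lambda>a b'. of_bool (good n a b') *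
        exp (- s * (real a - real 0 - real n * x) - t * (real b' - real 0 - real n * z))) 0 0)"
    proof (intro mult_left_mono)
      show "E * bexp ?T v n (\<lambda>a b'. of_bool (good n a b')) 0 0 \<le> bexp ?T v n (\<lambda>a b'. of_bool (good n a b') *
        exp (- s * (real a - real 0 - real n * x) - t * (real b' - real 0 - real n * z))) 0 0"
        unfolding bexp_cmult[symmetric]
      proof (rule bexp_mono)
        fix a b'
        show "E * of_bool (good n a b') \<le> of_bool (good n a b') *
          exp (- s * (real a - real 0 - real n * x) - t * (real b' - real 0 - real n * z))"
        proof (cases "good n a b'")
          case True
          then have ga: "\<bar>real a - real n * x\<bar> \<le> \<delta> * NN" and gb: "\<bar>real b' - real n * y\<bar> \<le> \<delta> * NN"
            using \<delta>n by (auto simp: good_def)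
          have "s * (real a - real n * x) \<le> \<bar>s\<bar> * (\<delta> * NN)"
            using mult_left_mono[OF ga, of "\<bar>s\<bar>"] by (simp add: abs_mult[symmetric] abs_le_iff)
          moreover have "t * (real b' - real n * y) \<le> \<bar>t\<bar> * (\<delta> * NN)"
            using mult_left_mono[OF gb, of "\<bar>t\<bar>"] by (simp add: abs_mult[symmetric] abs_le_iff)
          \<comment> \<open>Complementary slackness: the density is centred at \<open>z\<close>, yet
            only the fluctuation about the actual mean \<open>y\<close> matters.\<close>
          moreover have "t * (real b' - real n * z) = t * (real b' - real n * y) + real n * (t * (y - z))"
            by (simp add: algebra_simps)
          then have "t * (real b' - real n * z) = t * (real b' - real n * y)" by (simp only: slack)
          ultimately have "- (\<bar>s\<bar> * (\<delta> * NN)) - \<bar>t\<bar> * (\<delta> * NN)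
            \<le> - (s * (real a - real n * x)) - t * (real b' - real n * z)" by linarith
          then show ?thesis using True by (simp add: E_def distrib_right)
        qed simp
      qed (rule v)
    qed (use c(1) F(2) in auto)
    also have "\<dots> = c ^ q k * bexp ?T w n (\<lambda>a b'. of_bool (good n a b')) 0 0"
      by (subst (2) bexp_tilt[where v = v and F = F and s = s and t = t and x = x and z = z]) (auto simp: v_def F)
    also have "\<dots> \<le> bexp ?T w n (bexp ?T w (q k) g) 0 0"
      unfolding bexp_cmult[symmetric]
    proof (rule bexp_mono[OF w_nonneg])
      fix a b'
      show "c ^ q k * of_bool (good n a b') \<le> bexp ?T w (q k) g a b'"
      proof (cases "good n a b'")
        case True
        have "c ^ q k \<le> bexp ?T w (q k) g a b'"
          unfolding g_def
        proof (rule bexp_filler[OF finite_blocks w_nonneg])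
          show "1 \<le> B" "0 \<le> c" using B_ge c by auto
          show "(l, 0) \<in> ?T \<and> c \<le> w l 0" if "l \<in> {1..B}" for l
            using that c(2) K by (auto simp: blocks_def)
        qed (use fit[OF True] in auto)
        then show ?thesis using True by simp
      next
        case False
        have "0 \<le> bexp ?T w (q k) g a b'"
          using bexp_mono[where w = w and T = ?T and N = "q k" and a = a and b = b' and g = "\<lambda>_ _. 0" and h = g]
            bexp_cmult[where T = ?T and w = w and N = "q k" and a = a and b = b' and c = 0 and g = "\<lambda>_ _. 0"]
          by (simp add: w_nonneg g_def)
        then show ?thesis using False by simp
      qed
    qed
    also have "\<dots> = bexp ?T w (N k) g 0 0" using qN by (simp add: bexp_add[symmetric] n_def)
    also have "\<dots> \<le> cum_conv w (N k) (m k) (r k)"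
      using bexp_le_cum_conv[where T = ?T and w = w and N = "N k" and m = "m k" and r = "r k" and a = 0 and b = 0]
        finite_blocks w_nonneg by (simp add: g_def[abs_def] blocks_def)
    finally have lower: "c ^ q k * (F ^ n * (E * (1 / 2))) \<le> cum_conv w (N k) (m k) (r k)" .
    \<comment> \<open>The budget spends a quarter of \<open>\<epsilon> * NN\<close> each on the
      fillers, on the density, and on \<open>ln 2 + A\<close>.\<close>
    have "exp (NN * (b - \<epsilon>)) \<le> exp (real (q k) * ln c + real n * ln F - (\<bar>s\<bar> + \<bar>t\<bar>) * (\<delta> * NN) - ln 2)"
    proof -
      have "b \<le> ln F" using F by (simp add: ln_ge_iff)
      then have 1: "NN * b \<le> NN * ln F" using NN by (intro mult_left_mono) auto
      have 2: "real (q k) * (ln F - ln c) \<le> \<epsilon> / 4 * NN + A"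
      proof -
        have "real (q k) * (ln F - ln c) \<le> real (q k) * A" by (intro mult_left_mono) (auto simp: A_def)
        also have "\<dots> \<le> (\<eta> * NN + 1) * A" using q(2) A by (intro mult_right_mono) auto
        also have "\<dots> = (\<eta> * A) * NN + A" by (simp add: algebra_simps)
        also have "\<dots> \<le> \<epsilon> / 4 * NN + A" using \<eta>(3) NN by (intro add_mono mult_right_mono) auto
        finally show ?thesis .
      qed
      have 3: "(\<bar>s\<bar> + \<bar>t\<bar>) * (\<delta> * NN) \<le> \<epsilon> / 4 * NN"
      proof -
        have "\<delta> * (\<bar>s\<bar> + \<bar>t\<bar> + 1) \<le> \<epsilon> / 4" using \<delta>(5) by (simp add: field_simps)
        moreover have "(\<bar>s\<bar> + \<bar>t\<bar>) * \<delta> \<le> \<delta> * (\<bar>s\<bar> + \<bar>t\<bar> + 1)" using \<delta>(1) by (simp add: algebra_simps)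
        ultimately have "(\<bar>s\<bar> + \<bar>t\<bar>) * \<delta> * NN \<le> \<epsilon> / 4 * NN" using NN by (intro mult_right_mono) auto
        then show ?thesis by (simp add: mult_ac)
      qed
      have 4: "real n * ln F = NN * ln F - real (q k) * ln F" by (simp only: n left_diff_distrib)
      have "NN * (b - \<epsilon>) = NN * b - \<epsilon> * NN" by (simp add: algebra_simps)
      moreover have "real (q k) * (ln F - ln c) = real (q k) * ln F - real (q k) * ln c" by (simp add: algebra_simps)
      moreover have "0 \<le> \<epsilon> * NN" using \<epsilon> NN by simp
      ultimately show ?thesis using 1 2 3 4 NN(3) by simp
    qed
    also have "\<dots> = c ^ q k * (F ^ n * (E * (1 / 2)))"
    proof -
      have "c ^ q k = exp (real (q k) * ln c)" using c(1) by (simp add: exp_of_nat_mult)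
      moreover have "F ^ n = exp (real n * ln F)" using F(2) by (simp add: exp_of_nat_mult)
      moreover have "exp (u + u' - u'' - ln 2) = exp u * (exp u' * (exp (- u'') * (1 / 2)))" for u u' u'' :: real
        by (simp add: exp_diff exp_add exp_minus field_simps)
      ultimately show ?thesis unfolding E_def by (simp only:)
    qed
    finally show ?case using lower by (simp add: NN_def)
  qed
qed

end

section \<open>Asymptotics of the prefactor\<close>

text \<open>The error of \<open>n * ln n - n\<close> as an approximation to the logarithm of the
  factorial; only its being o(n) matters.\<close>

definition fact_error :: "nat \<Rightarrow> real" where
  "fact_error n = ln (fact n) - (real n * ln (real n) - real n)"

text \<open>The increment is \<open>1 - n * d\<close> with \<open>d = ln ((n + 1) / n)\<close>, and
  \<open>n * d <= 1 <= (n + 1) * d\<close> places it between 0 and \<open>d\<close>; the values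
  \<open>d\<close> telescope to the logarithm.\<close>

lemma fact_error_bounds:
  assumes "1 \<le> n"
  shows "0 \<le> fact_error n \<and> fact_error n \<le> ln (real n) + 1"
  using assms
proof (induction n rule: dec_induct)
  case base
  then show ?case by (simp add: fact_error_def)
next
  case (step n)
  define d where "d = ln (real (Suc n)) - ln (real n)"
  have n: "0 < real n" using step by simp
  have "d = ln (real (Suc n) / real n)" using n by (simp add: d_def ln_div del: of_nat_Suc)
  also have "real (Suc n) / real n = 1 + 1 / real n" using n by (simp add: field_simps)
  also have "ln (1 + 1 / real n) \<le> 1 / real n" using n by (intro ln_add_one_self_le_self) auto
  finally have 1: "real n * d \<le> 1" using n by (simp add: field_simps)
  have "- d = ln (real n / real (Suc n))" using n by (simp add: d_def ln_div del: of_nat_Suc)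
  also have "real n / real (Suc n) = 1 - 1 / real (Suc n)" by (simp add: field_simps)
  also have "ln (1 - 1 / real (Suc n)) \<le> - 1 / real (Suc n)" using n ln_le_minus_one[of "1 - 1 / real (Suc n)"] by (simp add: field_simps)
  finally have 2: "1 \<le> real (Suc n) * d" using n by (simp add: field_simps)
  have "ln (fact (Suc n)) = ln (real (Suc n)) + ln (fact n :: real)"
    by (simp add: ln_mult del: of_nat_Suc)
  then have "fact_error (Suc n) = fact_error n + 1 - real n * d"
    by (simp add: fact_error_def d_def algebra_simps)
  moreover have "real (Suc n) * d = real n * d + d" by (simp add: algebra_simps)
  ultimately show ?case using step.IH 1 2 by (simp add: d_def)
qed

lemma fact_error_limit: "(\<lambda>n. fact_error n / real n) \<longlonglongrightarrow> 0"
proof (rule tendsto_sandwich)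
  show "eventually (\<lambda>n. 0 \<le> fact_error n / real n) sequentially"
    using eventually_ge_at_top[of 1] by eventually_elim (use fact_error_bounds in auto)
  show "eventually (\<lambda>n. fact_error n / real n \<le> (ln (real n) + 1) / real n) sequentially"
    using eventually_ge_at_top[of 1] by eventually_elim (use fact_error_bounds in \<open>auto intro!: divide_right_mono\<close>)
  show "(\<lambda>n. (ln (real n) + 1) / real n) \<longlonglongrightarrow> 0" by real_asymp
qed simp

section \<open>The large deviation principle\<close>

text \<open>The factors come from rotation, from the uniform words together with the factorials in
  the weights, and from undoing the tilt.\<close>

definition prefactor :: "real \<Rightarrow> nat \<Rightarrow> nat \<Rightarrow> real" where
  "prefactor \<mu> m n = real m / real (m - n) * (fact n / real m ^ n) * exp (\<mu> * real m - real n * ln \<mu>)"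

lemma prob_eq_cum_conv:
  assumes "n < m"
  shows "measure_pmf.prob (addresses m n) {hs. total_displacement m hs \<le> r}
    = prefactor \<mu> m n * cum_conv (tilted_weight \<mu>) (m - n) m r"
proof -
  have m: "0 < m" using assms by simp
  define N where "N = m - n"
  have N: "0 < N" "N + n = m" using assms by (auto simp: N_def)
  have c: "real (card {hs \<in> words m n. total_displacement m hs = j})
    = real m / real N * fact n * conv block_weight N m j" for j
  proof -
    have "N * card {hs \<in> words m n. total_displacement m hs = j} = m * card (last_free m n j)"
      using rotation_count[of n m j] assms by (simp add: N_def free_count_def last_free_def)
    then have "real N * real (card {hs \<in> words m n. total_displacement m hs = j}) = real m * real (card (last_free m n j))"
      by (metis of_nat_mult)
    then show ?thesis using conv_block_weight[OF N(2,1), of j] N(1) by (simp add: field_simps)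
  qed
  have "words m n \<inter> {hs. total_displacement m hs \<le> r} = (\<Union>j\<le>r. {hs \<in> words m n. total_displacement m hs = j})"
    by auto
  then have "card (words m n \<inter> {hs. total_displacement m hs \<le> r}) = (\<Sum>j\<le>r. card {hs \<in> words m n. total_displacement m hs = j})"
    by (simp only:) (rule card_UN_disjoint; use finite_words in auto)
  then have "measure_pmf.prob (addresses m n) {hs. total_displacement m hs \<le> r}
    = real m / real N * fact n * cum_conv block_weight N m r / real m ^ n"
    by (simp add: prob_addresses[OF m] c cum_conv_def sum_distrib_left)
  moreover have "cum_conv (tilted_weight \<mu>) N m r = cum_conv block_weight N m r * exp ((ln \<mu> - \<mu>) * real m + (- ln \<mu>) * real N)"
    by (rule cum_conv_tilt) (simp add: tilted_weight_def)
  moreover have "exp (\<mu> * real m - real n * ln \<mu>) * exp ((ln \<mu> - \<mu>) * real m + (- ln \<mu>) * real N) = 1"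
    using N(2) by (simp add: mult_exp_exp N(2)[symmetric] algebra_simps)
  ultimately show ?thesis
    by (simp add: prefactor_def N_def[symmetric] mult_ac)
qed

text \<open>At \<open>s = \<mu>\<close> the exponential factor disappears and a geometric series of
  ratio \<open>\<mu> / (1 - exp t)\<close> dominates.\<close>

lemma Lambda_geometric:
  assumes \<mu>: "0 < \<mu>" and t: "t < 0" "\<mu> < 1 - exp t"
  shows "Lambda \<mu> (\<mu>, t) \<le> ereal (- ln (1 - \<mu> / (1 - exp t)))"
proof -
  define \<rho> where "\<rho> = \<mu> / (1 - exp t)"
  have \<rho>: "0 < \<rho>" "\<rho> < 1" using \<mu> t by (auto simp: \<rho>_def)
  have le: "Lambda_term \<mu> \<mu> t (Suc l) \<le> \<rho> ^ l" for l
    using Lambda_term_le_geometric[OF \<mu> _ t(1), of "Suc l" \<mu>] by (simp add: \<rho>_def)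
  have "(\<Sum>l. ennreal (Lambda_term \<mu> \<mu> t (Suc l))) \<le> (\<Sum>l. ennreal (\<rho> ^ l))"
    by (intro suminf_le ennreal_leI le) auto
  also have "\<dots> = ennreal (1 / (1 - \<rho>))"
    using \<rho> by (subst suminf_ennreal2) (auto simp: suminf_geometric summable_geometric)
  finally have S: "(\<Sum>l. ennreal (Lambda_term \<mu> \<mu> t (Suc l))) \<le> ennreal (1 / (1 - \<rho>))" (is "?S \<le> _") .
  have "?S \<noteq> \<infinity>" using S by (auto simp: top_unique)
  then have "ext_ln ?S \<le> ereal (ln (1 / (1 - \<rho>)))"
  proof (cases "?S = 0")
    case False
    then have "0 < enn2real ?S" using \<open>?S \<noteq> \<infinity>\<close> by (simp add: enn2real_positive_iff top.not_eq_extremum zero_less_iff_neq_zero)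
    moreover have "enn2real ?S \<le> 1 / (1 - \<rho>)" using enn2real_mono[OF S] \<rho> by simp
    ultimately have "ln (enn2real ?S) \<le> ln (1 / (1 - \<rho>))" using \<rho> by (subst ln_le_cancel_iff) auto
    then show ?thesis using False \<open>?S \<noteq> \<infinity>\<close> by (simp add: ext_ln_def)
  qed (simp add: ext_ln_def)
  moreover have "ln (1 / (1 - \<rho>)) = - ln (1 - \<rho>)" using \<rho> by (simp add: ln_div)
  ultimately show ?thesis by (simp add: Lambda_def \<rho>_def)
qed

lemma fenchel_legendre_ge: "ereal (s * x + t * z) - F (s, t) \<le> fenchel_legendre F (x, z)"
  unfolding fenchel_legendre_def by (auto intro!: SUP_upper2[of "(s, t)"])

lemma ext_rate_le:
  assumes "0 < N" "0 \<le> p" "p \<le> exp (N * a)"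
  shows "ereal (1 / N) * ext_ln (ennreal p) \<le> ereal a"
proof (cases "p = 0")
  case True
  then show ?thesis using assms(1) by (simp add: ext_ln_def)
next
  case False
  then have p: "0 < p" using assms by simp
  have "ln p \<le> N * a" using assms(3) p by (metis ln_exp ln_le_cancel_iff exp_gt_zero)
  then show ?thesis using p assms(1) by (simp add: ext_ln_def field_simps)
qed

lemma ext_rate_ge:
  assumes "0 < N" "exp (N * a) \<le> p"
  shows "ereal a \<le> ereal (1 / N) * ext_ln (ennreal p)"
proof -
  have p: "0 < p" using assms(2) less_le_trans[OF exp_gt_zero] by blast
  have "N * a \<le> ln p" using assms(2) p by (simp add: ln_ge_iff)
  then show ?thesis using p assms(1) by (simp add: ext_ln_def field_simps)
qed

section \<open>Rates along a sequence of parameters\<close>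

context
  fixes \<mu> :: real and m n :: "nat \<Rightarrow> nat"
  assumes \<mu>: "0 < \<mu>" "\<mu> < 1" and mn: "\<And>k. 1 \<le> m k" "\<And>k. n k \<le> m k"
    and m_lim: "filterlim m at_top sequentially"
    and ratio: "(\<lambda>k. real (n k) / real (m k)) \<longlonglongrightarrow> \<mu>"
begin

lemma m_real: "filterlim (\<lambda>k. real (m k)) at_top sequentially"
  by (rule filterlim_compose[OF filterlim_real_sequentially m_lim])

lemma N_ratio: "(\<lambda>k. real (m k - n k) / real (m k)) \<longlonglongrightarrow> 1 - \<mu>"
proof (rule Lim_transform_eventually)
  show "(\<lambda>k. 1 - real (n k) / real (m k)) \<longlonglongrightarrow> 1 - \<mu>" by (intro tendsto_intros ratio)
  show "eventually (\<lambda>k. 1 - real (n k) / real (m k) = real (m k - n k) / real (m k)) sequentially"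
  proof (rule always_eventually, rule allI)
    fix k
    show "1 - real (n k) / real (m k) = real (m k - n k) / real (m k)"
      using mn[of k] by (simp add: of_nat_diff field_simps)
  qed
qed

lemma N_lim: "filterlim (\<lambda>k. m k - n k) at_top sequentially"
proof -
  have "filterlim (\<lambda>k. real (m k - n k) / real (m k) * real (m k)) at_top sequentially"
    by (rule filterlim_tendsto_pos_mult_at_top[OF N_ratio _ m_real]) (use \<mu> in simp)
  moreover have "real (m k - n k) / real (m k) * real (m k) = real (m k - n k)" for k
    using mn(1)[of k] by simp
  ultimately show ?thesis by (simp add: filterlim_sequentially_iff_filterlim_real)
qed

lemma n_lim: "filterlim n at_top sequentially"
proof -
  have "filterlim (\<lambda>k. real (n k) / real (m k) * real (m k)) at_top sequentially"
    by (rule filterlim_tendsto_pos_mult_at_top[OF ratio _ m_real]) (use \<mu> in simp)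
  moreover have "real (n k) / real (m k) * real (m k) = real (n k)" for k
    using mn(1)[of k] by simp
  ultimately show ?thesis by (simp add: filterlim_sequentially_iff_filterlim_real)
qed

lemma m_over_N: "(\<lambda>k. real (m k) / real (m k - n k)) \<longlonglongrightarrow> 1 / (1 - \<mu>)"
  using tendsto_inverse[OF N_ratio] \<mu> by (simp add: inverse_eq_divide)

lemma eventually_N_pos: "eventually (\<lambda>k. 0 < m k - n k \<and> 0 < n k) sequentially"
  using filterlim_at_top[THEN iffD1, OF N_lim, rule_format, of 1]
    filterlim_at_top[THEN iffD1, OF n_lim, rule_format, of 1]
  by eventually_elim auto

lemma rate_from_m:
  assumes "(\<lambda>k. f k / real (m k)) \<longlonglongrightarrow> c"
  shows "(\<lambda>k. f k / real (m k - n k)) \<longlonglongrightarrow> c / (1 - \<mu>)"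
proof (rule Lim_transform_eventually)
  show "(\<lambda>k. f k / real (m k) * (real (m k) / real (m k - n k))) \<longlonglongrightarrow> c / (1 - \<mu>)"
    using tendsto_mult[OF assms m_over_N] by simp
  show "eventually (\<lambda>k. f k / real (m k) * (real (m k) / real (m k - n k)) = f k / real (m k - n k)) sequentially"
    using mn(1) by (intro always_eventually allI) simp
qed

text \<open>The main terms tend to
  \<open>\<mu> * ln \<mu> - \<mu> + \<mu> - \<mu> * ln \<mu> = 0\<close>; this cancellation is the
  effect of tilting the weights by \<mu>.\<close>

lemma prefactor_rate: "(\<lambda>k. ln (prefactor \<mu> (m k) (n k)) / real (m k - n k)) \<longlonglongrightarrow> 0"
proof -
  define \<rho> where "\<rho> k = real (n k) / real (m k)" for k
  define f where "f k = - ln (real (m k - n k) / real (m k)) * (1 / real (m k))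
      + fact_error (n k) / real (n k) * \<rho> k + (\<rho> k * ln (\<rho> k) - \<rho> k + \<mu> - \<rho> k * ln \<mu>)" for k
  have inv: "(\<lambda>k. 1 / real (m k)) \<longlonglongrightarrow> 0"
    using tendsto_inverse_0_at_top[OF m_real] by (simp add: inverse_eq_divide)
  have \<rho>: "\<rho> \<longlonglongrightarrow> \<mu>" using ratio by (simp add: \<rho>_def[abs_def])
  have err: "(\<lambda>k. fact_error (n k) / real (n k)) \<longlonglongrightarrow> 0"
    by (rule filterlim_compose[OF fact_error_limit n_lim])
  have "f \<longlonglongrightarrow> - ln (1 - \<mu>) * 0 + 0 * \<mu> + (\<mu> * ln \<mu> - \<mu> + \<mu> - \<mu> * ln \<mu>)"
    unfolding f_def by (intro tendsto_intros N_ratio inv err \<rho>) (use \<mu> in auto)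
  then have "f \<longlonglongrightarrow> 0" by simp
  moreover have "eventually (\<lambda>k. f k = ln (prefactor \<mu> (m k) (n k)) / real (m k)) sequentially"
    using eventually_N_pos
  proof eventually_elim
    case (elim k)
    have m: "0 < real (m k)" using mn(1)[of k] by simp
    have "ln (prefactor \<mu> (m k) (n k)) = - ln (real (m k - n k) / real (m k)) + (ln (fact (n k)) - real (n k) * ln (real (m k)))
        + (\<mu> * real (m k) - real (n k) * ln \<mu>)"
      using elim m by (simp add: prefactor_def ln_mult ln_div ln_realpow)
    also have "ln (fact (n k)) - real (n k) * ln (real (m k)) = fact_error (n k) + real (n k) * ln (\<rho> k) - real (n k)"
      using elim m by (simp add: fact_error_def \<rho>_def ln_div algebra_simps)
    finally have E: "ln (prefactor \<mu> (m k) (n k)) = - ln (real (m k - n k) / real (m k))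
        + (fact_error (n k) + real (n k) * ln (\<rho> k) - real (n k)) + (\<mu> * real (m k) - real (n k) * ln \<mu>)" .
    have "fact_error (n k) / real (n k) * \<rho> k = fact_error (n k) / real (m k)"
      "\<rho> k * ln (\<rho> k) = real (n k) * ln (\<rho> k) / real (m k)"
      "\<rho> k * ln \<mu> = real (n k) * ln \<mu> / real (m k)"
      "\<rho> k = real (n k) / real (m k)"
      using elim m by (simp_all add: \<rho>_def)
    moreover have "\<mu> * real (m k) / real (m k) = \<mu>" using m by simp
    ultimately show ?case
      unfolding E f_def add_divide_distrib diff_divide_distrib times_divide_eq_right mult_1_right by linarith
  qed
  ultimately have "(\<lambda>k. ln (prefactor \<mu> (m k) (n k)) / real (m k)) \<longlonglongrightarrow> 0"
    by (rule Lim_transform_eventually)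
  from rate_from_m[OF this] show ?thesis by simp
qed

text \<open>The fraction is the probability that all addresses are distinct. Its rate is the
  negative of the bound in \<open>Lambda_star_zero\<close> at
  \<open>x = 1 / (1 - \<mu>)\<close>.\<close>

lemma zero_displacement_rate:
  "(\<lambda>k. ln (fact (m k) / (fact (m k - n k) * real (m k) ^ n k)) / real (m k - n k))
     \<longlonglongrightarrow> - (\<mu> * (1 / (1 - \<mu>)) + ln (1 - \<mu>))"
proof -
  define \<sigma> where "\<sigma> k = real (m k - n k) / real (m k)" for k
  define f where "f k = fact_error (m k) / real (m k) - fact_error (m k - n k) / real (m k - n k) * \<sigma> k
      - (1 - \<sigma> k) - \<sigma> k * ln (\<sigma> k)" for k
  have \<sigma>: "\<sigma> \<longlonglongrightarrow> 1 - \<mu>" using N_ratio by (simp add: \<sigma>_def[abs_def])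
  have err: "(\<lambda>k. fact_error (m k) / real (m k)) \<longlonglongrightarrow> 0"
    "(\<lambda>k. fact_error (m k - n k) / real (m k - n k)) \<longlonglongrightarrow> 0"
    by (rule filterlim_compose[OF fact_error_limit m_lim] filterlim_compose[OF fact_error_limit N_lim])+
  have "f \<longlonglongrightarrow> 0 - 0 * (1 - \<mu>) - (1 - (1 - \<mu>)) - (1 - \<mu>) * ln (1 - \<mu>)"
    unfolding f_def by (intro tendsto_intros err \<sigma>) (use \<mu> in auto)
  moreover have "eventually (\<lambda>k. f k = ln (fact (m k) / (fact (m k - n k) * real (m k) ^ n k)) / real (m k)) sequentially"
    using eventually_N_pos
  proof eventually_elim
    case (elim k)
    have m: "0 < real (m k)" using mn(1)[of k] by simp
    have nk: "real (n k) = real (m k) - real (m k - n k)" using mn(2)[of k] by (simp add: of_nat_diff)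
    have "ln (fact (m k) / (fact (m k - n k) * real (m k) ^ n k))
      = ln (fact (m k)) - ln (fact (m k - n k)) - real (n k) * ln (real (m k))"
      using m by (simp add: ln_mult ln_div ln_realpow)
    also have "\<dots> = fact_error (m k) - fact_error (m k - n k) - (real (m k) - real (m k - n k)) - real (m k - n k) * ln (\<sigma> k)"
      unfolding nk using elim m by (simp add: fact_error_def \<sigma>_def ln_div algebra_simps)
    finally have E: "ln (fact (m k) / (fact (m k - n k) * real (m k) ^ n k))
      = fact_error (m k) - fact_error (m k - n k) - (real (m k) - real (m k - n k)) - real (m k - n k) * ln (\<sigma> k)" .
    have "fact_error (m k - n k) / real (m k - n k) * \<sigma> k = fact_error (m k - n k) / real (m k)"
      "\<sigma> k * ln (\<sigma> k) = real (m k - n k) * ln (\<sigma> k) / real (m k)"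
      "\<sigma> k = real (m k - n k) / real (m k)" "real (m k) / real (m k) = 1"
      using elim m by (simp_all add: \<sigma>_def)
    then show ?case unfolding E f_def add_divide_distrib diff_divide_distrib by linarith
  qed
  ultimately have "(\<lambda>k. ln (fact (m k) / (fact (m k - n k) * real (m k) ^ n k)) / real (m k))
      \<longlonglongrightarrow> 0 - 0 * (1 - \<mu>) - (1 - (1 - \<mu>)) - (1 - \<mu>) * ln (1 - \<mu>)"
    by (rule Lim_transform_eventually)
  from rate_from_m[OF this]
  have "(\<lambda>k. ln (fact (m k) / (fact (m k - n k) * real (m k) ^ n k)) / real (m k - n k))
     \<longlonglongrightarrow> (- \<mu> - (1 - \<mu>) * ln (1 - \<mu>)) / (1 - \<mu>)" by simp
  moreover have "(- \<mu> - (1 - \<mu>) * ln (1 - \<mu>)) / (1 - \<mu>) = - (\<mu> * (1 / (1 - \<mu>)) + ln (1 - \<mu>))"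
    using \<mu> by (simp add: field_simps)
  ultimately show ?thesis by simp
qed

lemma expected_rate:
  "(\<lambda>k. expected_displacement (m k) (n k) / real (m k - n k)) \<longlonglongrightarrow> \<mu>\<^sup>2 / (2 * (1 - \<mu>)\<^sup>2)"
proof -
  have "mean_flow \<mu> / (1 - \<mu>) = \<mu>\<^sup>2 / (2 * (1 - \<mu>)\<^sup>2)"
    using \<mu> by (simp add: mean_flow_def power2_eq_square)
  then show ?thesis
    using rate_from_m[OF expected_displacement_limit[OF \<mu> m_lim ratio]] by simp
qed

section \<open>A threshold \<open>R k\<close> with \<open>R k / N\<close> tending to
  \<open>z\<close>\<close>

context
  fixes R :: "nat \<Rightarrow> real" and z :: real
  assumes R: "(\<lambda>k. R k / real (m k - n k)) \<longlonglongrightarrow> z"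
begin

abbreviation rate :: "nat \<Rightarrow> ereal" where
  "rate k \<equiv> ereal (1 / real (m k - n k)) *
    ext_ln (ennreal (measure_pmf.prob (addresses (m k) (n k)) {hs. real (total_displacement (m k) hs) \<le> R k}))"

lemma prefactor_pos: "n k < m k \<Longrightarrow> 0 < prefactor \<mu> (m k) (n k)"
  by (simp add: prefactor_def)

lemma prob_R:
  assumes "n k < m k" "0 \<le> R k"
  shows "measure_pmf.prob (addresses (m k) (n k)) {hs. real (total_displacement (m k) hs) \<le> R k}
    = prefactor \<mu> (m k) (n k) * cum_conv (tilted_weight \<mu>) (m k - n k) (m k) (nat \<lfloor>R k\<rfloor>)"
proof -
  have "real d \<le> R k \<longleftrightarrow> d \<le> nat \<lfloor>R k\<rfloor>" for d
    using assms(2) by (simp add: le_nat_iff le_floor_iff)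
  then show ?thesis using prob_eq_cum_conv[OF assms(1), of "nat \<lfloor>R k\<rfloor>" \<mu>] by simp
qed

lemma rate_upper:
  assumes a: "- fenchel_legendre (Lambda \<mu>) (1 / (1 - \<mu>), z) < ereal a"
  shows "eventually (\<lambda>k. rate k \<le> ereal a) sequentially"
proof -
  define x where "x = 1 / (1 - \<mu>)"
  have "ereal (- a) < fenchel_legendre (Lambda \<mu>) (x, z)"
    using a unfolding x_def by (metis ereal_minus_less_minus ereal_uminus_uminus uminus_ereal.simps(1))
  then obtain s t where st: "ereal (- a) < ereal (s * x + t * z) - Lambda \<mu> (s, t)"
    unfolding fenchel_legendre_def by (auto simp: less_SUP_iff split_def)
  define S where "S = (\<Sum>l. ennreal (Lambda_term \<mu> s t (Suc l)))"
  have L: "Lambda \<mu> (s, t) = ext_ln S" by (simp add: Lambda_def S_def)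
  have Sfin: "S \<noteq> \<infinity>" using st unfolding L by (auto simp: ext_ln_def)
  \<comment> \<open>A pair that beats \<open>- a\<close> has finite \<Lambda>, and the series
    diverges for positive \<open>t\<close>.\<close>
  have t: "t \<le> 0" using Lambda_sum_infinite[OF \<mu>, of t s] Sfin by (auto simp: S_def not_le[symmetric])
  \<comment> \<open>A positive real bound gives \<open>ln F\<close> a meaning; in the formal case
    \<open>S = 0\<close> any small enough value serves.\<close>
  obtain F where F: "0 < F" "S \<le> ennreal F" "ln F < a + s * x + t * z"
  proof (cases "S = 0")
    case True
    then show ?thesis by (intro that[of "exp (a + s * x + t * z - 1)"]) auto
  next
    case False
    have "0 < enn2real S" using False Sfin by (simp add: enn2real_positive_iff top.not_eq_extremum zero_less_iff_neq_zero)
    moreover have "S = ennreal (enn2real S)" using Sfin by (simp add: ennreal_enn2real_if)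
    moreover have "ln (enn2real S) < a + s * x + t * z"
      using st False Sfin by (simp add: L ext_ln_def)
    ultimately show ?thesis by (intro that[of "enn2real S"]) auto
  qed
  have gen: "(\<Sum>l\<in>{1..M}. \<Sum>i\<le>r. tilted_weight \<mu> l i * exp (s * real l + t * real i)) \<le> F" for M r
  proof -
    have "(\<Sum>l\<in>{1..M}. \<Sum>i\<le>r. tilted_weight \<mu> l i * exp (s * real l + t * real i)) \<le> (\<Sum>l\<in>{1..M}. Lambda_term \<mu> s t l)"
      by (intro sum_mono Lambda_term_ge) (use \<mu> in auto)
    also have "\<dots> = (\<Sum>l<M. Lambda_term \<mu> s t (Suc l))"
      by (rule sum.reindex_bij_witness[where i = Suc and j = "\<lambda>l. l - 1"]) auto
    finally have 1: "(\<Sum>l\<in>{1..M}. \<Sum>i\<le>r. tilted_weight \<mu> l i * exp (s * real l + t * real i)) \<le> (\<Sum>l<M. Lambda_term \<mu> s t (Suc l))" .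
    have "ennreal (\<Sum>l<M. Lambda_term \<mu> s t (Suc l)) = (\<Sum>l<M. ennreal (Lambda_term \<mu> s t (Suc l)))"
      by (rule sum_ennreal[symmetric]) (use Lambda_term_nonneg[OF \<mu>(1)] in auto)
    also have "\<dots> \<le> S" unfolding S_def by (rule sum_le_suminf) auto
    also have "\<dots> \<le> ennreal F" by fact
    finally show ?thesis using 1 F(1) by (simp add: ennreal_le_iff)
  qed
  define e where "e k = ln (prefactor \<mu> (m k) (n k)) / real (m k - n k) - s * (real (m k) / real (m k - n k))
      - t * (R k / real (m k - n k)) + ln F" for k
  have "e \<longlonglongrightarrow> 0 - s * x - t * z + ln F"
    unfolding e_def x_def by (intro tendsto_intros prefactor_rate m_over_N R)
  then have "eventually (\<lambda>k. e k < a) sequentially"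
    by (rule order_tendstoD(2)) (use F(3) in simp)
  then show ?thesis using eventually_N_pos
  proof eventually_elim
    case (elim k)
    define N where "N = real (m k - n k)"
    have N: "0 < N" and nm: "n k < m k" using elim by (auto simp: N_def)
    let ?p = "measure_pmf.prob (addresses (m k) (n k)) {hs. real (total_displacement (m k) hs) \<le> R k}"
    have "?p \<le> exp (N * a)"
    \<comment> \<open>A negative threshold empties the event, whereas \<open>nat\<close> would round
      it up to 0.\<close>
    proof (cases "0 \<le> R k")
      case False
      then have "{hs. real (total_displacement (m k) hs) \<le> R k} = {}" by (auto simp: not_le intro: less_le_trans)
      then show ?thesis by simp
    next
      case True
      have "?p \<le> prefactor \<mu> (m k) (n k) * (exp (- s * real (m k) - t * real (nat \<lfloor>R k\<rfloor>)) * F ^ (m k - n k))"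
        unfolding prob_R[OF nm True]
        using prefactor_pos[OF nm] tilted_weight_nonneg t gen
        by (intro mult_left_mono cum_conv_le) auto
      also have "\<dots> \<le> prefactor \<mu> (m k) (n k) * (exp (- s * real (m k) - t * R k) * F ^ (m k - n k))"
      proof -
        have "real (nat \<lfloor>R k\<rfloor>) \<le> R k" using True by simp
        then have "t * R k \<le> t * real (nat \<lfloor>R k\<rfloor>)" using t by (intro mult_left_mono_neg)
        then show ?thesis using prefactor_pos[OF nm] F(1) by (intro mult_left_mono mult_right_mono) auto
      qed
      also have "\<dots> = exp (N * e k)"
      proof -
        have "prefactor \<mu> (m k) (n k) = exp (ln (prefactor \<mu> (m k) (n k)))" using prefactor_pos[OF nm] by simp
        moreover have "F ^ (m k - n k) = exp (N * ln F)" using F(1) by (simp add: N_def exp_of_nat_mult)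
        moreover have "N * e k = ln (prefactor \<mu> (m k) (n k)) + (- s * real (m k) - t * R k) + N * ln F"
          using N by (simp add: e_def N_def[symmetric] algebra_simps)
        ultimately show ?thesis by (simp add: exp_add)
      qed
      also have "\<dots> \<le> exp (N * a)" using elim N by simp
      finally show ?thesis .
    qed
    then show ?case using ext_rate_le[OF N] by (simp add: N_def)
  qed
qed

section \<open>Lower bounds on the transform from the pairs \<open>(\<mu>, t)\<close>\<close>

lemma Lambda_star_lower:
  assumes "t < 0" "\<mu> < 1 - exp t"
  shows "ereal (\<mu> * x + t * z + ln (1 - \<mu> / (1 - exp t))) \<le> fenchel_legendre (Lambda \<mu>) (x, z)"
proof -
  have "ereal (\<mu> * x + t * z + ln (1 - \<mu> / (1 - exp t))) = ereal (\<mu> * x + t * z) - ereal (- ln (1 - \<mu> / (1 - exp t)))"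
    by simp
  also have "\<dots> \<le> ereal (\<mu> * x + t * z) - Lambda \<mu> (\<mu>, t)"
    using Lambda_geometric[OF \<mu>(1) assms] by (intro ereal_minus_mono) auto
  also have "\<dots> \<le> fenchel_legendre (Lambda \<mu>) (x, z)" by (rule fenchel_legendre_ge)
  finally show ?thesis .
qed

lemma geometric_limit: "((\<lambda>t. ln (1 - \<mu> / (1 - exp t))) \<longlongrightarrow> ln (1 - \<mu>)) at_bot"
proof -
  have "((\<lambda>t. ln (1 - \<mu> / (1 - exp t))) \<longlongrightarrow> ln (1 - \<mu> / (1 - 0))) at_bot"
    using \<mu> by (intro tendsto_intros exp_at_bot) auto
  then show ?thesis by simp
qed

lemma eventually_geometric: "eventually (\<lambda>t. t < 0 \<and> \<mu> < 1 - exp t) at_bot"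
proof -
  have "((\<lambda>t::real. 1 - exp t) \<longlongrightarrow> 1 - 0) at_bot" by (intro tendsto_intros exp_at_bot)
  from order_tendstoD(1)[OF this, of \<mu>] \<mu> have "eventually (\<lambda>t. \<mu> < 1 - exp t) at_bot" by simp
  with eventually_gt_at_bot[of "0::real"] show ?thesis by (rule eventually_conj)
qed

text \<open>As t tends to minus infinity, \<open>t * z\<close> grows without bound while the
  logarithm converges.\<close>

lemma Lambda_star_negative:
  assumes "z < 0"
  shows "fenchel_legendre (Lambda \<mu>) (x, z) = \<infinity>"
proof (rule ereal_top)
  fix c :: real
  have "filterlim (\<lambda>t. z * t) at_top at_bot"
    using filterlim_tendsto_pos_mult_at_top[OF tendsto_const[of "- z"] _ filterlim_uminus_at_top_at_bot] assms by simp
  then have "filterlim (\<lambda>t. (\<mu> * x + ln (1 - \<mu> / (1 - exp t))) + z * t) at_top at_bot"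
    by (rule filterlim_tendsto_add_at_top[OF tendsto_add[OF tendsto_const geometric_limit]])
  then have "eventually (\<lambda>t. c \<le> (\<mu> * x + ln (1 - \<mu> / (1 - exp t))) + z * t) at_bot"
    by (simp add: filterlim_at_top)
  from eventually_happens'[OF _ eventually_conj[OF this eventually_geometric]]
  obtain t where "c \<le> (\<mu> * x + ln (1 - \<mu> / (1 - exp t))) + z * t" "t < 0" "\<mu> < 1 - exp t"
    by (auto simp: trivial_limit_at_bot_linorder)
  then have "ereal c \<le> ereal (\<mu> * x + t * z + ln (1 - \<mu> / (1 - exp t)))" by (simp add: mult.commute)
  also have "\<dots> \<le> fenchel_legendre (Lambda \<mu>) (x, z)" by (rule Lambda_star_lower) fact+
  finally show "ereal c \<le> fenchel_legendre (Lambda \<mu>) (x, z)" .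
qed

text \<open>The term \<open>t * z\<close> vanishes, so letting t tend to minus infinity leaves the
  exact rate of displacement 0.\<close>

lemma Lambda_star_zero:
  assumes "z = 0"
  shows "ereal (\<mu> * x + ln (1 - \<mu>)) \<le> fenchel_legendre (Lambda \<mu>) (x, z)"
proof (rule tendsto_upperbound)
  show "((\<lambda>t. ereal (\<mu> * x + ln (1 - \<mu> / (1 - exp t)))) \<longlongrightarrow> ereal (\<mu> * x + ln (1 - \<mu>))) at_bot"
    by (intro tendsto_intros geometric_limit)
  show "eventually (\<lambda>t. ereal (\<mu> * x + ln (1 - \<mu> / (1 - exp t))) \<le> fenchel_legendre (Lambda \<mu>) (x, z)) at_bot"
    using eventually_geometric by eventually_elim (use Lambda_star_lower assms in auto)
qed (simp add: trivial_limit_at_bot_linorder)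

text \<open>\<open>R0\<close> puts displacement 0 into the event; a negative threshold would make
  the event empty and the rate \<open>-\<infinity>\<close>.\<close>

lemma rate_lower_zero:
  assumes "z = 0" and R0: "eventually (\<lambda>k. 0 \<le> R k) sequentially"
    and a: "ereal a < - fenchel_legendre (Lambda \<mu>) (1 / (1 - \<mu>), z)"
  shows "eventually (\<lambda>k. ereal a \<le> rate k) sequentially"
proof -
  let ?c = "- (\<mu> * (1 / (1 - \<mu>)) + ln (1 - \<mu>))"
  have "- fenchel_legendre (Lambda \<mu>) (1 / (1 - \<mu>), z) \<le> ereal ?c"
    using Lambda_star_zero[OF assms(1), of "1 / (1 - \<mu>)"]
    by (metis ereal_minus_le_minus uminus_ereal.simps(1))
  then have "a < ?c" using a by (metis less_le_trans ereal_less_eq(3) less_ereal.simps(1))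
  from order_tendstoD(1)[OF zero_displacement_rate this] R0 eventually_N_pos
  show ?thesis
  proof eventually_elim
    case (elim k)
    define N where "N = real (m k - n k)"
    have N: "0 < N" and m0: "0 < m k" using elim mn(1)[of k] by (auto simp: N_def)
    let ?q = "fact (m k) / (fact (m k - n k) * real (m k) ^ n k)"
    have q: "0 < ?q" using m0 by simp
    have "a * N < ln ?q" using elim(1) N by (simp add: N_def pos_less_divide_eq)
    then have "exp (N * a) \<le> exp (ln ?q)" by (simp add: mult.commute)
    also have "\<dots> = ?q" using q by simp
    also have "\<dots> \<le> real (card {hs \<in> words (m k) (n k). total_displacement (m k) hs = 0}) / real (m k) ^ n k"
      using divide_right_mono[OF card_displacement_zero[OF mn(2)[of k]], of "real (m k) ^ n k"] by simp
    also have "\<dots> \<le> real (card (words (m k) (n k) \<inter> {hs. real (total_displacement (m k) hs) \<le> R k})) / real (m k) ^ n k"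
      using elim(2) by (intro divide_right_mono of_nat_mono card_mono) (auto simp: finite_words)
    also have "\<dots> = measure_pmf.prob (addresses (m k) (n k)) {hs. real (total_displacement (m k) hs) \<le> R k}"
      by (rule prob_addresses[OF m0, symmetric])
    finally show ?case using ext_rate_ge[OF N] by (simp add: N_def)
  qed
qed

lemma rate_lower_pos:
  assumes z: "0 < z" and a: "ereal a < - fenchel_legendre (Lambda \<mu>) (1 / (1 - \<mu>), z)"
  shows "eventually (\<lambda>k. ereal a \<le> rate k) sequentially"
proof -
  define x where "x = 1 / (1 - \<mu>)"
  have x: "1 < x" using \<mu> by (simp add: x_def)
  obtain B :: nat where B: "x < real B" using reals_Archimedean2 by blast
  interpret block_weights "tilted_weight \<mu>" x z B
    by unfold_locales (use tilted_weight_nonneg tilted_weight_pos x z B in auto)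
  obtain b where b: "a < b" "ereal b < - fenchel_legendre (Lambda \<mu>) (x, z)"
    using ereal_dense2[OF a] unfolding x_def by auto
  have b': "fenchel_legendre (Lambda \<mu>) (x, z) < ereal (- b)"
    using b(2) by (metis ereal_minus_less_minus ereal_uminus_uminus uminus_ereal.simps(1))
  \<comment> \<open>As \<open>- b\<close> exceeds the supremum, \<Lambda>(s, t) > b + s x + t z for
    every pair, so some partial sum of the series is already large enough.\<close>
  have "\<exists>K. exp b < gen K (s, t)" for s t
  proof -
    have "ereal (s * x + t * z) - Lambda \<mu> (s, t) < ereal (- b)"
      using fenchel_legendre_ge b' by (rule le_less_trans)
    then have L: "ereal (b + s * x + t * z) < Lambda \<mu> (s, t)"
      by (cases "Lambda \<mu> (s, t)") auto
    define S where "S = (\<Sum>l. ennreal (Lambda_term \<mu> s t (Suc l)))"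
    have "ennreal (exp (b + s * x + t * z)) < S"
    proof (cases "S = 0 \<or> S = \<infinity>")
      case True
      then show ?thesis using L by (auto simp: Lambda_def S_def[symmetric] ext_ln_def)
    next
      case False
      then have pos: "0 < enn2real S" by (simp add: enn2real_positive_iff top.not_eq_extremum zero_less_iff_neq_zero)
      have "b + s * x + t * z < ln (enn2real S)"
        using L False by (simp add: Lambda_def S_def[symmetric] ext_ln_def)
      then have "exp (b + s * x + t * z) < enn2real S"
        using pos by (metis exp_less_cancel_iff exp_ln)
      then have "ennreal (exp (b + s * x + t * z)) < ennreal (enn2real S)" by (intro ennreal_lessI pos)
      then show ?thesis using False by (simp add: ennreal_enn2real_if)
    qed
    also have "S = (SUP K. \<Sum>l<K. ennreal (Lambda_term \<mu> s t (Suc l)))"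
      unfolding S_def by (rule suminf_eq_SUP)
    finally obtain K where K: "ennreal (exp (b + s * x + t * z)) < (\<Sum>l<K. ennreal (Lambda_term \<mu> s t (Suc l)))"
      by (auto simp: less_SUP_iff)
    also have "(\<Sum>l<K. ennreal (Lambda_term \<mu> s t (Suc l))) = ennreal (\<Sum>l<K. Lambda_term \<mu> s t (Suc l))"
      by (rule sum_ennreal) (use Lambda_term_nonneg[OF \<mu>(1)] in auto)
    finally have K: "exp (b + s * x + t * z) < (\<Sum>l<K. Lambda_term \<mu> s t (Suc l))"
      by (subst (asm) ennreal_less_iff) auto
    have "(\<Sum>l<K. Lambda_term \<mu> s t (Suc l)) = (\<Sum>l\<in>{1..K}. Lambda_term \<mu> s t l)"
      by (rule sum.reindex_bij_witness[where j = Suc and i = "\<lambda>l. l - 1"]) auto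
    also have "\<dots> = (\<Sum>l\<in>{1..K}. \<Sum>i\<le>K * K. tilted_weight \<mu> l i * exp (s * real l + t * real i))"
      by (intro sum.cong refl Lambda_term_eq) (use \<mu> in \<open>auto intro: mult_le_mono\<close>)
    also have "\<dots> = exp (s * x + t * z) * gen K (s, t)"
      unfolding gen_def blocks_def prod.case sum.cartesian_product sum_distrib_left
      by (intro sum.cong refl) (auto simp: mult_exp_exp algebra_simps)
    finally have "exp (s * x + t * z) * exp b < exp (s * x + t * z) * gen K (s, t)"
      using K by (simp add: exp_add mult_ac)
    then show ?thesis by (intro exI[of _ K]) simp
  qed
  then obtain K where K: "B \<le> K" "\<And>s t. t \<le> 0 \<Longrightarrow> exp b < gen K (s, t)"
    using sublevel_empty[of "exp b"] by blast
  \<comment> \<open>Half of the gap is left for the prefactor, half for the convolution.\<close>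
  define \<epsilon> where "\<epsilon> = (b - a) / 2"
  have \<epsilon>: "0 < \<epsilon>" using b by (simp add: \<epsilon>_def)
  have r: "(\<lambda>k. real (nat \<lfloor>R k\<rfloor>) / real (m k - n k)) \<longlonglongrightarrow> z"
  proof (rule tendsto_sandwich)
    have N_real: "filterlim (\<lambda>k. real (m k - n k)) at_top sequentially"
      by (rule filterlim_compose[OF filterlim_real_sequentially N_lim])
    have "(\<lambda>k. 1 / real (m k - n k)) \<longlonglongrightarrow> 0"
      using tendsto_inverse_0_at_top[OF N_real] by (simp add: inverse_eq_divide)
    from tendsto_diff[OF R this]
    show "(\<lambda>k. (R k - 1) / real (m k - n k)) \<longlonglongrightarrow> z" by (simp add: diff_divide_distrib)
    show "eventually (\<lambda>k. (R k - 1) / real (m k - n k) \<le> real (nat \<lfloor>R k\<rfloor>) / real (m k - n k)) sequentially"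
    proof (intro always_eventually allI divide_right_mono)
      fix k show "R k - 1 \<le> real (nat \<lfloor>R k\<rfloor>)" by linarith
    qed simp
    show "eventually (\<lambda>k. real (nat \<lfloor>R k\<rfloor>) / real (m k - n k) \<le> R k / real (m k - n k)) sequentially"
      using order_tendstoD(1)[OF R z] eventually_N_pos
    proof eventually_elim
      case (elim k)
      then have "0 \<le> R k" by (simp add: zero_less_divide_iff)
      then show ?case by (intro divide_right_mono) auto
    qed
  qed (rule R)
  have cum_conv: "eventually (\<lambda>k. exp (real (m k - n k) * (b - \<epsilon>)) \<le> cum_conv (tilted_weight \<mu>) (m k - n k) (m k) (nat \<lfloor>R k\<rfloor>)) sequentially"
    by (rule cum_conv_lower[OF N_lim _ r K \<epsilon>]) (use m_over_N in \<open>simp add: x_def\<close>)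
  have "eventually (\<lambda>k. - \<epsilon> < ln (prefactor \<mu> (m k) (n k)) / real (m k - n k)) sequentially"
    by (rule order_tendstoD(1)[OF prefactor_rate]) (use \<epsilon> in simp)
  then show ?thesis using cum_conv order_tendstoD(1)[OF R z] eventually_N_pos
  proof eventually_elim
    case (elim k)
    define N where "N = real (m k - n k)"
    have N: "0 < N" and nm: "n k < m k" using elim by (auto simp: N_def)
    have R0: "0 \<le> R k" using elim by (simp add: zero_less_divide_iff)
    have "- \<epsilon> * N < ln (prefactor \<mu> (m k) (n k))" using elim(1) N by (simp add: N_def pos_less_divide_eq)
    then have "exp (- \<epsilon> * N) \<le> prefactor \<mu> (m k) (n k)"
      using prefactor_pos[OF nm] by (metis exp_le_cancel_iff exp_ln less_imp_le)
    then have "exp (- \<epsilon> * N) * exp (N * (b - \<epsilon>)) \<le> prefactor \<mu> (m k) (n k) * cum_conv (tilted_weight \<mu>) (m k - n k) (m k) (nat \<lfloor>R k\<rfloor>)"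
      using elim(2) prefactor_pos[OF nm] by (intro mult_mono) (auto simp: N_def)
    moreover have "exp (- \<epsilon> * N) * exp (N * (b - \<epsilon>)) = exp (N * a)"
      by (simp add: mult_exp_exp \<epsilon>_def field_simps)
    ultimately have "exp (N * a) \<le> measure_pmf.prob (addresses (m k) (n k)) {hs. real (total_displacement (m k) hs) \<le> R k}"
      by (simp add: prob_R[OF nm R0])
    then show ?case using ext_rate_ge[OF N] by (simp add: N_def)
  qed
qed

lemma rate_limit:
  assumes R0: "z = 0 \<Longrightarrow> eventually (\<lambda>k. 0 \<le> R k) sequentially"
  shows "rate \<longlonglongrightarrow> - fenchel_legendre (Lambda \<mu>) (1 / (1 - \<mu>), z)"
proof (rule order_tendstoI)
  fix a :: ereal
  assume "a < - fenchel_legendre (Lambda \<mu>) (1 / (1 - \<mu>), z)"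
  from ereal_dense2[OF this] obtain b where b: "a < ereal b" "ereal b < - fenchel_legendre (Lambda \<mu>) (1 / (1 - \<mu>), z)"
    by blast
  have "eventually (\<lambda>k. ereal b \<le> rate k) sequentially"
  proof (cases z "0 :: real" rule: linorder_cases)
    \<comment> \<open>The claimed limit is \<open>-\<infinity>\<close>, so nothing lies below it and
      \<open>b(2)\<close> is contradictory.\<close>
    case less
    then show ?thesis using Lambda_star_negative[of "1 / (1 - \<mu>)"] b(2) by simp
  next
    case equal
    then show ?thesis using rate_lower_zero[OF _ R0 b(2)] by simp
  next
    case greater
    then show ?thesis by (rule rate_lower_pos[OF _ b(2)])
  qed
  then show "eventually (\<lambda>k. a < rate k) sequentially"
  proof eventually_elim
    case (elim k)
    with b(1) show ?case by (rule less_le_trans)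
  qed
next
  fix a :: ereal
  assume "- fenchel_legendre (Lambda \<mu>) (1 / (1 - \<mu>), z) < a"
  from ereal_dense2[OF this] obtain b where b: "- fenchel_legendre (Lambda \<mu>) (1 / (1 - \<mu>), z) < ereal b" "ereal b < a"
    by blast
  show "eventually (\<lambda>k. rate k < a) sequentially"
    using rate_upper[OF b(1)]
  proof eventually_elim
    case (elim k)
    then show ?case using b(2) by (rule le_less_trans)
  qed
qed

end

end

text \<open>\<open>critical\<close> concerns the one value of \<open>y\<close> with
  \<open>z = 0\<close>: there the limits do not decide the sign of the threshold, and a negative
  threshold makes the event impossible although the limit is finite.\<close>

theorem theorem8:
  fixes \<mu> y :: real and m n :: "nat \<Rightarrow> nat"
  assumes \<mu>: "0 < \<mu>" "\<mu> < 1"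
    and mn: "\<And>k. 1 \<le> m k" "\<And>k. n k \<le> m k"
    and m_lim: "filterlim m at_top sequentially"
    and ratio: "(\<lambda>k. real (n k) / real (m k)) \<longlonglongrightarrow> \<mu>"
    and y: "0 \<le> y"
    and critical: "y = \<mu>\<^sup>2 / (2 * (1 - \<mu>)\<^sup>2) \<Longrightarrow>
      eventually (\<lambda>k. real (m k - n k) * y \<le> expected_displacement (m k) (n k)) sequentially"
  shows "(\<lambda>k. ereal (1 / real (m k - n k)) *
            ext_ln (ennreal (measure_pmf.prob (addresses (m k) (n k))
              {hs. real (total_displacement (m k) hs) - expected_displacement (m k) (n k)
                     \<le> - real (m k - n k) * y})))
         \<longlonglongrightarrow> - fenchel_legendre (Lambda \<mu>) (1 / (1 - \<mu>), \<mu>\<^sup>2 / (2 * (1 - \<mu>)\<^sup>2) - y)"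
proof -
  note ctx = \<mu> mn m_lim ratio
  define R where "R k = expected_displacement (m k) (n k) - real (m k - n k) * y" for k
  have "(\<lambda>k. expected_displacement (m k) (n k) / real (m k - n k) - y) \<longlonglongrightarrow> \<mu>\<^sup>2 / (2 * (1 - \<mu>)\<^sup>2) - y"
    by (intro tendsto_intros expected_rate[OF ctx])
  moreover have "eventually (\<lambda>k. expected_displacement (m k) (n k) / real (m k - n k) - y = R k / real (m k - n k)) sequentially"
    using eventually_N_pos[OF ctx] by eventually_elim (simp add: R_def field_simps)
  ultimately have R: "(\<lambda>k. R k / real (m k - n k)) \<longlonglongrightarrow> \<mu>\<^sup>2 / (2 * (1 - \<mu>)\<^sup>2) - y"
    by (rule Lim_transform_eventually)
  have R0: "eventually (\<lambda>k. 0 \<le> R k) sequentially" if "\<mu>\<^sup>2 / (2 * (1 - \<mu>)\<^sup>2) - y = 0"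
    using critical that by (simp add: R_def)
  have "real d - expected_displacement (m k) (n k) \<le> - real (m k - n k) * y \<longleftrightarrow> real d \<le> R k" for d k
    by (auto simp: R_def)
  then show ?thesis using rate_limit[OF ctx R R0] by simp
qed

end
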